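(* Let $k\ge 0$ be an integer and let $f\colon X\to Y$ be a map between compacta. Then $f$ admits approximation by $k$-dimensional simplicial maps if and only if there exists a map $g\colon X\to \mathbf I^k$ such that $\dim(f\bigtriangleup g)\le 0$.
   Context: All spaces are separable metrizable; a map is a continuous function; a compactum is a compact (metrizable) space; $\dim$ is covering dimension; $\mathbf I=[0,1]$. For a map $h$, $\dim h\le m$ means each fiber of $h$ has dimension at most $m$; such a map is called $m$-dimensional. The diagonal product of $f\colon X\to Y$ and $g\colon X\to Z$ is $f\bigtriangleup g\colon X\to Y\times Z$, $(f\bigtriangleup g)(x)=(f(x),g(x))$. For a simplicial complex $\mathcal K$, $|\mathcal K|$ is the corresponding polyhedron; a simplicial map $|\mathcal K|\to|\mathcal L|$ is a map sending simplices to simplices and affine on each of them. For an open cover $\omega$ of $X$, a map $\kappa\colon X\to Z$ is an $\omega$-map if $Z$ has an open cover such that the preimage of each of its members is contained in some member of $\omega$. A map $f\colon X\to Y$ admits approximation by $k$-dimensional simplicial maps if for every open cover $\omega_X$ of $X$ and every open cover $\omega_Y$ of $Y$ there exist polyhedra $|\mathcal K|,|\mathcal L|$, an $\omega_X$-map $\kappa_X\colon X\to|\mathcal K|$, an $\omega_Y$-map $\kappa_Y\colon Y\to|\mathcal L|$ and a $k$-dimensional simplicial map $p\colon|\mathcal K|\to|\mathcal L|$ with $p\circ\kappa_X=\kappa_Y\circ f$. *)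

theory Defs
  imports "HOL-Analysis.Analysis"
begin

section \<open>Open covers, covering dimension, dimension of maps\<close>

definition open_cover :: "'a topology \<Rightarrow> 'a set set \<Rightarrow> bool" where
  "open_cover X \<U> \<longleftrightarrow> (\<forall>U\<in>\<U>. openin X U) \<and> \<Union>\<U> = topspace X"

definition refines :: "'a set set \<Rightarrow> 'a set set \<Rightarrow> bool" where
  "refines \<V> \<U> \<longleftrightarrow> (\<forall>V\<in>\<V>. \<exists>U\<in>\<U>. V \<subseteq> U)"

text \<open>The inequality \<open>dim X \<le> n\<close> for the covering dimension. The library's \<^const>\<open>dimension_le\<close>
  is the small inductive dimension. The empty space (of dimension \<open>-1\<close>) satisfies the inequality
  for all \<open>n\<close>.\<close>

definition covering_dim_le :: "'a topology \<Rightarrow> nat \<Rightarrow> bool" where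
  "covering_dim_le X n \<longleftrightarrow>
    (\<forall>\<U>. finite \<U> \<and> open_cover X \<U> \<longrightarrow>
      (\<exists>\<V>. finite \<V> \<and> open_cover X \<V> \<and> refines \<V> \<U> \<and>
           (\<forall>x\<in>topspace X. card {V\<in>\<V>. x \<in> V} \<le> n + 1)))"

definition map_dim_le :: "'a topology \<Rightarrow> 'b topology \<Rightarrow> ('a \<Rightarrow> 'b) \<Rightarrow> nat \<Rightarrow> bool" where
  "map_dim_le X Y h m \<longleftrightarrow>
    (\<forall>y\<in>topspace Y. covering_dim_le (subtopology X {x \<in> topspace X. h x = y}) m)"

definition omega_map :: "'a topology \<Rightarrow> 'a set set \<Rightarrow> 'b topology \<Rightarrow> ('a \<Rightarrow> 'b) \<Rightarrow> bool" where
  "omega_map X \<omega> Z \<kappa> \<longleftrightarrow> continuous_map X Z \<kappa> \<and>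
    (\<exists>\<V>. open_cover Z \<V> \<and> (\<forall>V\<in>\<V>. \<exists>U\<in>\<omega>. {x \<in> topspace X. \<kappa> x \<in> V} \<subseteq> U))"

text \<open>\<open>cube k\<close> is the power of the unit interval indexed by \<open>{..<k}\<close>; for \<open>k = 0\<close> it is a point.\<close>

definition cube :: "nat \<Rightarrow> (nat \<Rightarrow> real) topology" where
  "cube k = product_topology (\<lambda>_. top_of_set {0..1}) {..<k}"

definition diagonal_product :: "('a \<Rightarrow> 'b) \<Rightarrow> ('a \<Rightarrow> 'c) \<Rightarrow> 'a \<Rightarrow> 'b \<times> 'c" where
  "diagonal_product f g = (\<lambda>x. (f x, g x))"

section \<open>Simplicial complexes and polyhedra\<close>

text \<open>Vertices are natural numbers. Since only separable polyhedra occur and the vertices form a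
  closed discrete subset of the polyhedron, the vertex set is always countable, so that up to
  isomorphism no complex is lost. The complex may be infinite, and it may be empty.
  The library's \<^const>\<open>simplicial_complex\<close> only covers finite complexes in a Euclidean space whose
  dimension is fixed by the type.\<close>

definition abstract_complex :: "nat set set \<Rightarrow> bool" where
  "abstract_complex K \<longleftrightarrow>
    (\<forall>s\<in>K. finite s \<and> s \<noteq> {} \<and> (\<forall>t. t \<subseteq> s \<and> t \<noteq> {} \<longrightarrow> t \<in> K))"

text \<open>The closed simplex spanned by \<open>s\<close>, in barycentric coordinates.\<close>

definition closed_simplex :: "nat set \<Rightarrow> (nat \<Rightarrow> real) set" where
  "closed_simplex s = {a. (\<forall>v. 0 \<le> a v) \<and> (\<forall>v. v \<notin> s \<longrightarrow> a v = 0) \<and> (\<Sum>v\<in>s. a v) = 1}"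

text \<open>The polyhedron \<open>|K|\<close> with the weak (Whitehead) topology: a set is open iff it meets every
  closed simplex in a relatively open set. On a single simplex, the topology of pointwise
  convergence of \<^typ>\<open>nat \<Rightarrow> real\<close> is the Euclidean one.\<close>

definition polyhedron_of :: "nat set set \<Rightarrow> (nat \<Rightarrow> real) topology" where
  "polyhedron_of K = topology (\<lambda>U. U \<subseteq> (\<Union>s\<in>K. closed_simplex s) \<and>
     (\<forall>s\<in>K. openin (top_of_set (closed_simplex s)) (U \<inter> closed_simplex s)))"

lemma openin_polyhedron_of:
  "openin (polyhedron_of K) U \<longleftrightarrow> U \<subseteq> (\<Union>s\<in>K. closed_simplex s) \<and>
     (\<forall>s\<in>K. openin (top_of_set (closed_simplex s)) (U \<inter> closed_simplex s))"
proof -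
  let ?P = "\<lambda>U. U \<subseteq> (\<Union>s\<in>K. closed_simplex s) \<and>
     (\<forall>s\<in>K. openin (top_of_set (closed_simplex s)) (U \<inter> closed_simplex s))"
  have "istopology ?P"
    unfolding istopology_def
  proof (intro conjI allI impI)
    fix S T assume S: "?P S" and T: "?P T"
    have "(S \<inter> T) \<inter> closed_simplex s = (S \<inter> closed_simplex s) \<inter> (T \<inter> closed_simplex s)" for s
      by blast
    with S T show "S \<inter> T \<subseteq> (\<Union>s\<in>K. closed_simplex s)"
      and "\<forall>s\<in>K. openin (top_of_set (closed_simplex s)) (S \<inter> T \<inter> closed_simplex s)"
      by (auto intro: openin_Int)
  next
    fix \<K> assume *: "\<forall>S\<in>\<K>. ?P S"
    then show "\<Union>\<K> \<subseteq> (\<Union>s\<in>K. closed_simplex s)"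
      by blast
    show "\<forall>s\<in>K. openin (top_of_set (closed_simplex s)) (\<Union>\<K> \<inter> closed_simplex s)"
    proof
      fix s assume "s \<in> K"
      with * have "openin (top_of_set (closed_simplex s)) (\<Union>S\<in>\<K>. S \<inter> closed_simplex s)"
        by (intro openin_Union) blast
      then show "openin (top_of_set (closed_simplex s)) (\<Union>\<K> \<inter> closed_simplex s)"
        by (simp only: Int_Union2)
    qed
  qed
  then show ?thesis
    unfolding polyhedron_of_def by (simp add: topology_inverse')
qed

lemma topspace_polyhedron_of: "topspace (polyhedron_of K) = (\<Union>s\<in>K. closed_simplex s)"
proof (rule antisym)
  show "topspace (polyhedron_of K) \<subseteq> (\<Union>s\<in>K. closed_simplex s)"
    by (meson openin_polyhedron_of openin_topspace)
  have "(\<Union>s\<in>K. closed_simplex s) \<inter> closed_simplex s = closed_simplex s" if "s \<in> K" for s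
    using that by blast
  then have "openin (polyhedron_of K) (\<Union>s\<in>K. closed_simplex s)"
    by (auto simp: openin_polyhedron_of)
  then show "(\<Union>s\<in>K. closed_simplex s) \<subseteq> topspace (polyhedron_of K)"
    by (rule openin_subset)
qed

text \<open>All spaces are separable metrizable; for polyhedra this is a condition on the complex (with
  the weak topology, it says that the complex is locally finite).\<close>

definition admissible_complex :: "nat set set \<Rightarrow> bool" where
  "admissible_complex K \<longleftrightarrow> abstract_complex K \<and>
     separable_space (polyhedron_of K) \<and> metrizable_space (polyhedron_of K)"

text \<open>Affinity is spelled out coordinatewise because \<^typ>\<open>nat \<Rightarrow> real\<close> is not an instance of
  \<^class>\<open>real_vector\<close>.\<close>

definition simplicial_map ::
    "nat set set \<Rightarrow> nat set set \<Rightarrow> ((nat \<Rightarrow> real) \<Rightarrow> (nat \<Rightarrow> real)) \<Rightarrow> bool" where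
  "simplicial_map K L p \<longleftrightarrow> continuous_map (polyhedron_of K) (polyhedron_of L) p \<and>
     (\<forall>s\<in>K. (\<exists>t\<in>L. p ` closed_simplex s = closed_simplex t) \<and>
       (\<forall>a\<in>closed_simplex s. \<forall>b\<in>closed_simplex s. \<forall>u\<in>{0..1}.
          p (\<lambda>v. (1 - u) * a v + u * b v) = (\<lambda>w. (1 - u) * p a w + u * p b w)))"

definition approx_by_simplicial_maps ::
    "nat \<Rightarrow> 'a topology \<Rightarrow> 'b topology \<Rightarrow> ('a \<Rightarrow> 'b) \<Rightarrow> bool" where
  "approx_by_simplicial_maps k X Y f \<longleftrightarrow>
    (\<forall>\<omega>X \<omega>Y. open_cover X \<omega>X \<and> open_cover Y \<omega>Y \<longrightarrow>
      (\<exists>K L \<kappa>X \<kappa>Y p. admissible_complex K \<and> admissible_complex L \<and>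
         omega_map X \<omega>X (polyhedron_of K) \<kappa>X \<and>
         omega_map Y \<omega>Y (polyhedron_of L) \<kappa>Y \<and>
         simplicial_map K L p \<and>
         map_dim_le (polyhedron_of K) (polyhedron_of L) p k \<and>
         (\<forall>x\<in>topspace X. p (\<kappa>X x) = \<kappa>Y (f x))))"

definition compactum :: "'a topology \<Rightarrow> bool" where
  "compactum X \<longleftrightarrow> compact_space X \<and> metrizable_space X"

end

theory Submission
  imports Defs
begin

text \<open>Say that a set splits over an open cover if it lies in a finite disjoint union of open sets that are
  subordinate to the cover; a closed subset of a compactum is zero-dimensional iff it splits over every
  open cover, and by compactness splitting of all fibres of \<open>(f, g)\<close> survives small perturbations of \<open>g\<close>.

  Given simplicial approximations \<open>p \<circ> \<kappa> = \<kappa>Y \<circ> f\<close> of \<open>f\<close>, the fibres of \<open>p\<close> are \<open>k\<close>-dimensional,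
  so a simplex \<open>s\<close> has at most \<open>k\<close> more vertices than its image. Hence any
  \<open>g\<close> is close to a function that is piecewise linear in the barycentric coordinates of
  \<open>\<kappa>\<close>, and, after a general position perturbation, injective on the fibres of \<open>p\<close> in each linear piece. The
  fibres of \<open>(f, g)\<close> then have finite image under \<open>\<kappa>\<close> and split. A uniform limit of such
  functions for finer and finer covers is the required \<open>g\<close>.

  Conversely, take a fine partition of unity on \<open>Y\<close>, and cut \<open>X\<close> over the support of its function number \<open>v\<close>
  along the preimages under \<open>g\<close> of \<open>k + 1\<close> shifted cubical grids of its own. All grids being
  distinct, a point of the cube lies near at most \<open>k\<close> of them; so a point of \<open>X\<close> lies in at most \<open>k\<close> pieces
  more than in supports, and no nerve is needed: the full simplex serves as \<open>L\<close>, and \<open>K\<close> consists of all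
  sets of pieces whose excess over their image is at most \<open>k\<close>.\<close>

section \<open>Splitting over open covers\<close>

text \<open>Splitting over one fixed cover is an open and dense condition on \<open>g\<close>, so
  the forward direction is a Baire category argument carried out by hand. Density is the hard half:
  \<open>g\<close> need not factor through \<kappa>, which only pulls a cover back. Hence the covers
  are refined until \<open>g\<close> hardly varies on their members, and the L1 distance of
  barycentric coordinates yields a function of \<kappa> close to \<open>g\<close>. The bound on the
  number of vertices rests on the fact that an \<open>n\<close>-cube has covering dimension at least
  \<open>n\<close>, hence on Brouwer's theorem. In the converse, grids shared by all vertices of
  \<open>L\<close> would allow \<open>k\<close> extra pieces over each vertex separately. Giving
  every vertex its own \<open>k + 1\<close> shifts makes \<open>k\<close> a bound on the total
  excess, and it is the total excess that controls the dimension of the fibres of the simplicial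
  map. The latter is seen by the tools already at hand, general position and shifted grids.\<close>

lemma compact_space_point_cover:
  assumes "compact_space X" and "\<And>x. x \<in> topspace X \<Longrightarrow> openin X (N x) \<and> x \<in> N x"
  obtains F where "finite F" "F \<subseteq> topspace X" "topspace X \<subseteq> (\<Union>x\<in>F. N x)"
proof -
  have "\<exists>\<F>. finite \<F> \<and> \<F> \<subseteq> N ` topspace X \<and> topspace X \<subseteq> \<Union>\<F>"
    by (rule assms(1)[unfolded compact_space_alt, rule_format]) (use assms(2) in auto)
  then obtain \<F> where "finite \<F>" "\<F> \<subseteq> N ` topspace X" "topspace X \<subseteq> \<Union>\<F>" by blast
  then show ?thesis
    using finite_subset_image[of \<F> N "topspace X"] that by metis
qed

lemma openin_real_less:
  assumes "continuous_map X euclideanreal \<phi>"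
  shows "openin X {x \<in> topspace X. \<phi> x < c}" "openin X {x \<in> topspace X. c < \<phi> x}"
  using openin_continuous_map_preimage[OF assms, of "{..<c}"]
    openin_continuous_map_preimage[OF assms, of "{c<..}"] by auto

lemma closedin_fibre:
  assumes "continuous_map X Z h" "Hausdorff_space Z"
  shows "closedin X {x \<in> topspace X. h x = z}"
proof (cases "z \<in> topspace Z")
  case True
  then have "closedin Z {z}"
    using assms(2) by (simp add: closedin_Hausdorff_sing_eq)
  from closedin_continuous_map_preimage[OF assms(1) this] show ?thesis by simp
next
  case False
  then have "{x \<in> topspace X. h x = z} = {}"
    using continuous_map_image_subset_topspace[OF assms(1)] by auto
  then show ?thesis by (simp only: closedin_empty)
qed

text \<open>\<open>D\<close> may vanish off the diagonal, so balls shrink to zero sets rather than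
  to points. By compactness \<open>D x\<close> is a closed map, hence some ball around
  \<open>x\<close> fits into any open set containing the zero set; a finite subcover then gives
  \<delta> as usual. Applied below to a metric and to pseudometrics built from \<open>f\<close>,
  \<open>g\<close> and \<kappa>.\<close>

lemma pseudometric_lebesgue_number:
  fixes D :: "'a \<Rightarrow> 'a \<Rightarrow> real"
  assumes X: "compact_space X"
    and cont: "\<And>x. x \<in> topspace X \<Longrightarrow> continuous_map X euclideanreal (D x)"
    and nonneg: "\<And>x y. x \<in> topspace X \<Longrightarrow> y \<in> topspace X \<Longrightarrow> 0 \<le> D x y"
    and refl: "\<And>x. x \<in> topspace X \<Longrightarrow> D x x = 0"
    and tri: "\<And>x y z. x \<in> topspace X \<Longrightarrow> y \<in> topspace X \<Longrightarrow> z \<in> topspace X \<Longrightarrow> D x z \<le> D x y + D y z"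
    and cover: "\<And>x. x \<in> topspace X \<Longrightarrow> \<exists>U\<in>\<O>. openin X U \<and> {y \<in> topspace X. D x y = 0} \<subseteq> U"
  obtains \<delta> where "0 < \<delta>"
    "\<And>x. x \<in> topspace X \<Longrightarrow> \<exists>U\<in>\<O>. {y \<in> topspace X. D x y < \<delta>} \<subseteq> U"
proof -
  have "\<forall>x\<in>topspace X. \<exists>r>0. \<exists>U\<in>\<O>. {y \<in> topspace X. D x y < 2 * r} \<subseteq> U"
  proof
    fix x assume x: "x \<in> topspace X"
    obtain U where U: "U \<in> \<O>" "openin X U" "{y \<in> topspace X. D x y = 0} \<subseteq> U"
      using cover[OF x] by blast
    have "closed_map X euclideanreal (D x)"
      using X cont[OF x] by (intro continuous_imp_closed_map) auto
    then obtain V where V: "open V" "0 \<in> V" "{y \<in> topspace X. D x y \<in> V} \<subseteq> U"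
      using U(2,3) unfolding closed_map_fibre_neighbourhood by force
    then obtain e where "e > 0" and e: "\<And>t. dist t 0 < e \<Longrightarrow> t \<in> V"
      using open_dist by blast
    then have "{y \<in> topspace X. D x y < 2 * (e / 2)} \<subseteq> U"
      using V(3) nonneg[OF x] by (auto simp: dist_real_def)
    then show "\<exists>r>0. \<exists>U\<in>\<O>. {y \<in> topspace X. D x y < 2 * r} \<subseteq> U"
      using U(1) \<open>e > 0\<close> by (intro exI[of _ "e/2"]) auto
  qed
  from bchoice[OF this] obtain r where Ur: "\<And>x. x \<in> topspace X \<Longrightarrow>
      0 < r x \<and> (\<exists>U\<in>\<O>. {y \<in> topspace X. D x y < 2 * r x} \<subseteq> U)"
    by auto
  obtain F where F: "finite F" "F \<subseteq> topspace X"
      "topspace X \<subseteq> (\<Union>x\<in>F. {y \<in> topspace X. D x y < r x})"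
  proof (rule compact_space_point_cover[OF X, of "\<lambda>x. {y \<in> topspace X. D x y < r x}"])
    show "openin X {y \<in> topspace X. D x y < r x} \<and> x \<in> {y \<in> topspace X. D x y < r x}"
      if "x \<in> topspace X" for x
      using that Ur refl openin_real_less(1)[OF cont] by auto
  qed
  \<comment> \<open>The element 1 keeps \<open>Min\<close> meaningful when \<open>F\<close> is
    empty, as it is for empty \<open>X\<close>.\<close>
  define \<delta> where "\<delta> = Min (insert 1 (r ` F))"
  show ?thesis
  proof
    show "0 < \<delta>" using F Ur by (auto simp: \<delta>_def)
    fix x assume x: "x \<in> topspace X"
    then obtain z where z: "z \<in> F" "D z x < r z" using F(3) by blast
    then have zX: "z \<in> topspace X" using F(2) by blast
    have "\<delta> \<le> r z" using F(1) z(1) by (simp add: \<delta>_def)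
    then have "{y \<in> topspace X. D x y < \<delta>} \<subseteq> {y \<in> topspace X. D z y < 2 * r z}"
      using tri[OF zX x] z(2) by fastforce
    then show "\<exists>U\<in>\<O>. {y \<in> topspace X. D x y < \<delta>} \<subseteq> U"
      using Ur[OF zX] by blast
  qed
qed

text \<open>Normalised Urysohn functions. They are numbered because they later serve as vertices;
  several of them may lie in the same member of \<open>\<U>\<close>.\<close>

lemma finite_partition_of_unity:
  assumes Y: "compact_space Y" "Hausdorff_space Y" and cov: "open_cover Y \<U>"
  obtains m :: nat and \<phi> where
    "\<And>i. i < m \<Longrightarrow> continuous_map Y euclideanreal (\<phi> i)"
    "\<And>i y. i < m \<Longrightarrow> y \<in> topspace Y \<Longrightarrow> 0 \<le> \<phi> i y"
    "\<And>i. i < m \<Longrightarrow> \<exists>U\<in>\<U>. {y \<in> topspace Y. 0 < \<phi> i y} \<subseteq> U"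
    "\<And>y. y \<in> topspace Y \<Longrightarrow> (\<Sum>i<m. \<phi> i y) = 1"
proof -
  have cr: "completely_regular_space Y"
    using Y compact_Hausdorff_or_regular_imp_normal_space normal_imp_completely_regular_space by blast
  have "\<forall>y\<in>topspace Y. \<exists>h. continuous_map Y euclideanreal h \<and> (\<forall>z\<in>topspace Y. 0 \<le> h z) \<and> 0 < h y \<and>
      (\<exists>U\<in>\<U>. {z \<in> topspace Y. 0 < h z} \<subseteq> U)"
  proof
    fix y assume y: "y \<in> topspace Y"
    obtain U where U: "U \<in> \<U>" "openin Y U" "y \<in> U"
      using cov y unfolding open_cover_def by blast
    then have "closedin Y (topspace Y - U)" "y \<in> topspace Y - (topspace Y - U)" using y by auto
    then obtain h :: "_ \<Rightarrow> real" where h: "continuous_map Y (top_of_set {0..1}) h" "h y = 0"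
        "h ` (topspace Y - U) \<subseteq> {1}"
      using cr unfolding completely_regular_space_def by blast
    have h': "continuous_map Y euclideanreal h" "\<And>z. z \<in> topspace Y \<Longrightarrow> h z \<in> {0..1}"
      using h(1) by (auto simp: continuous_map_in_subtopology)
    have "continuous_map Y euclideanreal (\<lambda>z. 1 - h z)"
      by (intro continuous_intros h')
    moreover have "{z \<in> topspace Y. 0 < 1 - h z} \<subseteq> U" using h(3) by fastforce
    moreover have "0 < 1 - h y" "\<forall>z\<in>topspace Y. 0 \<le> 1 - h z" using h h' by auto
    ultimately show "\<exists>h. continuous_map Y euclideanreal h \<and> (\<forall>z\<in>topspace Y. 0 \<le> h z) \<and> 0 < h y \<and>
      (\<exists>U\<in>\<U>. {z \<in> topspace Y. 0 < h z} \<subseteq> U)" using U(1) by (intro exI[of _ "\<lambda>z. 1 - h z"]) blast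
  qed
  from bchoice[OF this] obtain h where h: "\<And>y. y \<in> topspace Y \<Longrightarrow> continuous_map Y euclideanreal (h y)
      \<and> (\<forall>z\<in>topspace Y. 0 \<le> h y z) \<and> 0 < h y y \<and> (\<exists>U\<in>\<U>. {z \<in> topspace Y. 0 < h y z} \<subseteq> U)"
    by blast
  have hc: "continuous_map Y euclideanreal (h y)" if "y \<in> topspace Y" for y using h[OF that] by blast
  have h0: "0 \<le> h y z" if "y \<in> topspace Y" "z \<in> topspace Y" for y z using h[OF that(1)] that(2) by blast
  obtain F where F: "finite F" "F \<subseteq> topspace Y"
      "topspace Y \<subseteq> (\<Union>y\<in>F. {z \<in> topspace Y. 0 < h y z})"
  proof (rule compact_space_point_cover[OF Y(1), of "\<lambda>y. {z \<in> topspace Y. 0 < h y z}"])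
    show "openin Y {z \<in> topspace Y. 0 < h y z} \<and> y \<in> {z \<in> topspace Y. 0 < h y z}"
      if "y \<in> topspace Y" for y
      using that h[OF that] openin_real_less(2)[of Y "h y" 0] by auto
  qed
  obtain e where e: "bij_betw e {..<card F} F"
    using ex_bij_betw_nat_finite[OF F(1)] by (auto simp: lessThan_atLeast0)
  define S where "S z = (\<Sum>y\<in>F. h y z)" for z
  have Spos: "0 < S z" if z: "z \<in> topspace Y" for z
  proof -
    obtain y where "y \<in> F" "0 < h y z" using F(3) z by blast
    then show ?thesis unfolding S_def
      using F(1,2) h0 z by (intro sum_pos2[of _ y]) auto
  qed
  have Sc: "continuous_map Y euclideanreal S" unfolding S_def
    using F(1,2) hc by (intro continuous_intros) auto
  have eF: "e i \<in> F" "e i \<in> topspace Y" if "i < card F" for i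
    using e that F(2) by (auto simp: bij_betw_def)
  show ?thesis
  proof
    fix i assume i: "i < card F"
    show "continuous_map Y euclideanreal (\<lambda>z. h (e i) z / S z)"
    proof (intro continuous_map_real_divide hc eF i Sc)
      show "S z \<noteq> 0" if "z \<in> topspace Y" for z using Spos[OF that] by simp
    qed
    show "0 \<le> h (e i) z / S z" if "z \<in> topspace Y" for z
      using h0[OF eF(2)[OF i] that] Spos[OF that] by simp
    have "{z \<in> topspace Y. 0 < h (e i) z / S z} \<subseteq> {z \<in> topspace Y. 0 < h (e i) z}"
    proof clarify
      fix z assume "z \<in> topspace Y" "0 < h (e i) z / S z"
      then show "0 < h (e i) z" using Spos[of z] by (simp add: zero_less_divide_iff)
    qed
    then show "\<exists>U\<in>\<U>. {z \<in> topspace Y. 0 < h (e i) z / S z} \<subseteq> U"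
      using h[OF eF(2)[OF i]] by blast
  next
    fix z assume z: "z \<in> topspace Y"
    have "(\<Sum>i<card F. h (e i) z) = S z"
      unfolding S_def using sum.reindex_bij_betw[OF e, of "\<lambda>y. h y z"] by simp
    then show "(\<Sum>i<card F. h (e i) z / S z) = 1"
      using Spos[OF z] by (simp flip: sum_divide_distrib)
  qed
qed

text \<open>Zero-dimensionality of \<open>F\<close> at the scale of one cover. The pieces are open
  in \<open>X\<close> rather than in \<open>F\<close>, so the condition passes to a neighbourhood of
  \<open>F\<close>; this makes it stable under perturbation.\<close>

definition splits :: "'a topology \<Rightarrow> 'a set set \<Rightarrow> 'a set \<Rightarrow> bool" where
  "splits X \<omega> F \<longleftrightarrow> (\<exists>\<W>. finite \<W> \<and> (\<forall>W\<in>\<W>. openin X W \<and> (\<exists>U\<in>\<omega>. W \<subseteq> U)) \<and>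
     pairwise disjnt \<W> \<and> F \<subseteq> \<Union>\<W>)"

lemma splitsI:
  assumes "finite \<W>" "\<And>W. W \<in> \<W> \<Longrightarrow> openin X W" "\<And>W. W \<in> \<W> \<Longrightarrow> \<exists>U\<in>\<omega>. W \<subseteq> U"
    "pairwise disjnt \<W>" "F \<subseteq> \<Union>\<W>"
  shows "splits X \<omega> F"
  using assms unfolding splits_def by (intro exI[of _ \<W>]) simp

lemma splitsE:
  assumes "splits X \<omega> F"
  obtains \<W> where "finite \<W>" "\<And>W. W \<in> \<W> \<Longrightarrow> openin X W" "\<And>W. W \<in> \<W> \<Longrightarrow> \<exists>U\<in>\<omega>. W \<subseteq> U"
    "pairwise disjnt \<W>" "F \<subseteq> \<Union>\<W>"
  using assms unfolding splits_def by auto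

lemma splits_mono: "splits X \<omega> F \<Longrightarrow> G \<subseteq> F \<Longrightarrow> splits X \<omega> G"
  by (erule splitsE, rule splitsI, assumption+) auto

lemma splits_empty [simp]: "splits X \<omega> {}"
  unfolding splits_def by (intro exI[of _ "{}"]) auto

lemma splits_refines: "splits X \<omega> F \<Longrightarrow> refines \<omega> \<omega>' \<Longrightarrow> splits X \<omega>' F"
  unfolding refines_def by (erule splitsE, rule splitsI, assumption+) (meson order_trans, assumption+)

lemma disjoint_closed_separate:
  assumes X: "normal_space X" and "finite I"
    and C: "\<And>i. i \<in> I \<Longrightarrow> closedin X (C i)" and U: "\<And>i. i \<in> I \<Longrightarrow> openin X (U i) \<and> C i \<subseteq> U i"
    and dis: "\<And>i j. i \<in> I \<Longrightarrow> j \<in> I \<Longrightarrow> i \<noteq> j \<Longrightarrow> disjnt (C i) (C j)"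
  obtains W where "\<And>i. i \<in> I \<Longrightarrow> openin X (W i) \<and> C i \<subseteq> W i \<and> W i \<subseteq> U i"
    "\<And>i j. i \<in> I \<Longrightarrow> j \<in> I \<Longrightarrow> i \<noteq> j \<Longrightarrow> disjnt (W i) (W j)"
proof -
  define P where "P i j p \<longleftrightarrow> openin X (fst p) \<and> openin X (snd p) \<and> C i \<subseteq> fst p \<and> C j \<subseteq> snd p \<and>
    disjnt (fst p) (snd p)" for i j p
  define q where "q i j = (SOME p. P i j p)" for i j
  have q: "P i j (q i j)" if "i \<in> I" "j \<in> I" "i \<noteq> j" for i j
  proof -
    have "\<exists>a b. openin X a \<and> openin X b \<and> C i \<subseteq> a \<and> C j \<subseteq> b \<and> disjnt a b"
      by (rule X[unfolded normal_space_def, rule_format]) (use C that dis in auto)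
    then obtain a b where "openin X a" "openin X b" "C i \<subseteq> a" "C j \<subseteq> b" "disjnt a b" by blast
    then have "P i j (a, b)" by (simp add: P_def)
    then show ?thesis unfolding q_def by (rule someI)
  qed
  \<comment> \<open>\<open>q i j\<close> and \<open>q j i\<close> are chosen independently; taking
    one half of each puts \<open>W i\<close> and \<open>W j\<close> into the two disjoint halves of
    the single pair \<open>q i j\<close>.\<close>
  define N where "N i j = fst (q i j) \<inter> snd (q j i)" for i j
  have N: "openin X (N i j) \<and> C i \<subseteq> N i j" if "i \<in> I" "j \<in> I" "i \<noteq> j" for i j
    using q[OF that] q[OF that(2,1)] that(3) unfolding P_def N_def by auto
  define W where "W i = U i \<inter> \<Inter> (insert (topspace X) (N i ` (I - {i})))" for i
  show ?thesis
  proof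
    fix i assume i: "i \<in> I"
    have "openin X (\<Inter> (insert (topspace X) (N i ` (I - {i}))))"
      using \<open>finite I\<close> N[OF i] by (intro openin_Inter) auto
    then have "openin X (W i)" unfolding W_def using U[OF i] by blast
    moreover have "C i \<subseteq> W i" using U[OF i] N[OF i] closedin_subset[OF C[OF i]] unfolding W_def by blast
    ultimately show "openin X (W i) \<and> C i \<subseteq> W i \<and> W i \<subseteq> U i" by (auto simp: W_def)
  next
    fix i j assume ij: "i \<in> I" "j \<in> I" "i \<noteq> j"
    then have "W i \<subseteq> fst (q i j)" "W j \<subseteq> snd (q i j)" unfolding W_def N_def by blast+
    then show "disjnt (W i) (W j)" using q[OF ij] unfolding P_def by (meson disjnt_subset1 disjnt_subset2)
  qed
qed

lemma splits_closed_partition: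
  assumes "normal_space X" "finite I" "\<And>i. i \<in> I \<Longrightarrow> closedin X (C i)"
    and U: "\<And>i. i \<in> I \<Longrightarrow> \<exists>U. openin X U \<and> C i \<subseteq> U \<and> (\<exists>B\<in>\<omega>. U \<subseteq> B)"
    and "\<And>i j. i \<in> I \<Longrightarrow> j \<in> I \<Longrightarrow> i \<noteq> j \<Longrightarrow> disjnt (C i) (C j)"
  shows "splits X \<omega> (\<Union>i\<in>I. C i)"
proof -
  obtain U where U: "\<And>i. i \<in> I \<Longrightarrow> openin X (U i) \<and> C i \<subseteq> U i \<and> (\<exists>B\<in>\<omega>. U i \<subseteq> B)"
    using U by metis
  have U': "openin X (U i) \<and> C i \<subseteq> U i" if "i \<in> I" for i using U[OF that] by simp
  obtain W where W: "\<And>i. i \<in> I \<Longrightarrow> openin X (W i) \<and> C i \<subseteq> W i \<and> W i \<subseteq> U i"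
    "\<And>i j. i \<in> I \<Longrightarrow> j \<in> I \<Longrightarrow> i \<noteq> j \<Longrightarrow> disjnt (W i) (W j)"
    by (rule disjoint_closed_separate[OF assms(1-3) U' assms(5)]) blast+
  show ?thesis unfolding splits_def
  proof (intro exI[of _ "W ` I"] conjI ballI)
    show "pairwise disjnt (W ` I)" using W(2) by (auto simp: pairwise_def)
    show "\<exists>B\<in>\<omega>. V \<subseteq> B" if "V \<in> W ` I" for V using that U W(1) by (metis imageE order_trans)
  qed (use W assms in auto)
qed

text \<open>The point preimages of \<kappa> in \<open>F\<close> are finitely many disjoint closed
  sets. Each lies in the preimage of one member of the cover of \<open>Z\<close>, hence in a member
  of \<omega>, and normality separates them.\<close>

lemma splits_finite_image:
  assumes X: "compact_space X" "Hausdorff_space X" and Z: "Hausdorff_space Z"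
    and \<kappa>: "omega_map X \<omega> Z \<kappa>" and F: "closedin X F" and fin: "finite (\<kappa> ` F)"
  shows "splits X \<omega> F"
proof -
  obtain \<V> where \<V>: "open_cover Z \<V>" "\<And>V. V \<in> \<V> \<Longrightarrow> \<exists>U\<in>\<omega>. {x \<in> topspace X. \<kappa> x \<in> V} \<subseteq> U"
    and cont: "continuous_map X Z \<kappa>"
    using \<kappa> unfolding omega_map_def by blast
  define C where "C a = {x \<in> topspace X. \<kappa> x = a} \<inter> F" for a
  have "splits X \<omega> (\<Union>a\<in>\<kappa> ` F. C a)"
  proof (rule splits_closed_partition)
    show "normal_space X" using X compact_Hausdorff_or_regular_imp_normal_space by blast
    show "closedin X (C a)" for a
      unfolding C_def using closedin_fibre[OF cont Z] F by blast
    fix a assume "a \<in> \<kappa> ` F"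
    then have "a \<in> topspace Z"
      using closedin_subset[OF F] continuous_map_image_subset_topspace[OF cont] by auto
    then obtain V where V: "V \<in> \<V>" "a \<in> V" "openin Z V" using \<V>(1) unfolding open_cover_def by blast
    show "\<exists>U. openin X U \<and> C a \<subseteq> U \<and> (\<exists>B\<in>\<omega>. U \<subseteq> B)"
      using \<V>(2)[OF V(1)] openin_continuous_map_preimage[OF cont V(3)] V(2)
      by (intro exI[of _ "{x \<in> topspace X. \<kappa> x \<in> V}"]) (auto simp: C_def)
  qed (use fin in \<open>auto simp: C_def disjnt_def\<close>)
  moreover have "F \<subseteq> (\<Union>a\<in>\<kappa> ` F. C a)" using closedin_subset[OF F] by (auto simp: C_def)
  ultimately show ?thesis by (rule splits_mono)
qed

lemma splits_finite:
  assumes X: "compact_space X" "Hausdorff_space X" and "open_cover X \<omega>" "finite F" "F \<subseteq> topspace X"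
  shows "splits X \<omega> F"
proof (rule splits_finite_image[OF X X(2), where \<kappa> = id])
  show "omega_map X \<omega> X id" unfolding omega_map_def
    using assms by (auto intro!: exI[of _ \<omega>])
  show "closedin X F" using assms closedin_Hausdorff_finite by blast
qed (use assms in auto)

lemma card_disjoint_members:
  assumes "pairwise disjnt \<V>"
  shows "card {V \<in> \<V>. x \<in> V} \<le> 1"
proof -
  have "\<forall>V\<in>{V \<in> \<V>. x \<in> V}. \<forall>W\<in>{V \<in> \<V>. x \<in> V}. V = W"
    using assms by (auto simp: pairwise_def disjnt_def)
  then show ?thesis
    using card_le_Suc0_iff_eq[of "{V \<in> \<V>. x \<in> V}"]
    by (cases "finite {V \<in> \<V>. x \<in> V}") auto
qed

lemma covering_dim_0_imp_splits:
  assumes X: "compact_space X" "Hausdorff_space X" and \<omega>: "open_cover X \<omega>" and F: "closedin X F"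
    and dim: "covering_dim_le (subtopology X F) 0"
  shows "splits X \<omega> F"
proof -
  have FX: "F \<subseteq> topspace X" using F closedin_subset by blast
  obtain \<omega>' where \<omega>': "finite \<omega>'" "\<omega>' \<subseteq> \<omega>" "topspace X \<subseteq> \<Union>\<omega>'"
    using X(1)[unfolded compact_space_alt, rule_format, of \<omega>] \<omega> unfolding open_cover_def by auto
  have "open_cover (subtopology X F) ((\<lambda>U. U \<inter> F) ` \<omega>')"
    unfolding open_cover_def
  proof (intro conjI ballI)
    show "openin (subtopology X F) V" if "V \<in> (\<lambda>U. U \<inter> F) ` \<omega>'" for V
      using that \<omega> \<omega>'(2) unfolding open_cover_def by (auto simp: openin_subtopology)
    show "\<Union>((\<lambda>U. U \<inter> F) ` \<omega>') = topspace (subtopology X F)" using \<omega>'(3) FX by auto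
  qed
  with dim \<omega>'(1) obtain \<V> where \<V>: "finite \<V>" "open_cover (subtopology X F) \<V>"
      "refines \<V> ((\<lambda>U. U \<inter> F) ` \<omega>')" "\<And>x. x \<in> F \<Longrightarrow> card {V \<in> \<V>. x \<in> V} \<le> 1"
    unfolding covering_dim_le_def using FX by (auto simp: Int_absorb1)
  have opV: "openin (subtopology X F) V" if "V \<in> \<V>" for V using \<V>(2) that unfolding open_cover_def by blast
  have UV: "\<Union>\<V> = F" using \<V>(2) FX unfolding open_cover_def by auto
  have dis: "disjnt V W" if "V \<in> \<V>" "W \<in> \<V>" "V \<noteq> W" for V W
  proof (rule ccontr)
    assume "\<not> disjnt V W"
    then obtain x where x: "x \<in> V" "x \<in> W" by (auto simp: disjnt_def)
    then have "card {V, W} \<le> card {V \<in> \<V>. x \<in> V}" using that \<V>(1) by (intro card_mono) auto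
    moreover have "x \<in> F" using x that UV by blast
    ultimately show False using \<V>(4)[of x] that(3) by simp
  qed
  have "splits X \<omega> (\<Union>V\<in>\<V>. V)"
  proof (rule splits_closed_partition)
    show "normal_space X" using X compact_Hausdorff_or_regular_imp_normal_space by blast
    show "finite \<V>" by fact
    fix V assume V: "V \<in> \<V>"
    \<comment> \<open>A member of a disjoint open cover of \<open>F\<close> is also closed in
      \<open>F\<close>, hence in \<open>X\<close>.\<close>
    have "V = F - \<Union>(\<V> - {V})" using UV V dis by (auto simp: disjnt_def)
    moreover have "openin (subtopology X F) (\<Union>(\<V> - {V}))" using opV by blast
    ultimately have "closedin (subtopology X F) V"
      by (metis FX closedin_def Diff_subset double_diff inf.absorb2 order_refl openin_subset topspace_subtopology_subset)
    then show "closedin X V" using F closedin_trans_full by blast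
    obtain U where "U \<in> \<omega>'" "V \<subseteq> U \<inter> F" using \<V>(3) V unfolding refines_def by blast
    then show "\<exists>U. openin X U \<and> V \<subseteq> U \<and> (\<exists>B\<in>\<omega>. U \<subseteq> B)"
      using \<omega> \<omega>'(2) unfolding open_cover_def by (intro exI[of _ U]) auto
  qed (rule dis)
  then show ?thesis using UV by simp
qed

lemma splits_imp_covering_dim_0:
  assumes F: "closedin X F" and sp: "\<And>\<omega>. open_cover X \<omega> \<Longrightarrow> splits X \<omega> F"
  shows "covering_dim_le (subtopology X F) 0"
  unfolding covering_dim_le_def
proof (intro allI impI, elim conjE)
  fix \<U> assume "finite \<U>" and \<U>: "open_cover (subtopology X F) \<U>"
  have FX: "F \<subseteq> topspace X" using F closedin_subset by blast
  define \<omega> where "\<omega> = insert (topspace X - F) {T. openin X T \<and> (\<exists>U\<in>\<U>. F \<inter> T \<subseteq> U)}"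
  have "open_cover X \<omega>" unfolding open_cover_def
  proof (intro conjI antisym ballI)
    show "openin X U" if "U \<in> \<omega>" for U using that F by (auto simp: \<omega>_def)
    then show "\<Union>\<omega> \<subseteq> topspace X" using openin_subset by blast
    show "topspace X \<subseteq> \<Union>\<omega>"
    proof
      fix x assume x: "x \<in> topspace X"
      show "x \<in> \<Union>\<omega>"
      proof (cases "x \<in> F")
        case True
        then obtain U where U: "U \<in> \<U>" "x \<in> U" "openin (subtopology X F) U"
          using \<U> x unfolding open_cover_def by (metis Union_iff FX topspace_subtopology_subset)
        then obtain T where "openin X T" "U = T \<inter> F" by (auto simp: openin_subtopology)
        then have "T \<in> \<omega>" "x \<in> T" using U by (auto simp: \<omega>_def Int_commute)
        then show ?thesis by blast
      qed (use x in \<open>auto simp: \<omega>_def\<close>)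
    qed
  qed
  then obtain \<W> where \<W>: "finite \<W>" "\<And>W. W \<in> \<W> \<Longrightarrow> openin X W \<and> (\<exists>U\<in>\<omega>. W \<subseteq> U)"
      "pairwise disjnt \<W>" "F \<subseteq> \<Union>\<W>"
    using sp unfolding splits_def by meson
  \<comment> \<open>Pieces that miss \<open>F\<close> may lie only in the complement of
    \<open>F\<close> and are dropped; a piece that meets \<open>F\<close> lies in one of the sets
    \<open>T\<close>.\<close>
  define \<V> where "\<V> = (\<lambda>W. W \<inter> F) ` {W \<in> \<W>. W \<inter> F \<noteq> {}}"
  show "\<exists>\<V>. finite \<V> \<and> open_cover (subtopology X F) \<V> \<and> refines \<V> \<U> \<and>
      (\<forall>x\<in>topspace (subtopology X F). card {V \<in> \<V>. x \<in> V} \<le> 0 + 1)"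
  proof (intro exI[of _ \<V>] conjI ballI)
    show "finite \<V>" using \<W>(1) by (simp add: \<V>_def)
    show "open_cover (subtopology X F) \<V>"
      unfolding open_cover_def
    proof (intro conjI ballI)
      show "openin (subtopology X F) V" if "V \<in> \<V>" for V
        using that \<W>(2) by (auto simp: openin_subtopology \<V>_def)
      show "\<Union>\<V> = topspace (subtopology X F)" using \<W>(4) FX unfolding \<V>_def by fastforce
    qed
    have "\<exists>U\<in>\<U>. W \<inter> F \<subseteq> U" if "W \<in> \<W>" "W \<inter> F \<noteq> {}" for W
      using \<W>(2)[OF that(1)] that(2) unfolding \<omega>_def by blast
    then show "refines \<V> \<U>" unfolding refines_def \<V>_def by auto
    have "pairwise disjnt \<V>" using \<W>(3) unfolding \<V>_def pairwise_def disjnt_def by blast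
    then show "card {V \<in> \<V>. x \<in> V} \<le> 0 + 1" for x using card_disjoint_members by simp
  qed
qed

section \<open>The dimension of the cube\<close>

lemma continuous_on_coordinate: "continuous_on S (\<lambda>x::nat \<Rightarrow> real. x i)"
  by (rule continuous_on_subset[OF continuous_on_product_coordinates]) simp

lemma tendsto_coordinatewise:
  fixes f :: "'a \<Rightarrow> nat \<Rightarrow> real"
  assumes "\<And>i. ((\<lambda>n. f n i) \<longlongrightarrow> l i) F"
  shows "(f \<longlongrightarrow> l) F"
proof -
  have "limitin (product_topology (\<lambda>i::nat. euclideanreal) UNIV) f l F"
    using assms by (simp add: limitin_componentwise)
  then show ?thesis by (simp add: euclidean_product_topology)
qed

lemma tendsto_coordinate:
  fixes f :: "'a \<Rightarrow> nat \<Rightarrow> real"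
  assumes "(f \<longlongrightarrow> l) F"
  shows "((\<lambda>n. f n i) \<longlongrightarrow> l i) F"
proof -
  have "limitin (product_topology (\<lambda>i::nat. euclideanreal) UNIV) f l F"
    using assms by (simp add: euclidean_product_topology)
  then show ?thesis by (simp add: limitin_componentwise)
qed

lemma compact_bounded_nat_fun: "compact {x::nat \<Rightarrow> real. \<forall>i. x i \<in> {0..1}}"
proof -
  have "compactin (product_topology (\<lambda>i::nat. euclideanreal) UNIV) (PiE UNIV (\<lambda>i. {0..1}))"
    by (simp add: compactin_PiE)
  moreover have "PiE UNIV (\<lambda>i::nat. {0..1::real}) = {x. \<forall>i. x i \<in> {0..1}}" by auto
  ultimately show ?thesis by (simp add: euclidean_product_topology)
qed

definition unit_cube :: "nat \<Rightarrow> (nat \<Rightarrow> real) set" where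
  "unit_cube n = {x. (\<forall>i. x i \<in> {0..1}) \<and> (\<forall>i\<ge>n. x i = 0)}"

lemma compact_unit_cube: "compact (unit_cube n)"
proof -
  have "closed (\<Inter>i\<in>{n..}. {x::nat \<Rightarrow> real. x i = 0})"
    by (intro closed_INT ballI closed_Collect_eq continuous_on_coordinate continuous_on_const)
  then have "compact ({x::nat \<Rightarrow> real. \<forall>i. x i \<in> {0..1}} \<inter> (\<Inter>i\<in>{n..}. {x. x i = 0}))"
    by (rule compact_Int_closed[OF compact_bounded_nat_fun])
  moreover have "{x::nat \<Rightarrow> real. \<forall>i. x i \<in> {0..1}} \<inter> (\<Inter>i\<in>{n..}. {x. x i = 0}) = unit_cube n"
    by (auto simp: unit_cube_def)
  ultimately show ?thesis by simp
qed

text \<open>Kuhn's labelling lemma is used on finer and finer grids, since the dimension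
  \<open>n\<close> is a variable here. The corners of the selected small cubes converge to one
  point, and there every coordinate of \<open>f\<close> is both at least and at most that of the
  point.\<close>

lemma brouwer_unit_cube:
  assumes cont: "\<And>i. i < n \<Longrightarrow> continuous_on (unit_cube n) (f i)"
    and range: "\<And>i x. i < n \<Longrightarrow> x \<in> unit_cube n \<Longrightarrow> f i x \<in> {0..1::real}"
  obtains x where "x \<in> unit_cube n" "\<And>i. i < n \<Longrightarrow> f i x = x i"
proof -
  define pt where "pt p q = (\<lambda>i. if i < n then real (q i) / real p else 0)" for p :: nat and q :: "nat \<Rightarrow> nat"
  have pt: "pt p q \<in> unit_cube n" if "0 < p" "\<forall>i<n. q i \<le> p" for p q
    using that by (auto simp: pt_def unit_cube_def divide_simps)
  define near where "near q r \<longleftrightarrow> (\<forall>j<n. q j \<le> r j \<and> r j \<le> q j + 1)" for q r :: "nat \<Rightarrow> nat"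
  have ex: "\<exists>q. (\<forall>i<n. q i < Suc m) \<and> (\<forall>i<n. \<exists>r s. near q r \<and> near q s \<and>
      pt (Suc m) r i \<le> f i (pt (Suc m) r) \<and> f i (pt (Suc m) s) \<le> pt (Suc m) s i)" for m
  proof -
    define p where "p = Suc m"
    have p: "0 < p" by (simp add: p_def)
    \<comment> \<open>Label 0 records that \<open>f\<close> does not lower coordinate
      \<open>i\<close>. The test \<open>x i < p\<close> forces label 1 on the far face, as Kuhn's
      lemma demands, even where \<open>f i\<close> equals 1.\<close>
    define label :: "(nat \<Rightarrow> nat) \<Rightarrow> nat \<Rightarrow> nat"
      where "label x i = (if x i < p \<and> pt p x i \<le> f i (pt p x) then 0 else 1)" for x i
    have 1: "\<forall>x. (\<forall>i<n. x i \<le> p) \<longrightarrow> (\<forall>i<n. label x i = (0::nat) \<or> label x i = 1)"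
      by (simp add: label_def)
    have 2: "\<forall>x. (\<forall>i<n. x i \<le> p) \<longrightarrow> (\<forall>i<n. x i = 0 \<longrightarrow> label x i = 0)"
    proof (intro allI impI)
      fix x i assume x: "\<forall>i<n. x i \<le> p" and i: "i < n" "x i = 0"
      have "pt p x i = 0" using i by (simp add: pt_def)
      moreover have "0 \<le> f i (pt p x)" using range[OF i(1) pt[OF p x]] by simp
      ultimately show "label x i = 0" using p i by (simp add: label_def)
    qed
    have 3: "\<forall>x. (\<forall>i<n. x i \<le> p) \<longrightarrow> (\<forall>i<n. x i = p \<longrightarrow> label x i = 1)"
      by (simp add: label_def)
    obtain q where q: "\<forall>i<n. q i < p" and "\<forall>i<n. \<exists>r s. (\<forall>j<n. q j \<le> r j \<and> r j \<le> q j + 1) \<and>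
        (\<forall>j<n. q j \<le> s j \<and> s j \<le> q j + 1) \<and> label r i \<noteq> label s i"
      using kuhn_lemma[OF p 1 2 3] by blast
    then have rs: "\<exists>r s. near q r \<and> near q s \<and> label r i \<noteq> label s i" if "i < n" for i
      unfolding near_def using that by blast
    have "\<exists>r s. near q r \<and> near q s \<and> pt p r i \<le> f i (pt p r) \<and> f i (pt p s) \<le> pt p s i" if i: "i < n" for i
    proof -
      obtain u v where uv: "near q u" "near q v" "label u i \<noteq> label v i" using rs[OF i] by blast
      obtain r s where rs: "near q r" "near q s" "label r i = 0" "label s i \<noteq> 0"
        by (cases "label u i = 0") (use uv that in \<open>auto simp: label_def split: if_splits\<close>)
      have sp: "\<forall>i<n. s i \<le> p" using rs(2) q unfolding near_def by fastforce
      have "f i (pt p s) \<le> pt p s i"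
      proof (cases "s i < p")
        \<comment> \<open>On the far face label 1 was forced; there the inequality holds because
          \<open>f i\<close> is at most 1.\<close>
        case False
        then have "pt p s i = 1" using sp i p by (auto simp: pt_def)
        then show ?thesis using range[OF i pt[OF p sp]] by simp
      qed (use rs(4) in \<open>auto simp: label_def split: if_splits\<close>)
      moreover have "pt p r i \<le> f i (pt p r)" using rs(3) by (auto simp: label_def split: if_splits)
      ultimately show ?thesis using rs by blast
    qed
    then show ?thesis using q unfolding p_def by blast
  qed
  then obtain q where q: "\<And>m. (\<forall>i<n. q m i < Suc m)" and
      "\<And>m i. i < n \<Longrightarrow> \<exists>r s. near (q m) r \<and> near (q m) s \<and>
      pt (Suc m) r i \<le> f i (pt (Suc m) r) \<and> f i (pt (Suc m) s) \<le> pt (Suc m) s i"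
    by metis
  then have "\<forall>m i. \<exists>r. i < n \<longrightarrow> near (q m) r \<and> pt (Suc m) r i \<le> f i (pt (Suc m) r)"
    and "\<forall>m i. \<exists>s. i < n \<longrightarrow> near (q m) s \<and> f i (pt (Suc m) s) \<le> pt (Suc m) s i" by blast+
  then obtain r s where rs: "\<And>m i. i < n \<Longrightarrow> near (q m) (r m i) \<and> pt (Suc m) (r m i) i \<le> f i (pt (Suc m) (r m i))"
      "\<And>m i. i < n \<Longrightarrow> near (q m) (s m i) \<and> f i (pt (Suc m) (s m i)) \<le> pt (Suc m) (s m i) i"
    by metis
  have "seq_compact (unit_cube n)" using compact_unit_cube compact_eq_seq_compact_metric by blast
  moreover have "\<forall>m. pt (Suc m) (q m) \<in> unit_cube n" using q by (auto intro!: pt simp: less_imp_le)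
  ultimately obtain z h where z: "z \<in> unit_cube n" "strict_mono h" "((\<lambda>m. pt (Suc m) (q m)) \<circ> h) \<longlonglongrightarrow> z"
    by (rule seq_compactE)
  have inv: "(\<lambda>m. 1 / real (Suc (h m))) \<longlonglongrightarrow> 0"
    using LIMSEQ_subseq_LIMSEQ[OF lim_1_over_real_power[of 1] z(2)]
    using LIMSEQ_subseq_LIMSEQ[OF LIMSEQ_inverse_real_of_nat z(2)] by (simp add: o_def inverse_eq_divide)
  \<comment> \<open>All corners of the small cube at \<open>q\<close> have the same limit, since
    they differ from \<open>q\<close> by at most the mesh in each coordinate.\<close>
  have lim: "(\<lambda>m. pt (Suc (h m)) (u (h m))) \<longlonglongrightarrow> z" if u: "\<And>m. near (q m) (u m)" for u
  proof (rule tendsto_coordinatewise)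
    fix i
    have 1: "(\<lambda>m. pt (Suc (h m)) (q (h m)) i) \<longlonglongrightarrow> z i"
      using tendsto_coordinate[OF z(3)] by (simp add: o_def)
    have 2: "(\<lambda>m. pt (Suc (h m)) (q (h m)) i + 1 / real (Suc (h m))) \<longlonglongrightarrow> z i"
      using tendsto_add[OF 1 inv] by simp
    have le: "pt (Suc m) (q m) i \<le> pt (Suc m) (u m) i \<and> pt (Suc m) (u m) i \<le> pt (Suc m) (q m) i + 1 / real (Suc m)" for m
      using u[of m] by (auto simp: pt_def near_def divide_simps)
    show "(\<lambda>m. pt (Suc (h m)) (u (h m)) i) \<longlonglongrightarrow> z i"
      by (rule tendsto_sandwich[OF _ _ 1 2]) (use le in auto)
  qed
  have inc: "pt (Suc m) u \<in> unit_cube n" if "near (q m) u" for m u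
    using that q[of m] by (intro pt) (auto simp: near_def, metis Suc_leI add.commute le_trans plus_1_eq_Suc)
  have flim: "(\<lambda>m. f i (pt (Suc (h m)) (u (h m)))) \<longlonglongrightarrow> f i z" if u: "\<And>m. near (q m) (u m)" and i: "i < n" for u i
    by (rule continuous_on_tendsto_compose[OF cont[OF i] lim[OF u] z(1)]) (use inc u in auto)
  show ?thesis
  proof
    show "z \<in> unit_cube n" by fact
    fix i assume i: "i < n"
    have r: "near (q m) (r m i)" and s: "near (q m) (s m i)" for m using rs[OF i] by auto
    have "z i \<le> f i z"
      by (rule LIMSEQ_le[OF tendsto_coordinate[OF lim[OF r]] flim[OF r i]]) (use rs(1)[OF i] in blast)
    moreover have "f i z \<le> z i"
      by (rule LIMSEQ_le[OF flim[OF s i] tendsto_coordinate[OF lim[OF s]]]) (use rs(2)[OF i] in blast)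
    ultimately show "f i z = z i" by simp
  qed
qed

text \<open>A partition of unity subordinate to a refinement of the cover \<open>U\<close> below defines a map of the cube into
  the boundary of the simplex with barycentric coordinates \<open>F 0, \<dots>, F n\<close>. Shifting the coordinates cyclically
  gives a fixed point at which the vanishing of one coordinate propagates to all of them.\<close>

lemma covering_dim_unit_cube:
  assumes "covering_dim_le (top_of_set (unit_cube n)) k"
  shows "n \<le> k"
proof (rule ccontr)
  assume "\<not> n \<le> k"
  then have kn: "k < n" by simp
  \<comment> \<open>For \<open>i < n\<close> this is where the barycentric coordinate
    \<open>x i\<close> of the corner simplex is positive; \<open>U n\<close> is where the remaining
    coordinate \<open>1 - (\<Sum>j<n. x j)\<close> is.\<close>
  define U where "U i = {x \<in> unit_cube n. if i < n then 0 < x i else (\<Sum>j<n. x j) < 1}" for i :: nat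
  have cs: "continuous_on (unit_cube n) (\<lambda>x. \<Sum>j<n. x j)"
    by (intro continuous_intros continuous_on_coordinate)
  have "openin (top_of_set (unit_cube n)) (U i)" for i
    using openin_real_less(2)[of "top_of_set (unit_cube n)" "\<lambda>x. x i" 0]
      openin_real_less(1)[of "top_of_set (unit_cube n)" "\<lambda>x. \<Sum>j<n. x j" 1] cs continuous_on_coordinate
    unfolding U_def by (cases "i < n") auto
  moreover have "\<exists>i\<le>n. x \<in> U i" if x: "x \<in> unit_cube n" for x
  proof (cases "\<exists>i<n. 0 < x i")
    case False
    then have "x j = 0" if "j < n" for j using x that by (auto simp: unit_cube_def not_less intro: antisym)
    then show ?thesis using x by (auto simp: U_def)
  qed (use x in \<open>auto simp: U_def\<close>)
  moreover have "U i \<subseteq> unit_cube n" for i by (auto simp: U_def)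
  ultimately have "open_cover (top_of_set (unit_cube n)) (U ` {..n})"
    unfolding open_cover_def by fastforce
  then obtain \<V> where \<V>: "finite \<V>" "open_cover (top_of_set (unit_cube n)) \<V>"
      "refines \<V> (U ` {..n})" "\<And>x. x \<in> unit_cube n \<Longrightarrow> card {V \<in> \<V>. x \<in> V} \<le> k + 1"
    using assms[unfolded covering_dim_le_def, rule_format, of "U ` {..n}"] by auto
  have "\<forall>V\<in>\<V>. \<exists>i\<le>n. V \<subseteq> U i" using \<V>(3) unfolding refines_def by auto
  from bchoice[OF this] obtain l where l: "\<And>V. V \<in> \<V> \<Longrightarrow> l V \<le> n \<and> V \<subseteq> U (l V)" by auto
  have "compact_space (top_of_set (unit_cube n))"
    using compact_unit_cube by (simp add: compact_space_subtopology)
  moreover have "Hausdorff_space (top_of_set (unit_cube n))"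
    by (simp add: Hausdorff_space_subtopology)
  ultimately obtain m :: nat and \<phi> where \<phi>:
    "\<And>i. i < m \<Longrightarrow> continuous_map (top_of_set (unit_cube n)) euclideanreal (\<phi> i)"
    "\<And>i y. i < m \<Longrightarrow> y \<in> topspace (top_of_set (unit_cube n)) \<Longrightarrow> 0 \<le> \<phi> i y"
    "\<And>i. i < m \<Longrightarrow> \<exists>V\<in>\<V>. {y \<in> topspace (top_of_set (unit_cube n)). 0 < \<phi> i y} \<subseteq> V"
    "\<And>y. y \<in> topspace (top_of_set (unit_cube n)) \<Longrightarrow> (\<Sum>i<m. \<phi> i y) = 1"
    using finite_partition_of_unity[OF _ _ \<V>(2)] by blast
  have "\<forall>i\<in>{..<m}. \<exists>V\<in>\<V>. {y \<in> unit_cube n. 0 < \<phi> i y} \<subseteq> V" using \<phi>(3) by auto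
  from bchoice[OF this[unfolded Bex_def]] obtain V where V: "\<And>i. i < m \<Longrightarrow> V i \<in> \<V> \<and> {y \<in> unit_cube n. 0 < \<phi> i y} \<subseteq> V i"
    by auto
  have nonneg: "0 \<le> \<phi> i y" if "i < m" "y \<in> unit_cube n" for i y using \<phi>(2)[of i y] that by simp
  define F where "F j x = (\<Sum>i\<in>{i. i < m \<and> l (V i) = j}. \<phi> i x)" for j x
  have F0: "0 \<le> F j x" if "x \<in> unit_cube n" for j x
    unfolding F_def using nonneg that by (intro sum_nonneg) auto
  have Fsum: "(\<Sum>j\<le>n. F j x) = 1" if "x \<in> unit_cube n" for x
  proof -
    have "(\<Sum>j\<le>n. F j x) = (\<Sum>j\<le>n. \<Sum>i\<in>{i\<in>{..<m}. l (V i) = j}. \<phi> i x)" unfolding F_def by simp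
    also have "\<dots> = (\<Sum>i<m. \<phi> i x)"
      by (rule sum.group) (use V l in auto)
    finally show ?thesis using \<phi>(4) that by simp
  qed
  have Fpos: "\<exists>i<m. l (V i) = j \<and> 0 < \<phi> i x" if "x \<in> unit_cube n" "0 < F j x" for j x
  proof (rule ccontr)
    assume "\<not> ?thesis"
    then have "F j x \<le> 0" unfolding F_def by (intro sum_nonpos) (auto simp: not_less)
    then show False using that by simp
  qed
  have FU: "x \<in> U j" if "x \<in> unit_cube n" "0 < F j x" for j x
    using Fpos[OF that] V l that(1) by blast
  \<comment> \<open>\<open>n + 1\<close> positive coordinates would require members of
    \<open>\<V>\<close> through \<open>x\<close> with \<open>n + 1\<close> different labels, while
    the multiplicity is at most \<open>k + 1 \<le> n\<close>.\<close>
  have Fzero: "\<exists>j\<le>n. F j x = 0" if x: "x \<in> unit_cube n" for x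
  proof (rule ccontr)
    assume "\<not> ?thesis"
    then have pos: "0 < F j x" if "j \<le> n" for j using F0[OF x, of j] that by (simp add: order_less_le)
    have "{..n} \<subseteq> l ` {V \<in> \<V>. x \<in> V}"
    proof
      fix j assume "j \<in> {..n}"
      then obtain i where "i < m" "l (V i) = j" "0 < \<phi> i x" using Fpos[OF x pos] by auto
      then show "j \<in> l ` {V \<in> \<V>. x \<in> V}" using V x by blast
    qed
    then have "card {..n} \<le> card {V \<in> \<V>. x \<in> V}"
      using \<V>(1) by (intro surj_card_le) auto
    then show False using \<V>(4)[OF x] kn by simp
  qed
  \<comment> \<open>Brouwer's map has only \<open>n\<close> coordinates; the cyclic shift leaves out
    \<open>F (n - 1)\<close>.\<close>
  define g where "g i x = (case i of 0 \<Rightarrow> F n x | Suc j \<Rightarrow> F j x)" for i x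
  have F1: "F j x \<le> 1" if "j \<le> n" "x \<in> unit_cube n" for j x
    using member_le_sum[of j "{..n}" "\<lambda>j. F j x"] F0[OF that(2)] Fsum[OF that(2)] that(1) by simp
  obtain x where x: "x \<in> unit_cube n" "\<And>i. i < n \<Longrightarrow> g i x = x i"
  proof (rule brouwer_unit_cube[of n g])
    have "continuous_on (unit_cube n) (F j)" for j
      unfolding F_def using \<phi>(1) by (intro continuous_intros) auto
    then have "continuous_on (unit_cube n) (\<lambda>x. F j x)" for j by simp
    then show "continuous_on (unit_cube n) (g i)" for i
      unfolding g_def by (cases i) simp_all
    show "g i x \<in> {0..1}" if "i < n" "x \<in> unit_cube n" for i x
      using that F0 F1 by (cases i) (auto simp: g_def)
  qed blast
  have step: "F (Suc j) x = 0" if "F j x = 0" "Suc j < n" for j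
  proof (rule ccontr)
    assume "F (Suc j) x \<noteq> 0"
    then have "x \<in> U (Suc j)" using FU F0 x(1) by (simp add: order_less_le)
    then have "0 < x (Suc j)" using that by (simp add: U_def)
    then show False using x(2)[OF that(2)] that(1) by (simp add: g_def)
  qed
  \<comment> \<open>If the omitted coordinate vanishes, the coordinates of the fixed point sum to
    the total of all \<open>F j\<close>, that is to 1, so \<open>x\<close> lies outside
    \<open>U n\<close>.\<close>
  have Fn: "F n x = 0" if "F (n - 1) x = 0"
  proof (rule ccontr)
    assume "F n x \<noteq> 0"
    then have "x \<in> U n" using FU F0 x(1) by (simp add: order_less_le)
    then have lt: "(\<Sum>j<n. x j) < 1" by (simp add: U_def)
    obtain n' where n': "n = Suc n'" using kn by (cases n) auto
    have "(\<Sum>j<n. x j) = (\<Sum>j<n. g j x)" using x(2) by simp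
    also have "\<dots> = F n x + (\<Sum>j<n'. F j x)" unfolding n' sum.lessThan_Suc_shift by (simp add: g_def flip: n')
    also have "\<dots> = (\<Sum>j\<le>n. F j x)"
      using that unfolding n' by (simp flip: lessThan_Suc_atMost)
    finally show False using lt Fsum[OF x(1)] by simp
  qed
  have F00: "F 0 x = 0" if "F n x = 0"
  proof (rule ccontr)
    assume "F 0 x \<noteq> 0"
    then have "x \<in> U 0" using FU F0 x(1) by (simp add: order_less_le)
    then have "0 < x 0" using kn by (simp add: U_def)
    then show False using x(2)[of 0] that kn by (simp add: g_def)
  qed
  have propagate: "j + d < n \<Longrightarrow> F j x = 0 \<Longrightarrow> F (j + d) x = 0" for j d
    by (induction d) (use step in auto)
  obtain j where j: "j \<le> n" "F j x = 0" using Fzero[OF x(1)] by blast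
  have "F n x = 0"
  proof (cases "j = n")
    case False
    then have "F (n - 1) x = 0" using propagate[of j "n - 1 - j"] j by simp
    then show ?thesis by (rule Fn)
  qed (use j in simp)
  then have "F i x = 0" if "i \<le> n" for i
    using propagate[of 0 i] F00 that by (cases "i = n") auto
  then show False using Fsum[OF x(1)] by simp
qed

section \<open>General position and shifted grids\<close>

text \<open>Gaussian elimination over arbitrary index types; below the unknowns are indexed by a
  disjoint sum, one summand for vertex classes and one for coordinates.\<close>

lemma underdetermined_system_nonzero_solution:
  fixes m :: "'e \<Rightarrow> 'u \<Rightarrow> real"
  assumes "finite E" "finite U" "card E < card U"
  shows "\<exists>y. (\<exists>u\<in>U. y u \<noteq> 0) \<and> (\<forall>e\<in>E. (\<Sum>u\<in>U. m e u * y u) = 0)"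
  using assms
proof (induction E arbitrary: U m)
  case empty
  then have "U \<noteq> {}" by auto
  then show ?case by (intro exI[of _ "\<lambda>_. 1"]) auto
next
  case (insert e E)
  show ?case
  proof (cases "\<forall>u\<in>U. m e u = 0")
    case True
    have "card E < card U" using insert by simp
    then obtain y where "\<exists>u\<in>U. y u \<noteq> 0" "\<forall>e\<in>E. (\<Sum>u\<in>U. m e u * y u) = 0"
      using insert.IH[OF insert.prems(1), of m] by blast
    then show ?thesis using True by (intro exI[of _ y]) auto
  next
    case False
    then obtain u0 where u0: "u0 \<in> U" "m e u0 \<noteq> 0" by blast
    define U' where "U' = U - {u0}"
    have U': "finite U'" "card E < card U'" using insert u0 by (auto simp: U'_def)
    obtain y where y: "\<exists>u\<in>U'. y u \<noteq> 0"
        "\<And>e'. e' \<in> E \<Longrightarrow> (\<Sum>u\<in>U'. (m e' u - m e' u0 * m e u / m e u0) * y u) = 0"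
      using insert.IH[OF U', of "\<lambda>e' u. m e' u - m e' u0 * m e u / m e u0"] by blast
    define y' where "y' = y(u0 := - (\<Sum>u\<in>U'. m e u * y u) / m e u0)"
    have split: "(\<Sum>u\<in>U. m e' u * y' u) = m e' u0 * y' u0 + (\<Sum>u\<in>U'. m e' u * y u)" for e'
    proof -
      have "(\<Sum>u\<in>U'. m e' u * y' u) = (\<Sum>u\<in>U'. m e' u * y u)"
        by (intro sum.cong) (auto simp: y'_def U'_def)
      then show ?thesis using sum.remove[OF insert.prems(1) u0(1), of "\<lambda>u. m e' u * y' u"] by (simp add: U'_def)
    qed
    have "(\<Sum>u\<in>U. m e' u * y' u) = 0" if "e' \<in> E" for e'
    proof -
      have "0 = (\<Sum>u\<in>U'. m e' u * y u) - (\<Sum>u\<in>U'. m e' u0 / m e u0 * (m e u * y u))"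
        using y(2)[OF that] by (simp add: left_diff_distrib sum_subtractf mult.assoc)
      also have "\<dots> = (\<Sum>u\<in>U'. m e' u * y u) + m e' u0 * y' u0"
        by (simp add: y'_def flip: sum_distrib_left sum_divide_distrib)
      finally show ?thesis unfolding split by simp
    qed
    moreover have "(\<Sum>u\<in>U. m e u * y' u) = 0" unfolding split using u0 by (simp add: y'_def)
    moreover have "\<exists>u\<in>U. y' u \<noteq> 0" using y(1) by (auto simp: y'_def U'_def)
    ultimately show ?thesis by (intro exI[of _ y']) auto
  qed
qed

text \<open>The exponents start at 1: the coordinates \<open>t ^ Suc j\<close> of the curve then
  become small with \<open>t\<close>, and the degree 0 coefficient \<open>c0\<close> cannot cancel
  against them.\<close>

lemma finite_roots_shifted_polynomial:
  fixes c0 :: real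
  assumes "c0 \<noteq> 0 \<or> (\<exists>j<k. y j \<noteq> 0)"
  shows "finite {t. c0 + (\<Sum>j<k. y j * t ^ Suc j) = 0}"
proof -
  define c where "c i = (case i of 0 \<Rightarrow> c0 | Suc j \<Rightarrow> y j)" for i
  have "(\<Sum>i\<le>k. c i * t ^ i) = c0 + (\<Sum>j<k. y j * t ^ Suc j)" for t
    by (simp add: sum.atMost_shift c_def)
  moreover have "\<exists>i\<le>k. c i \<noteq> 0"
    using assms
  proof
    assume "\<exists>j<k. y j \<noteq> 0"
    then obtain j where "j < k" "y j \<noteq> 0" by blast
    then show ?thesis by (intro exI[of _ "Suc j"]) (simp add: c_def)
  qed (auto simp: c_def intro: exI[of _ 0])
  ultimately show ?thesis using polyfun_finite_roots[of c k] by simp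
qed

text \<open>\<open>b\<close> stands for the difference of two points of the simplex \<open>s\<close>
  in one fibre of the simplicial map given by \<pi>. The condition says that the affine map into
  \<open>k\<close>-space with values \<open>a v\<close> at the vertices is injective on such
  fibres.\<close>

definition fibrewise_independent :: "nat \<Rightarrow> (nat \<Rightarrow> nat) \<Rightarrow> nat set \<Rightarrow> (nat \<Rightarrow> nat \<Rightarrow> real) \<Rightarrow> bool" where
  "fibrewise_independent k \<pi> s a \<longleftrightarrow> (\<forall>b. (\<forall>w. (\<Sum>v\<in>{v\<in>s. \<pi> v = w}. b v) = 0) \<longrightarrow>
     (\<forall>j<k. (\<Sum>v\<in>s. b v * a v j) = 0) \<longrightarrow> (\<forall>v\<in>s. b v = 0))"

text \<open>The new vertex \<open>v\<close> is placed on the moment curve; a simplex \<open>s\<close> containing \<open>v\<close> excludes only the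
  roots of a nonzero polynomial obtained from a linear form that vanishes on the other vertices.\<close>

lemma general_position:
  fixes \<alpha> :: "'i \<Rightarrow> nat \<Rightarrow> nat \<Rightarrow> real" and \<pi> :: "nat \<Rightarrow> nat"
  assumes "finite V" "finite I" "0 < \<delta>"
  shows "\<exists>z. (\<forall>v j. \<bar>z v j\<bar> \<le> \<delta>) \<and> (\<forall>i\<in>I. \<forall>s. s \<subseteq> V \<longrightarrow> card s \<le> card (\<pi> ` s) + k \<longrightarrow>
    fibrewise_independent k \<pi> s (\<lambda>v j. \<alpha> i v j + z v j))"
  using assms(1)
proof (induction V)
  case empty
  then show ?case using \<open>0 < \<delta>\<close> by (intro exI[of _ "\<lambda>_ _. 0"]) (auto simp: fibrewise_independent_def)
next
  case (insert v V)
  from insert.IH obtain z where zz: "(\<forall>v j. \<bar>z v j\<bar> \<le> \<delta>) \<and> (\<forall>i\<in>I. \<forall>s. s \<subseteq> V \<longrightarrow>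
    card s \<le> card (\<pi> ` s) + k \<longrightarrow> fibrewise_independent k \<pi> s (\<lambda>v j. \<alpha> i v j + z v j))" ..
  then have zb: "\<bar>z v j\<bar> \<le> \<delta>" for v j by simp
  from zz have z: "fibrewise_independent k \<pi> s (\<lambda>v j. \<alpha> i v j + z v j)"
    if "i \<in> I" "s \<subseteq> V" "card s \<le> card (\<pi> ` s) + k" for i s using that by simp
  define S where "S = {s. s \<subseteq> insert v V \<and> v \<in> s \<and> card s \<le> card (\<pi> ` s) + k}"
  have finS: "finite S" unfolding S_def by (rule finite_subset[of _ "Pow (insert v V)"]) (use insert.hyps in auto)
  \<comment> \<open>A pair \<open>p\<close> is a linear form: \<open>fst p\<close> weights the
    classes of \<pi>, \<open>snd p\<close> the \<open>k\<close> coordinates. It vanishes at the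
    vertices of \<open>s\<close> other than \<open>v\<close>; at \<open>v\<close> it is a polynomial
    in \<open>t\<close>.\<close>
  define P where "P i s p \<longleftrightarrow> (\<forall>u\<in>s - {v}. fst p (\<pi> u) + (\<Sum>j<k. snd p j * (\<alpha> i u j + z u j)) = 0) \<and>
      finite {t. fst p (\<pi> v) + (\<Sum>j<k. snd p j * (\<alpha> i v j + t ^ Suc j)) = 0}"
    for i s and p :: "(nat \<Rightarrow> real) \<times> (nat \<Rightarrow> real)"
  have Pex: "\<exists>p. P i s p" if s: "s \<in> S" for i s
  proof -
    define m where "m u x = (case x of Inl w \<Rightarrow> if \<pi> u = w then 1 else 0 | Inr j \<Rightarrow> \<alpha> i u j + z u j)"
      for u and x :: "nat + nat"
    have fs: "finite s" using s insert.hyps finite_subset unfolding S_def by blast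
    \<comment> \<open>There are \<open>card s - 1\<close> equations; the unknowns number
      \<open>k\<close> plus the classes met by \<open>s\<close>. The bound on \<open>card s\<close>
      is exactly what makes the unknowns outnumber the equations.\<close>
    have "card (s - {v}) < card (\<pi> ` s <+> {..<k})"
      using s fs card_gt_0_iff[of s] by (auto simp: S_def card_Plus)
    then obtain x where x: "\<exists>u\<in>\<pi> ` s <+> {..<k}. x u \<noteq> 0"
        "\<And>u. u \<in> s - {v} \<Longrightarrow> (\<Sum>r\<in>\<pi> ` s <+> {..<k}. m u r * x r) = 0"
      using underdetermined_system_nonzero_solution[of "s - {v}" "\<pi> ` s <+> {..<k}" m] fs by auto
    define l where "l w = x (Inl w)" for w
    define y where "y j = x (Inr j)" for j
    have L: "l (\<pi> u) + (\<Sum>j<k. y j * (\<alpha> i u j + z u j)) = 0" if u: "u \<in> s - {v}" for u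
    proof -
      have "(\<Sum>w\<in>\<pi> ` s. m u (Inl w) * x (Inl w)) = (\<Sum>w\<in>\<pi> ` s. if \<pi> u = w then l w else 0)"
        by (intro sum.cong) (auto simp: m_def l_def)
      also have "\<dots> = l (\<pi> u)" using u fs by (auto simp: sum.delta')
      finally show ?thesis
        using x(2)[OF u] fs by (simp add: sum.Plus m_def y_def mult.commute)
    qed
    \<comment> \<open>Were the polynomial identically zero, \<open>l\<close> would vanish on the
      class of \<open>v\<close> as well as on all others met by \<open>s\<close>, and the solution
      would be trivial.\<close>
    have "l (\<pi> v) + (\<Sum>j<k. y j * \<alpha> i v j) \<noteq> 0 \<or> (\<exists>j<k. y j \<noteq> 0)"
    proof (rule ccontr)
      assume "\<not> ?thesis"
      then have y0: "y j = 0" if "j < k" for j using that by blast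
      with \<open>\<not> ?thesis\<close> have "l (\<pi> v) = 0" by simp
      moreover have "l (\<pi> u) = 0" if "u \<in> s - {v}" for u using L[OF that] y0 by simp
      ultimately have "l w = 0" if "w \<in> \<pi> ` s" for w using that by blast
      then show False using x(1) y0 by (auto simp: l_def y_def)
    qed
    from finite_roots_shifted_polynomial[OF this]
    have "finite {t. l (\<pi> v) + (\<Sum>j<k. y j * (\<alpha> i v j + t ^ Suc j)) = 0}"
      by (simp add: distrib_left sum.distrib add.assoc)
    then show ?thesis using L unfolding P_def by (intro exI[of _ "(l, y)"]) auto
  qed
  define p where "p i s = (SOME p. P i s p)" for i s
  have Pp: "P i s (p i s)" if "s \<in> S" for i s
    using Pex[OF that] unfolding p_def by (rule someI_ex)
  define l where "l i s = fst (p i s)" for i s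
  define y where "y i s = snd (p i s)" for i s
  have ly: "\<And>i s u. s \<in> S \<Longrightarrow> u \<in> s - {v} \<Longrightarrow> l i s (\<pi> u) + (\<Sum>j<k. y i s j * (\<alpha> i u j + z u j)) = 0"
      "\<And>i s. s \<in> S \<Longrightarrow> finite {t. l i s (\<pi> v) + (\<Sum>j<k. y i s j * (\<alpha> i v j + t ^ Suc j)) = 0}"
    using Pp unfolding P_def l_def y_def by auto
  define B where "B = (\<Union>i\<in>I. \<Union>s\<in>S. {t. l i s (\<pi> v) + (\<Sum>j<k. y i s j * (\<alpha> i v j + t ^ Suc j)) = 0})"
  have "finite B" unfolding B_def using \<open>finite I\<close> finS ly(2) by auto
  \<comment> \<open>The bound 1 gives \<open>t ^ Suc j \<le> t \<le> \<delta>\<close> for all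
    \<open>j\<close> at once.\<close>
  moreover have "infinite {0<..min \<delta> 1}" using \<open>0 < \<delta>\<close> by (intro infinite_Ioc) auto
  ultimately have "\<exists>t. t \<in> {0<..min \<delta> 1} - B" by (metis Diff_infinite_finite finite.emptyI equals0I)
  then obtain t where t: "0 < t" "t \<le> \<delta>" "t \<le> 1" "t \<notin> B" by auto
  define z' where "z' = z(v := \<lambda>j. t ^ Suc j)"
  have z'V: "z' u = z u" if "u \<noteq> v" for u using that by (simp add: z'_def)
  have z'b: "\<bar>z' u j\<bar> \<le> \<delta>" for u j
  proof (cases "u = v")
    case True
    have "t ^ Suc j \<le> t" using t power_decreasing[of 1 "Suc j" t] by simp
    then have "t ^ Suc j \<le> \<delta>" using t by linarith
    then show ?thesis using True t by (simp add: z'_def del: power_Suc)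
  qed (simp add: z'V zb)
  moreover have "b u = 0" if u: "u \<in> s" and i: "i \<in> I" and s: "s \<subseteq> insert v V" "card s \<le> card (\<pi> ` s) + k"
    and b: "\<forall>w. (\<Sum>v\<in>{v\<in>s. \<pi> v = w}. b v) = 0" "\<forall>j<k. (\<Sum>v\<in>s. b v * (\<alpha> i v j + z' v j)) = 0" for i s b u
  proof -
    have fs: "finite s" using s insert.hyps finite_subset by blast
    \<comment> \<open>With \<open>b v = 0\<close> the relation lives on \<open>s - {v}\<close>.
      Removing \<open>v\<close> from \<open>s\<close> loses one vertex and at most one class, so the
      induction hypothesis applies.\<close>
    have restrict: "\<forall>u\<in>s - {v}. b u = 0" if bv: "v \<in> s \<Longrightarrow> b v = 0"
    proof -
      have 1: "s - {v} \<subseteq> V" using s by blast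
      have 2: "card (s - {v}) \<le> card (\<pi> ` (s - {v})) + k"
      proof (cases "v \<in> s")
        case True
        then have "\<pi> ` s = insert (\<pi> v) (\<pi> ` (s - {v}))" by blast
        then have "card (\<pi> ` s) \<le> Suc (card (\<pi> ` (s - {v})))" using fs by (simp add: card_insert_le_m1 card_insert_if)
        then show ?thesis using s(2) True fs by simp
      qed (use s in simp)
      have 3: "\<forall>w. (\<Sum>u\<in>{u \<in> s - {v}. \<pi> u = w}. b u) = 0"
      proof
        fix w
        have "(\<Sum>u\<in>{u \<in> s - {v}. \<pi> u = w}. b u) = (\<Sum>u\<in>{u \<in> s. \<pi> u = w}. b u)"
          by (rule sum.mono_neutral_left) (use fs bv in auto)
        then show "(\<Sum>u\<in>{u \<in> s - {v}. \<pi> u = w}. b u) = 0" using b(1) by simp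
      qed
      have 4: "\<forall>j<k. (\<Sum>u\<in>s - {v}. b u * (\<alpha> i u j + z u j)) = 0"
      proof (intro allI impI)
        fix j assume j: "j < k"
        have "(\<Sum>u\<in>s - {v}. b u * (\<alpha> i u j + z u j)) = (\<Sum>u\<in>s - {v}. b u * (\<alpha> i u j + z' u j))"
          by (rule sum.cong) (auto simp: z'V)
        also have "\<dots> = (\<Sum>u\<in>s. b u * (\<alpha> i u j + z' u j))"
          by (rule sum.mono_neutral_left) (use fs bv in auto)
        finally show "(\<Sum>u\<in>s - {v}. b u * (\<alpha> i u j + z u j)) = 0" using b(2) j by simp
      qed
      show ?thesis using z[OF i 1 2] 3 4 unfolding fibrewise_independent_def by blast
    qed
    \<comment> \<open>Applied to the relation given by \<open>b\<close>, the form \<open>L\<close>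
      kills every term except that of \<open>v\<close>, and \<open>L v\<close> is nonzero because
      \<open>t\<close> avoids \<open>B\<close>.\<close>
    have bv: "b v = 0" if v: "v \<in> s"
    proof -
      have sS: "s \<in> S" using s v by (simp add: S_def)
      define L where "L u = l i s (\<pi> u) + (\<Sum>j<k. y i s j * (\<alpha> i u j + z' u j))" for u
      have L0: "L u = 0" if "u \<in> s - {v}" for u
        using ly(1)[OF sS that, of i] that by (simp add: L_def z'V)
      have Lv: "L v \<noteq> 0"
        using t(4) i sS by (auto simp: B_def L_def z'_def)
      have "(\<Sum>u\<in>s. b u * l i s (\<pi> u)) = (\<Sum>w\<in>\<pi> ` s. \<Sum>u\<in>{u\<in>s. \<pi> u = w}. b u * l i s (\<pi> u))"
        by (rule sum.group[symmetric]) (use fs in auto)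
      also have "\<dots> = (\<Sum>w\<in>\<pi> ` s. (\<Sum>u\<in>{u\<in>s. \<pi> u = w}. b u) * l i s w)"
        by (intro sum.cong refl) (simp add: sum_distrib_right)
      also have "\<dots> = 0" using b(1) by simp
      finally have 1: "(\<Sum>u\<in>s. b u * l i s (\<pi> u)) = 0" .
      have "(\<Sum>u\<in>s. b u * (\<Sum>j<k. y i s j * (\<alpha> i u j + z' u j))) =
          (\<Sum>j<k. y i s j * (\<Sum>u\<in>s. b u * (\<alpha> i u j + z' u j)))"
        unfolding sum_distrib_left by (subst sum.swap) (simp add: mult.left_commute)
      also have "\<dots> = 0" using b(2) by simp
      finally have "(\<Sum>u\<in>s. b u * L u) = 0" using 1 by (simp add: L_def distrib_left sum.distrib)
      moreover have "(\<Sum>u\<in>s. b u * L u) = b v * L v"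
        using sum.remove[OF fs v, of "\<lambda>u. b u * L u"] L0 by simp
      ultimately show ?thesis using Lv by simp
    qed
    then show ?thesis using restrict u by blast
  qed
  ultimately show ?case unfolding fibrewise_independent_def by (intro exI[of _ z'] conjI allI ballI impI) auto
qed

section \<open>Shifted cubical grids and Kolmogorov's covering\<close>

lemma splits_neighbourhood:
  assumes "splits X \<omega> F"
  obtains W where "openin X W" "F \<subseteq> W" "splits X \<omega> W"
proof -
  obtain \<W> where \<W>: "finite \<W>" "\<And>W. W \<in> \<W> \<Longrightarrow> openin X W"
    "\<And>W. W \<in> \<W> \<Longrightarrow> \<exists>U\<in>\<omega>. W \<subseteq> U" "pairwise disjnt \<W>" "F \<subseteq> \<Union>\<W>"
    by (rule splitsE[OF assms, rule_format]) (rule that, assumption+)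
  have "splits X \<omega> (\<Union>\<W>)" by (rule splitsI[of \<W>]) (use \<W> in auto)
  then show ?thesis using that[of "\<Union>\<W>"] \<W> by blast
qed

text \<open>Off the grid, \<open>A\<close> falls into disjoint open cells on which every
  \<open>g i\<close> varies by at most \<open>1 / N\<close>. Each cell splits by
  \<open>small\<close>, and cutting its pieces down to the cell keeps pieces of different cells
  disjoint.\<close>

lemma splits_off_grid:
  fixes N s :: real and g :: "nat \<Rightarrow> 'a \<Rightarrow> real"
  assumes A: "openin X A" and g: "\<And>i. i < k \<Longrightarrow> continuous_map X euclideanreal (g i)"
    and bound: "\<And>i x. i < k \<Longrightarrow> x \<in> topspace X \<Longrightarrow> \<bar>g i x\<bar> \<le> 1" and N: "0 < N"
    and small: "\<And>a. a \<in> A \<Longrightarrow> splits X \<omega> {x\<in>A. \<forall>i<k. \<bar>g i a - g i x\<bar> \<le> 1 / N}"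
  shows "splits X \<omega> {x\<in>A. \<forall>i<k. N * g i x - s \<notin> \<int>}"
proof -
  have AX: "A \<subseteq> topspace X" using A openin_subset by blast
  \<comment> \<open>Finitely many cells suffice because every \<open>g i\<close> is bounded by 1;
    extensional index functions let a point determine the index of its cell.\<close>
  define C where "C = PiE {..<k} (\<lambda>_. {\<lfloor>- N - s\<rfloor>..\<lfloor>N - s\<rfloor>})"
  have finC: "finite C" unfolding C_def by (intro finite_PiE) auto
  define cell where "cell c = {x\<in>A. \<forall>i<k. of_int (c i) < N * g i x - s \<and> N * g i x - s < of_int (c i) + 1}"
    for c :: "nat \<Rightarrow> int"
  have cells: "splits X \<omega> (cell c)" for c
  proof (cases "cell c = {}")
    case False
    then obtain a where a: "a \<in> cell c" by blast
    have "\<bar>g i a - g i x\<bar> \<le> 1 / N" if x: "x \<in> cell c" and i: "i < k" for x i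
    proof -
      have "\<bar>N * g i a - N * g i x\<bar> \<le> 1" using a x i unfolding cell_def by force
      then have "N * \<bar>g i a - g i x\<bar> \<le> 1" using N by (simp add: abs_mult flip: right_diff_distrib)
      then show ?thesis using N by (simp add: field_simps)
    qed
    moreover have "a \<in> A" "cell c \<subseteq> A" using a by (auto simp: cell_def)
    ultimately show ?thesis using splits_mono[OF small[of a], of "cell c"] by blast
  qed simp
  have op: "openin X (cell c)" for c
  proof -
    define Q where "Q i = {x \<in> topspace X. of_int (c i) < N * g i x - s} \<inter> {x \<in> topspace X. N * g i x - s < of_int (c i) + 1}" for i
    have "openin X (Q i)" if "i < k" for i
      unfolding Q_def using g[OF that]
      by (intro openin_Int openin_real_less continuous_intros continuous_map_real_mult_left) auto
    then have "openin X (A \<inter> \<Inter>(Q ` {..<k}))" using A by (intro openin_Int_Inter) auto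
    moreover have "A \<inter> \<Inter>(Q ` {..<k}) = cell c" unfolding cell_def Q_def using AX by auto
    ultimately show ?thesis by simp
  qed
  have "\<forall>c\<in>C. \<exists>\<W>. finite \<W> \<and> (\<forall>W\<in>\<W>. openin X W \<and> (\<exists>U\<in>\<omega>. W \<subseteq> U)) \<and> pairwise disjnt \<W> \<and> cell c \<subseteq> \<Union>\<W>"
    using cells unfolding splits_def by simp
  from bchoice[OF this] obtain \<W> where \<W>: "\<forall>c\<in>C. finite (\<W> c) \<and>
      (\<forall>W\<in>\<W> c. openin X W \<and> (\<exists>U\<in>\<omega>. W \<subseteq> U)) \<and> pairwise disjnt (\<W> c) \<and> cell c \<subseteq> \<Union>(\<W> c)" ..
  then have \<W>: "finite (\<W> c) \<and> (\<forall>W\<in>\<W> c. openin X W \<and> (\<exists>U\<in>\<omega>. W \<subseteq> U)) \<and> pairwise disjnt (\<W> c) \<and>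
      cell c \<subseteq> \<Union>(\<W> c)" if "c \<in> C" for c using that by simp
  have uniq: "c = c'" if c: "c \<in> C" "c' \<in> C" "x \<in> cell c" "x \<in> cell c'" for c c' x
  proof
    fix i
    show "c i = c' i"
    proof (cases "i < k")
      case True
      then have "\<lfloor>N * g i x - s\<rfloor> = c i" "\<lfloor>N * g i x - s\<rfloor> = c' i"
        using c(3,4) unfolding cell_def by (auto intro!: floor_unique simp: less_imp_le)
      then show ?thesis by simp
    qed (use c(1,2) in \<open>auto simp: C_def PiE_def extensional_def\<close>)
  qed
  define \<V> where "\<V> = (\<Union>c\<in>C. (\<lambda>W. W \<inter> cell c) ` \<W> c)"
  show ?thesis
  proof (rule splitsI)
    show "finite \<V>" using finC \<W> by (auto simp: \<V>_def)
    show "openin X V" if "V \<in> \<V>" for V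
      using that \<W> op by (auto simp: \<V>_def)
    show "\<exists>U\<in>\<omega>. V \<subseteq> U" if V: "V \<in> \<V>" for V
    proof -
      obtain c W where "c \<in> C" "W \<in> \<W> c" "V = W \<inter> cell c" using V unfolding \<V>_def by blast
      moreover then obtain U where "U \<in> \<omega>" "W \<subseteq> U" using \<W> by blast
      ultimately show ?thesis by blast
    qed
    show "pairwise disjnt \<V>"
      unfolding pairwise_def
    proof (intro ballI impI)
      fix V V' assume "V \<in> \<V>" "V' \<in> \<V>"
        and ne: "V \<noteq> V'"
      then obtain c W c' W' where *: "c \<in> C" "W \<in> \<W> c" "V = W \<inter> cell c" "c' \<in> C" "W' \<in> \<W> c'" "V' = W' \<inter> cell c'"
        unfolding \<V>_def by blast
      show "disjnt V V'"
      proof (cases "c = c'")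
        case True
        then have "disjnt W W'" using * ne \<W>[of c] unfolding pairwise_def by blast
        then show ?thesis using * by (auto simp: disjnt_def)
      next
        case False
        then show ?thesis using * uniq unfolding disjnt_def by blast
      qed
    qed
    show "{x\<in>A. \<forall>i<k. N * g i x - s \<notin> \<int>} \<subseteq> \<Union>\<V>"
    proof
      fix x assume x: "x \<in> {x\<in>A. \<forall>i<k. N * g i x - s \<notin> \<int>}"
      define c where "c = (\<lambda>i\<in>{..<k}. \<lfloor>N * g i x - s\<rfloor>)"
      have "- N \<le> N * g i x \<and> N * g i x \<le> N" if "i < k" for i
        using bound[OF that, of x] AX x N mult_left_mono[of "g i x" 1 N] mult_left_mono[of "-1" "g i x" N] by auto
      then have "c \<in> C" unfolding C_def c_def by (auto intro!: floor_mono)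
      moreover have "x \<in> cell c" unfolding cell_def
      proof (intro CollectI conjI allI impI)
        fix i assume i: "i < k"
        have "N * g i x - s \<notin> \<int>" using x i by simp
        then have "of_int \<lfloor>N * g i x - s\<rfloor> \<noteq> N * g i x - s" by (metis Ints_of_int)
        then show "of_int (c i) < N * g i x - s" "N * g i x - s < of_int (c i) + 1"
          using i of_int_floor_le[of "N * g i x - s"] real_of_int_floor_add_one_gt[of "N * g i x - s"]
          by (auto simp: c_def order_less_le)
      qed (use x in auto)
      ultimately show "x \<in> \<Union>\<V>" using \<W>[of c] unfolding \<V>_def by blast
    qed
  qed
qed

text \<open>The radius is half the step \<open>1 / M\<close> between consecutive shifts, so the
  neighbourhoods of the \<open>M\<close> translates of \<int> are pairwise disjoint.\<close>

definition near_grid :: "nat \<Rightarrow> nat \<Rightarrow> real \<Rightarrow> bool" where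
  "near_grid M q t \<longleftrightarrow> infdist (t - real q / real M) \<int> < 1 / (2 * real M)"

text \<open>If \<open>t\<close> is near both, the shifts differ by less than \<open>1 / M\<close>
  modulo an integer. Multiplied by \<open>M\<close>, this leaves an integer of absolute value below
  1, so \<open>q\<close> and \<open>q'\<close> agree modulo \<open>M\<close>.\<close>

lemma near_grid_unique:
  assumes "near_grid M q t" "near_grid M q' t" "q < M" "q' < M"
  shows "q = q'"
proof -
  have *: "\<exists>a::int. \<bar>t - real r / real M - of_int a\<bar> < 1 / (2 * real M)" if r: "near_grid M r t" for r
  proof -
    have ne: "(\<int>::real set) \<noteq> {}" by (metis Ints_0 empty_iff)
    have "\<exists>b\<in>\<int>. dist (t - real r / real M) b < 1 / (2 * real M)"
    proof (rule ccontr)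
      assume "\<not> ?thesis"
      then have "1 / (2 * real M) \<le> infdist (t - real r / real M) \<int>"
        unfolding infdist_notempty[OF ne] by (intro cINF_greatest[OF ne]) (auto simp: not_less)
      then show False using r by (simp add: near_grid_def)
    qed
    then show ?thesis by (auto simp: dist_real_def elim!: Ints_cases)
  qed
  obtain a b where a: "\<bar>t - real q / real M - of_int a\<bar> < 1 / (2 * real M)"
    and b: "\<bar>t - real q' / real M - of_int b\<bar> < 1 / (2 * real M)"
    using *[OF assms(1)] *[OF assms(2)] by blast
  have M: "0 < real M" using assms(3) by simp
  have half: "1 / (2 * real M) + 1 / (2 * real M) = 1 / real M" by simp
  have "\<bar>(real q - real q') / real M + (of_int a - of_int b)\<bar> < 1 / real M"
    using a b half unfolding diff_divide_distrib by linarith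
  then have "\<bar>(real q - real q') / real M + (of_int a - of_int b)\<bar> * real M < 1"
    using M by (simp add: pos_less_divide_eq)
  also have "\<bar>(real q - real q') / real M + (of_int a - of_int b)\<bar> * real M =
      \<bar>((real q - real q') / real M + (of_int a - of_int b)) * real M\<bar>" using M by (simp add: abs_mult)
  also have "((real q - real q') / real M + (of_int a - of_int b)) * real M = of_int (int q - int q' + (a - b) * int M)"
    using M by (simp add: field_simps)
  finally have "int q - int q' + (a - b) * int M = 0" by linarith
  then have "int q' - int q = (a - b) * int M" by simp
  then have "int M dvd int q' - int q" by simp
  moreover have "\<bar>int q' - int q\<bar> < int M" using assms(3,4) by auto
  ultimately show ?thesis using zdvd_imp_le[of "int M" "\<bar>int q' - int q\<bar>"] by force
qed

lemma card_near_grid_le: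
  "card {q. q < M \<and> (\<exists>i<k. near_grid M q (t i))} \<le> k"
proof -
  have "card {q. q < M \<and> (\<exists>i<k. near_grid M q (t i))} \<le> card (\<Union>i<k. {q. q < M \<and> near_grid M q (t i)})"
    by (rule card_mono) auto
  also have "\<dots> \<le> (\<Sum>i<k. card {q. q < M \<and> near_grid M q (t i)})" by (rule card_UN_le) simp
  also have "\<dots> \<le> (\<Sum>i<k. 1)"
  proof (rule sum_mono)
    fix i
    have "\<forall>q\<in>{q. q < M \<and> near_grid M q (t i)}. \<forall>q'\<in>{q. q < M \<and> near_grid M q (t i)}. q = q'"
      using near_grid_unique by blast
    then show "card {q. q < M \<and> near_grid M q (t i)} \<le> 1" by (simp add: card_le_Suc0_iff_eq)
  qed
  finally show ?thesis by simp
qed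

lemma on_grid_imp_near_grid:
  assumes "t - real q / real M \<in> \<int>" "0 < M"
  shows "near_grid M q t"
  using assms by (simp add: near_grid_def)

text \<open>Kolmogorov's covering: the cells of \<open>k + 1\<close> shifted cubical grids cover the cube, since a point lies on
  at most \<open>k\<close> of the grids.\<close>

lemma light_imp_covering_dim_le:
  assumes X: "compact_space X" and g: "\<And>i. i < k \<Longrightarrow> continuous_map X euclideanreal (g i)"
    and bound: "\<And>i x. i < k \<Longrightarrow> x \<in> topspace X \<Longrightarrow> \<bar>g i x\<bar> \<le> 1"
    and light: "\<And>\<omega> a. open_cover X \<omega> \<Longrightarrow> a \<in> topspace X \<Longrightarrow>
      splits X \<omega> {x \<in> topspace X. \<forall>i<k. g i x = g i a}"
  shows "covering_dim_le X k"
  unfolding covering_dim_le_def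
proof (intro allI impI, elim conjE)
  fix \<U> assume \<U>: "open_cover X \<U>"
  define D where "D x y = (\<Sum>i<k. \<bar>g i x - g i y\<bar>)" for x y
  define \<O> where "\<O> = {W. openin X W \<and> splits X \<U> W}"
  obtain \<delta> where \<delta>: "0 < \<delta>" "\<And>x. x \<in> topspace X \<Longrightarrow> \<exists>U\<in>\<O>. {y \<in> topspace X. D x y < \<delta>} \<subseteq> U"
  proof (rule pseudometric_lebesgue_number[OF X, of D \<O>])
    show "continuous_map X euclideanreal (D x)" for x
      unfolding D_def using g by (intro continuous_intros) auto
    show "0 \<le> D x y" "D x x = 0" for x y by (auto simp: D_def sum_nonneg)
    show "D x z \<le> D x y + D y z" for x y z
      unfolding D_def sum.distrib[symmetric] by (intro sum_mono) auto
    show "\<exists>U\<in>\<O>. openin X U \<and> {y \<in> topspace X. D a y = 0} \<subseteq> U" if a: "a \<in> topspace X" for a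
    proof -
      obtain W where W: "openin X W" "{x \<in> topspace X. \<forall>i<k. g i x = g i a} \<subseteq> W" "splits X \<U> W"
        using splits_neighbourhood[OF light[OF \<U> a]] by blast
      have "{y \<in> topspace X. D a y = 0} \<subseteq> {x \<in> topspace X. \<forall>i<k. g i x = g i a}"
        by (auto simp: D_def sum_nonneg_eq_0_iff)
      then show ?thesis using W unfolding \<O>_def by (intro bexI[of _ W]) auto
    qed
  qed blast
  obtain n :: nat where n: "real k / \<delta> < real n" using reals_Archimedean2 by blast
  \<comment> \<open>A cell has width at most \<open>1 / N\<close> in each of the \<open>k\<close>
    coordinates, so its \<open>D\<close>-diameter is at most \<open>k / N\<close>, below the
    Lebesgue number.\<close>
  define N where "N = real (Suc n)"
  have N: "0 < N" "real k / N < \<delta>"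
    using n \<delta>(1) by (auto simp: N_def field_simps)
  have sp: "splits X \<U> {x \<in> topspace X. \<forall>i<k. N * g i x - real j / real (Suc k) \<notin> \<int>}" for j
  proof (rule splits_off_grid[OF openin_topspace g bound])
    fix a assume "a \<in> topspace X"
    then obtain W where W: "splits X \<U> W" "{y \<in> topspace X. D a y < \<delta>} \<subseteq> W"
      using \<delta>(2) unfolding \<O>_def by blast
    have "D a x < \<delta>" if "\<forall>i<k. \<bar>g i a - g i x\<bar> \<le> 1 / N" for x
    proof -
      have "D a x \<le> (\<Sum>i<k. 1 / N)" unfolding D_def using that by (intro sum_mono) auto
      then show ?thesis using N by simp
    qed
    then show "splits X \<U> {x \<in> topspace X. \<forall>i<k. \<bar>g i a - g i x\<bar> \<le> 1 / N}"
      by (intro splits_mono[OF W(1)] subset_trans[OF _ W(2)]) auto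
  qed (use N in auto)
  then have "\<forall>j. \<exists>\<W>. finite \<W> \<and> (\<forall>W\<in>\<W>. openin X W \<and> (\<exists>U\<in>\<U>. W \<subseteq> U)) \<and>
     pairwise disjnt \<W> \<and> {x \<in> topspace X. \<forall>i<k. N * g i x - real j / real (Suc k) \<notin> \<int>} \<subseteq> \<Union>\<W>"
    unfolding splits_def by blast
  from choice[OF this] obtain \<W> where "\<forall>j. finite (\<W> j) \<and> (\<forall>W\<in>\<W> j. openin X W \<and> (\<exists>U\<in>\<U>. W \<subseteq> U)) \<and>
     pairwise disjnt (\<W> j) \<and> {x \<in> topspace X. \<forall>i<k. N * g i x - real j / real (Suc k) \<notin> \<int>} \<subseteq> \<Union>(\<W> j)" ..
  then have \<W>: "finite (\<W> j)" "W \<in> \<W> j \<Longrightarrow> openin X W \<and> (\<exists>U\<in>\<U>. W \<subseteq> U)" "pairwise disjnt (\<W> j)"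
     "{x \<in> topspace X. \<forall>i<k. N * g i x - real j / real (Suc k) \<notin> \<int>} \<subseteq> \<Union>(\<W> j)" for j W
    by simp_all
  show "\<exists>\<V>. finite \<V> \<and> open_cover X \<V> \<and> refines \<V> \<U> \<and> (\<forall>x\<in>topspace X. card {V \<in> \<V>. x \<in> V} \<le> k + 1)"
  proof (intro exI[of _ "\<Union>j\<le>k. \<W> j"] conjI ballI)
    show "finite (\<Union>j\<le>k. \<W> j)" using \<W>(1) by blast
    have "x \<in> \<Union>(\<Union>j\<le>k. \<W> j)" if x: "x \<in> topspace X" for x
    proof -
      have "card {q. q < Suc k \<and> (\<exists>i<k. near_grid (Suc k) q (N * g i x))} < card {..<Suc k}"
        using card_near_grid_le[of "Suc k" k "\<lambda>i. N * g i x"] by simp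
      then have "\<not> {..<Suc k} \<subseteq> {q. q < Suc k \<and> (\<exists>i<k. near_grid (Suc k) q (N * g i x))}"
        using card_mono[of "{q. q < Suc k \<and> (\<exists>i<k. near_grid (Suc k) q (N * g i x))}" "{..<Suc k}"] by auto
      then obtain j where "j < Suc k" "\<And>i. i < k \<Longrightarrow> \<not> near_grid (Suc k) j (N * g i x)" by blast
      then have "j \<le> k" "\<forall>i<k. N * g i x - real j / real (Suc k) \<notin> \<int>"
        using on_grid_imp_near_grid[of _ j "Suc k"] by auto
      then have "x \<in> \<Union>(\<W> j)" using \<W>(4)[of j] x by blast
      then show ?thesis using \<open>j \<le> k\<close> by blast
    qed
    then show "open_cover X (\<Union>j\<le>k. \<W> j)"
      unfolding open_cover_def using \<W>(2) openin_subset by blast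
    show "refines (\<Union>j\<le>k. \<W> j) \<U>" unfolding refines_def using \<W>(2) by blast
    fix x
    have "{V \<in> \<Union>j\<le>k. \<W> j. x \<in> V} = (\<Union>j\<le>k. {V \<in> \<W> j. x \<in> V})" by blast
    then have "card {V \<in> \<Union>j\<le>k. \<W> j. x \<in> V} \<le> (\<Sum>j\<le>k. card {V \<in> \<W> j. x \<in> V})"
      using card_UN_le[of "{..k}" "\<lambda>j. {V \<in> \<W> j. x \<in> V}"] by simp
    also have "\<dots> \<le> (\<Sum>j\<le>k. 1)" by (intro sum_mono card_disjoint_members \<W>(3))
    finally show "card {V \<in> \<Union>j\<le>k. \<W> j. x \<in> V} \<le> k + 1" by simp
  qed
qed

section \<open>Simplicial maps\<close>

text \<open>For a retract, monotonicity of dimension is elementary: covers of \<open>P\<close> pull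
  back along \<open>q\<close>, refinements return along \<open>e\<close>, and members through
  \<open>x\<close> come from members through \<open>e x\<close>, so the multiplicity does not
  grow.\<close>

lemma covering_dim_le_retract:
  assumes dim: "covering_dim_le Q k" and e: "continuous_map P Q e" and q: "continuous_map Q P q"
    and qe: "\<And>x. x \<in> topspace P \<Longrightarrow> q (e x) = x"
  shows "covering_dim_le P k"
  unfolding covering_dim_le_def
proof (intro allI impI, elim conjE)
  fix \<U> assume fin: "finite \<U>" and \<U>: "open_cover P \<U>"
  define fwd where "fwd U = {x \<in> topspace Q. q x \<in> U}" for U
  define bwd where "bwd V = {x \<in> topspace P. e x \<in> V}" for V
  have eQ: "e x \<in> topspace Q" if "x \<in> topspace P" for x
    using e that continuous_map_image_subset_topspace by blast
  have qP: "q x \<in> topspace P" if "x \<in> topspace Q" for x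
    using q that continuous_map_image_subset_topspace by blast
  have "open_cover Q (fwd ` \<U>)" unfolding open_cover_def
  proof (intro conjI ballI)
    show "openin Q W" if "W \<in> fwd ` \<U>" for W
      using that \<U> openin_continuous_map_preimage[OF q] by (auto simp: fwd_def open_cover_def)
    show "\<Union>(fwd ` \<U>) = topspace Q"
      using qP \<U> unfolding fwd_def open_cover_def by (auto 4 3)
  qed
  then obtain \<V> where \<V>: "finite \<V>" "open_cover Q \<V>" "refines \<V> (fwd ` \<U>)"
      "\<And>x. x \<in> topspace Q \<Longrightarrow> card {V \<in> \<V>. x \<in> V} \<le> k + 1"
    using dim[unfolded covering_dim_le_def, rule_format, of "fwd ` \<U>"] fin by auto
  show "\<exists>\<V>. finite \<V> \<and> open_cover P \<V> \<and> refines \<V> \<U> \<and> (\<forall>x\<in>topspace P. card {V \<in> \<V>. x \<in> V} \<le> k + 1)"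
  proof (intro exI[of _ "bwd ` \<V>"] conjI ballI)
    show "finite (bwd ` \<V>)" using \<V>(1) by simp
    show "open_cover P (bwd ` \<V>)" unfolding open_cover_def
    proof (intro conjI ballI)
      show "openin P W" if "W \<in> bwd ` \<V>" for W
        using that \<V>(2) openin_continuous_map_preimage[OF e] by (auto simp: bwd_def open_cover_def)
      show "\<Union>(bwd ` \<V>) = topspace P"
        using eQ \<V>(2) unfolding bwd_def open_cover_def by (auto 4 3)
    qed
    show "refines (bwd ` \<V>) \<U>"
      unfolding refines_def
    proof
      fix W assume "W \<in> bwd ` \<V>"
      then obtain V where V: "V \<in> \<V>" "W = bwd V" by blast
      then obtain U where U: "U \<in> \<U>" "V \<subseteq> fwd U" using \<V>(3) unfolding refines_def by blast
      have "W \<subseteq> U"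
      proof
        fix x assume "x \<in> W"
        then have "x \<in> topspace P" "e x \<in> V" using V(2) by (auto simp: bwd_def)
        then show "x \<in> U" using U(2) qe[of x] by (auto simp: fwd_def)
      qed
      then show "\<exists>U\<in>\<U>. W \<subseteq> U" using U(1) by blast
    qed
    fix x assume x: "x \<in> topspace P"
    have "{W \<in> bwd ` \<V>. x \<in> W} \<subseteq> bwd ` {V \<in> \<V>. e x \<in> V}" by (auto simp: bwd_def)
    then have "card {W \<in> bwd ` \<V>. x \<in> W} \<le> card {V \<in> \<V>. e x \<in> V}"
      using \<V>(1) by (intro surj_card_le) auto
    then show "card {W \<in> bwd ` \<V>. x \<in> W} \<le> k + 1" using \<V>(4)[OF eQ[OF x]] by simp
  qed
qed

section \<open>Closed simplices and the weak topology\<close>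

lemma closed_closed_simplex: "closed (closed_simplex s)"
proof -
  have "closed_simplex s = (\<Inter>v. {a. 0 \<le> a v}) \<inter> (\<Inter>v\<in>-s. {a. a v = 0}) \<inter> {a. (\<Sum>v\<in>s. a v) = 1}"
    by (auto simp: closed_simplex_def)
  then show ?thesis
    by (auto intro!: closed_Int closed_INT closed_Collect_le closed_Collect_eq continuous_intros
        continuous_on_coordinate)
qed

lemma closed_simplex_le_1:
  assumes "a \<in> closed_simplex s" shows "a v \<le> 1"
proof (cases "v \<in> s \<and> finite s")
  case True
  then have "a v \<le> (\<Sum>v\<in>s. a v)" using assms by (intro member_le_sum) (auto simp: closed_simplex_def)
  then show ?thesis using assms by (simp add: closed_simplex_def)
qed (use assms in \<open>auto simp: closed_simplex_def\<close>)

lemma compact_closed_simplex: "compact (closed_simplex s)"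
proof -
  have "compact ({x::nat \<Rightarrow> real. \<forall>i. x i \<in> {0..1}} \<inter> closed_simplex s)"
    by (rule compact_Int_closed[OF compact_bounded_nat_fun closed_closed_simplex])
  moreover have "{x::nat \<Rightarrow> real. \<forall>i. x i \<in> {0..1}} \<inter> closed_simplex s = closed_simplex s"
    using closed_simplex_le_1 by (auto simp: closed_simplex_def)
  ultimately show ?thesis by simp
qed

lemma closed_simplex_sum_superset:
  assumes "a \<in> closed_simplex s" "finite t" "s \<subseteq> t"
  shows "(\<Sum>v\<in>t. a v) = 1"
proof -
  have "(\<Sum>v\<in>t. a v) = (\<Sum>v\<in>s. a v)"
    by (rule sum.mono_neutral_right) (use assms in \<open>auto simp: closed_simplex_def\<close>)
  then show ?thesis using assms by (simp add: closed_simplex_def)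
qed

lemma closed_simplex_mono:
  assumes "t \<subseteq> s" "finite s"
  shows "closed_simplex t \<subseteq> closed_simplex s"
  using assms closed_simplex_sum_superset[OF _ assms(2,1)] by (auto simp: closed_simplex_def)

definition support :: "(nat \<Rightarrow> real) \<Rightarrow> nat set" where
  "support a = {v. a v \<noteq> 0}"

lemma closed_simplex_support:
  assumes a: "a \<in> closed_simplex s" and "finite s"
  shows "support a \<subseteq> s" "support a \<noteq> {}" "a \<in> closed_simplex (support a)"
proof -
  show s: "support a \<subseteq> s" using a by (auto simp: closed_simplex_def support_def)
  have 1: "(\<Sum>v\<in>support a. a v) = 1"
  proof -
    have "(\<Sum>v\<in>support a. a v) = (\<Sum>v\<in>s. a v)"
      by (rule sum.mono_neutral_left) (use s assms in \<open>auto simp: support_def\<close>)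
    then show ?thesis using a by (simp add: closed_simplex_def)
  qed
  then show "support a \<noteq> {}" by force
  show "a \<in> closed_simplex (support a)"
    using 1 a by (auto simp: closed_simplex_def support_def)
qed

lemma support_in_complex:
  assumes "abstract_complex K" "a \<in> topspace (polyhedron_of K)"
  shows "support a \<in> K" "a \<in> closed_simplex (support a)"
proof -
  obtain s where s: "s \<in> K" "a \<in> closed_simplex s" using assms(2) by (auto simp: topspace_polyhedron_of)
  then have "finite s" using assms(1) by (auto simp: abstract_complex_def)
  then show "support a \<in> K" "a \<in> closed_simplex (support a)"
    using closed_simplex_support[OF s(2)] assms(1) s(1) unfolding abstract_complex_def by blast+
qed

lemma continuous_map_simplex_inclusion:
  assumes "s \<in> K"
  shows "continuous_map (top_of_set (closed_simplex s)) (polyhedron_of K) (\<lambda>a. a)"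
  unfolding continuous_map_def
proof (intro conjI allI impI)
  show "(\<lambda>a. a) \<in> topspace (top_of_set (closed_simplex s)) \<rightarrow> topspace (polyhedron_of K)"
    using assms by (auto simp: topspace_polyhedron_of)
  fix U assume "openin (polyhedron_of K) U"
  then have "openin (top_of_set (closed_simplex s)) (U \<inter> closed_simplex s)"
    using assms by (simp add: openin_polyhedron_of)
  moreover have "{x \<in> topspace (top_of_set (closed_simplex s)). x \<in> U} = U \<inter> closed_simplex s" by auto
  ultimately show "openin (top_of_set (closed_simplex s)) {x \<in> topspace (top_of_set (closed_simplex s)). x \<in> U}"
    by simp
qed

lemma continuous_map_polyhedron_inclusion: "continuous_map (polyhedron_of K) euclidean (\<lambda>a. a)"
  unfolding continuous_map_def
proof (intro conjI allI impI)
  fix U :: "(nat \<Rightarrow> real) set" assume U: "openin euclidean U"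
  show "openin (polyhedron_of K) {x \<in> topspace (polyhedron_of K). x \<in> U}"
    unfolding openin_polyhedron_of
  proof (intro conjI ballI)
    show "{x \<in> topspace (polyhedron_of K). x \<in> U} \<subseteq> \<Union> (closed_simplex ` K)"
      by (auto simp: topspace_polyhedron_of)
    fix s assume "s \<in> K"
    then have "{x \<in> topspace (polyhedron_of K). x \<in> U} \<inter> closed_simplex s = closed_simplex s \<inter> U"
      by (auto simp: topspace_polyhedron_of)
    then show "openin (top_of_set (closed_simplex s)) ({x \<in> topspace (polyhedron_of K). x \<in> U} \<inter> closed_simplex s)"
      using U by (auto simp: openin_subtopology)
  qed
qed simp

lemma continuous_map_barycentric: "continuous_map (polyhedron_of K) euclideanreal (\<lambda>a. a v)"
proof -
  have "continuous_map euclidean euclideanreal (\<lambda>a::nat \<Rightarrow> real. a v)"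
    using continuous_on_coordinate[of UNIV v] by simp
  from continuous_map_compose[OF continuous_map_polyhedron_inclusion this]
  show ?thesis by (simp add: o_def)
qed

text \<open>The complement of a weakly open set is a union of closed sets, one in each simplex;
  finiteness of \<open>K\<close> makes this union closed.\<close>

lemma polyhedron_of_finite:
  assumes "finite K"
  shows "polyhedron_of K = top_of_set (\<Union>s\<in>K. closed_simplex s)"
proof (rule topology_eq[THEN iffD2], intro allI iffI)
  fix U
  let ?P = "\<Union>s\<in>K. closed_simplex s"
  assume U: "openin (polyhedron_of K) U"
  then have UP: "U \<subseteq> ?P" by (simp add: openin_polyhedron_of)
  have "closed (closed_simplex s - U)" if "s \<in> K" for s
  proof -
    have "openin (top_of_set (closed_simplex s)) (U \<inter> closed_simplex s)"
      using U that by (simp add: openin_polyhedron_of)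
    then have "closedin (top_of_set (closed_simplex s)) (closed_simplex s - U \<inter> closed_simplex s)"
      by (metis closedin_diff closedin_topspace topspace_euclidean_subtopology)
    then have "closedin (top_of_set (closed_simplex s)) (closed_simplex s - U)" by (simp add: Diff_Int_distrib Diff_Int)
    then show ?thesis using closed_closed_simplex closedin_closed_trans by blast
  qed
  then have "closed (\<Union>s\<in>K. closed_simplex s - U)" using assms by (intro closed_UN) auto
  then have "openin (top_of_set ?P) (?P \<inter> - (\<Union>s\<in>K. closed_simplex s - U))"
    by (rule openin_open_Int[OF open_Compl])
  moreover have "?P \<inter> - (\<Union>s\<in>K. closed_simplex s - U) = U" using UP by blast
  ultimately show "openin (top_of_set ?P) U" by simp
next
  fix U
  assume "openin (top_of_set (\<Union>s\<in>K. closed_simplex s)) U"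
  then obtain T where T: "open T" "U = (\<Union>s\<in>K. closed_simplex s) \<inter> T" by (auto simp: openin_open)
  have "U \<inter> closed_simplex s = closed_simplex s \<inter> T" if "s \<in> K" for s using that T by blast
  then show "openin (polyhedron_of K) U"
    unfolding openin_polyhedron_of using T by (auto intro: openin_open_Int)
qed

lemma compact_finite_polyhedron: "finite K \<Longrightarrow> compact (\<Union>s\<in>K. closed_simplex s)"
  by (intro compact_UN compact_closed_simplex) auto

lemma finite_imp_admissible_complex:
  assumes "finite K" "abstract_complex K"
  shows "admissible_complex K"
proof -
  have "metrizable_space (polyhedron_of K)"
    unfolding polyhedron_of_finite[OF assms(1)]
    by (intro metrizable_space_subtopology metrizable_space_euclidean)
  moreover have "second_countable (euclidean :: (nat \<Rightarrow> real) topology)"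
  proof -
    obtain B :: "(nat \<Rightarrow> real) set set" where B: "countable B" "\<And>C. C \<in> B \<Longrightarrow> open C"
        "\<And>S. open S \<Longrightarrow> \<exists>U. U \<subseteq> B \<and> S = \<Union>U"
      by (rule univ_second_countable) blast
    show ?thesis unfolding second_countable_def
    proof (intro exI[of _ B] conjI ballI allI impI)
      fix U and x :: "nat \<Rightarrow> real" assume "openin euclidean U \<and> x \<in> U"
      then show "\<exists>V\<in>B. x \<in> V \<and> V \<subseteq> U" using B(3)[of U] by auto
    qed (use B in auto)
  qed
  then have "separable_space (polyhedron_of K)"
    unfolding polyhedron_of_finite[OF assms(1)]
    by (intro second_countable_imp_separable_space second_countable_subtopology)
  ultimately show ?thesis using assms(2) by (simp add: admissible_complex_def)
qed

text \<open>Points with distinct supports form a closed discrete set in the weak topology.\<close>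

lemma finite_supports_compact_image:
  assumes X: "compact_space X" and \<kappa>: "continuous_map X (polyhedron_of K) \<kappa>" and K: "abstract_complex K"
  shows "finite ((\<lambda>x. support (\<kappa> x)) ` topspace X)"
proof -
  have \<kappa>K: "\<kappa> x \<in> topspace (polyhedron_of K)" if "x \<in> topspace X" for x
    using \<kappa> that continuous_map_image_subset_topspace by blast
  define S where "S = (\<lambda>x. support (\<kappa> x)) ` topspace X"
  have "\<forall>s\<in>S. \<exists>x. x \<in> topspace X \<and> support (\<kappa> x) = s" by (auto simp: S_def)
  from bchoice[OF this] obtain c where c: "\<forall>s\<in>S. c s \<in> topspace X \<and> support (\<kappa> (c s)) = s" ..
  define a where "a s = \<kappa> (c s)" for s
  have a: "support (a s) = s" "a s \<in> topspace (polyhedron_of K)" if "s \<in> S" for s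
    using c that \<kappa>K by (auto simp: a_def)
  \<comment> \<open>\<open>W s\<close> discards every chosen point but \<open>a s\<close>, so
    finitely many of these sets can account for finitely many supports only.\<close>
  define W where "W s = topspace (polyhedron_of K) - a ` (S - {s})" for s
  have op: "openin (polyhedron_of K) (W s)" for s
    unfolding openin_polyhedron_of
  proof (intro conjI ballI)
    show "W s \<subseteq> \<Union> (closed_simplex ` K)" by (auto simp: W_def topspace_polyhedron_of)
    fix t assume t: "t \<in> K"
    then have ft: "finite t" using K by (auto simp: abstract_complex_def)
    \<comment> \<open>A chosen point in the simplex \<open>t\<close> has a subset of
      \<open>t\<close> as its support, and the support determines the point.\<close>
    have sub: "a ` (S - {s}) \<inter> closed_simplex t \<subseteq> a ` Pow t"
      using a closed_simplex_support(1)[OF _ ft] by force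
    have "finite (a ` (S - {s}) \<inter> closed_simplex t)"
      by (rule finite_subset[OF sub]) (use ft in simp)
    then have "open (- (a ` (S - {s}) \<inter> closed_simplex t))" by (rule open_Compl[OF finite_imp_closed])
    then have "openin (top_of_set (closed_simplex t)) (closed_simplex t \<inter> - (a ` (S - {s}) \<inter> closed_simplex t))"
      by (rule openin_open_Int)
    moreover have "closed_simplex t \<inter> - (a ` (S - {s}) \<inter> closed_simplex t) = W s \<inter> closed_simplex t"
      using t by (auto simp: W_def topspace_polyhedron_of)
    ultimately show "openin (top_of_set (closed_simplex t)) (W s \<inter> closed_simplex t)" by simp
  qed
  obtain F where F: "finite F" "F \<subseteq> topspace X"
      "topspace X \<subseteq> (\<Union>x\<in>F. {y \<in> topspace X. \<kappa> y \<in> W (support (\<kappa> x))})"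
  proof (rule compact_space_point_cover[OF X, of "\<lambda>x. {y \<in> topspace X. \<kappa> y \<in> W (support (\<kappa> x))}"])
    fix x assume x: "x \<in> topspace X"
    have "\<kappa> x \<in> W (support (\<kappa> x))" using \<kappa>K[OF x] a(1) by (auto simp: W_def)
    then show "openin X {y \<in> topspace X. \<kappa> y \<in> W (support (\<kappa> x))} \<and> x \<in> {y \<in> topspace X. \<kappa> y \<in> W (support (\<kappa> x))}"
      using x openin_continuous_map_preimage[OF \<kappa> op] by simp
  qed
  have "S \<subseteq> (\<lambda>x. support (\<kappa> x)) ` F"
  proof
    fix s assume s: "s \<in> S"
    then obtain x where x: "x \<in> F" "a s \<in> W (support (\<kappa> x))" using F(3) c unfolding a_def by blast
    then have "s = support (\<kappa> x)" using s by (auto simp: W_def)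
    then show "s \<in> (\<lambda>x. support (\<kappa> x)) ` F" using x(1) by blast
  qed
  then show ?thesis using F(1) finite_surj unfolding S_def by blast
qed

section \<open>Vertex maps and the dimension of their fibres\<close>

abbreviation unit_at :: "nat \<Rightarrow> nat \<Rightarrow> real" where
  "unit_at v \<equiv> (\<lambda>u. if u = v then 1 else 0)"

lemma unit_at_in_closed_simplex: "v \<in> s \<Longrightarrow> finite s \<Longrightarrow> unit_at v \<in> closed_simplex s"
  by (auto simp: closed_simplex_def)

lemma closed_simplex_singleton: "closed_simplex {v} = {unit_at v}"
  by (auto simp: closed_simplex_def fun_eq_iff)

text \<open>What is given about \<open>p\<close> concerns images of simplices and segments only.
  Vertices go to vertices because a one-point simplex is a vertex; the barycentric formula then
  follows by splitting off one vertex at a time.\<close>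

lemma simplicial_map_vertex_map:
  assumes K: "abstract_complex K" and L: "abstract_complex L" and p: "simplicial_map K L p"
  obtains \<pi> where "\<And>s a w. s \<in> K \<Longrightarrow> a \<in> closed_simplex s \<Longrightarrow> p a w = (\<Sum>v\<in>{v\<in>s. \<pi> v = w}. a v)"
proof -
  have face: "t \<in> K" if "s \<in> K" "t \<subseteq> s" "t \<noteq> {}" for s t
    using K[unfolded abstract_complex_def, THEN bspec, OF that(1)] that(2,3) by blast
  have affine: "p (\<lambda>v. (1 - u) * a v + u * b v) = (\<lambda>w. (1 - u) * p a w + u * p b w)"
    if "s \<in> K" "a \<in> closed_simplex s" "b \<in> closed_simplex s" "u \<in> {0..1}" for s a b u
    using p that unfolding simplicial_map_def by (elim conjE) (drule (1) bspec, elim conjE, simp only: Ball_def)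
  have "\<exists>w. p (unit_at v) = unit_at w" if v: "{v} \<in> K" for v
  proof -
    obtain t where t: "t \<in> L" "p ` closed_simplex {v} = closed_simplex t"
      using p v unfolding simplicial_map_def by meson
    then have t': "closed_simplex t = {p (unit_at v)}" "finite t" "t \<noteq> {}"
      using L by (auto simp: closed_simplex_singleton abstract_complex_def)
    then obtain w where "w \<in> t" by blast
    then have "unit_at w \<in> closed_simplex t" using t'(2) by (rule unit_at_in_closed_simplex)
    then have "unit_at w = p (unit_at v)" unfolding t'(1) by (rule singletonD)
    then show ?thesis by (intro exI[of _ w]) (rule sym)
  qed
  then obtain \<pi> where \<pi>: "\<And>v. {v} \<in> K \<Longrightarrow> p (unit_at v) = unit_at (\<pi> v)" by metis
  have pt: "p a w = (\<Sum>v\<in>t. a v * unit_at (\<pi> v) w)" if "finite t" "t \<noteq> {}" "t \<in> K" "a \<in> closed_simplex t" for t a w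
    using that
  proof (induction t arbitrary: a w rule: finite_ne_induct)
    case (singleton v)
    then show ?case using \<pi>[of v] by (simp add: closed_simplex_singleton)
  next
    case (insert v t)
    have tK: "t \<in> K" "{v} \<in> K" by (rule face[OF insert.prems(1)]; use insert.hyps in auto)+
    have a0: "0 \<le> a u" "u \<notin> insert v t \<Longrightarrow> a u = 0" for u using insert.prems by (auto simp: closed_simplex_def)
    have a1: "a v + (\<Sum>u\<in>t. a u) = 1" using insert by (simp add: closed_simplex_def)
    have dv: "unit_at v \<in> closed_simplex (insert v t)" using insert by (intro unit_at_in_closed_simplex) auto
    show ?case
    proof (cases "a v = 1")
      case True
      then have "(\<Sum>u\<in>t. a u) = 0" using a1 by simp
      then have at: "\<forall>u\<in>t. a u = 0" using insert a0 by (simp add: sum_nonneg_eq_0_iff)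
      have "a u = unit_at v u" for u
        using True at a0(2)[of u] by auto
      then have "a = unit_at v" by blast
      then show ?thesis using \<pi>[OF tK(2)] at True insert by simp
    next
      case False
      \<comment> \<open>The point is a convex combination of the vertex \<open>v\<close> and its
        projection \<open>a'\<close> from \<open>v\<close> to the opposite face, which exists
        because \<open>a v\<close> differs from 1.\<close>
      define c where "c = 1 - a v"
      have c: "0 < c" "c \<noteq> 0" using False a1 sum_nonneg[of t a] a0 by (auto simp: c_def)
      define a' where "a' = (\<lambda>u. if u = v then 0 else a u / c)"
      have a't: "(\<Sum>u\<in>t. a' u) = (\<Sum>u\<in>t. a u) / c"
        unfolding sum_divide_distrib by (rule sum.cong) (use insert in \<open>auto simp: a'_def\<close>)
      have a': "a' \<in> closed_simplex t"
        using a't a1 c a0 insert.hyps unfolding closed_simplex_def by (auto simp: a'_def c_def)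
      then have a'': "a' \<in> closed_simplex (insert v t)"
        using closed_simplex_mono[of t "insert v t"] insert by auto
      have ac: "a = (\<lambda>u. (1 - a v) * a' u + a v * unit_at v u)"
        using c by (auto simp: a'_def c_def)
      have av: "a v \<in> {0..1}" using a0 c by (simp add: c_def)
      have "p a = p (\<lambda>u. (1 - a v) * a' u + a v * unit_at v u)" by (rule arg_cong[where f = p, OF ac])
      also have "\<dots> = (\<lambda>w. (1 - a v) * p a' w + a v * p (unit_at v) w)"
        by (rule affine[OF insert.prems(1) a'' dv av])
      finally have "p a = (\<lambda>w. (1 - a v) * p a' w + a v * p (unit_at v) w)" .
      then have "p a w = c * p a' w + a v * unit_at (\<pi> v) w" using \<pi>[OF tK(2)] by (simp add: c_def)
      also have "p a' w = (\<Sum>u\<in>t. a' u * unit_at (\<pi> u) w)" by (rule insert.IH[OF tK(1) a'])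
      also have "c * \<dots> = (\<Sum>u\<in>t. a u * unit_at (\<pi> u) w)"
        unfolding sum_distrib_left by (rule sum.cong) (use c insert.hyps in \<open>auto simp: a'_def\<close>)
      finally show ?thesis using insert.hyps by simp
    qed
  qed
  have "p a w = (\<Sum>v\<in>{v\<in>s. \<pi> v = w}. a v)" if s: "s \<in> K" "a \<in> closed_simplex s" for s a w
  proof -
    have fs: "finite s" "s \<noteq> {}" using K s(1) by (auto simp: abstract_complex_def)
    have "(\<Sum>v\<in>{v\<in>s. \<pi> v = w}. a v) = (\<Sum>v\<in>s. a v * unit_at (\<pi> v) w)"
      unfolding sum.inter_filter[OF fs(1)] by (rule sum.cong) auto
    then show ?thesis using pt[OF fs s] by simp
  qed
  then show ?thesis by (rule that)
qed

text \<open>A fibre over an interior point of the image simplex contains a cube of dimension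
  \<open>card s - card (\<pi> ` s)\<close> as a retract.\<close>

lemma map_dim_le_imp_card_le:
  assumes K: "abstract_complex K" and p: "continuous_map (polyhedron_of K) L p"
    and p\<pi>: "\<And>a w. a \<in> closed_simplex s \<Longrightarrow> p a w = (\<Sum>v\<in>{v\<in>s. \<pi> v = w}. a v)"
    and dim: "map_dim_le (polyhedron_of K) L p k" and s: "s \<in> K"
  shows "card s \<le> card (\<pi> ` s) + k"
proof -
  have fs: "finite s" "s \<noteq> {}" using K s by (auto simp: abstract_complex_def)
  define T where "T = \<pi> ` s"
  define m where "m = real (card T)"
  define M where "M = real (card s)"
  have mM: "0 < m" "0 < M" using fs by (auto simp: m_def M_def T_def card_gt_0_iff)
  \<comment> \<open>One representative vertex for each class; the other vertices, \<open>S\<close>,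
    carry the \<open>n\<close> free coordinates of the cube.\<close>
  define r where "r = inv_into s \<pi>"
  have r: "r w \<in> s" "\<pi> (r w) = w" if "w \<in> T" for w
    using that by (auto simp: r_def T_def inv_into_into f_inv_into_f)
  have injr: "inj_on r T" by (metis inj_onI r(2))
  define S where "S = s - r ` T"
  define n where "n = card S"
  have rT: "r ` T \<subseteq> s" using r by blast
  have cards: "card s = n + card T"
    using card_Diff_subset[of "r ` T" s] rT fs card_image[OF injr] card_mono[OF fs(1) rT]
    by (simp add: n_def S_def finite_subset)
  obtain e where e: "bij_betw e {..<n} S"
    using ex_bij_betw_nat_finite[of S] fs by (auto simp: lessThan_atLeast0 n_def S_def)
  define d where "d = the_inv_into {..<n} e"
  have d: "d (e i) = i" if "i < n" for i using e that by (auto simp: d_def bij_betw_def the_inv_into_f_f)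
  \<comment> \<open>The scale \<open>1 / (m * M)\<close> keeps the free weight of a class at most
    \<open>1 / m\<close>, so the representative can absorb the rest. Every class then has total
    \<open>1 / m\<close>, and all points \<open>E x\<close> lie over the barycentre
    \<open>y\<close>.\<close>
  define c where "c x w = (\<Sum>u\<in>{u\<in>S. \<pi> u = w}. x (d u) / (m * M))" for x :: "nat \<Rightarrow> real" and w
  define E where "E x v = (if v \<in> S then x (d v) / (m * M) else if v \<in> r ` T then 1 / m - c x (\<pi> v) else 0)"
    for x :: "nat \<Rightarrow> real" and v
  define y where "y w = (if w \<in> T then 1 / m else 0)" for w
  have fibre: "(\<Sum>v\<in>{v\<in>s. \<pi> v = w}. E x v) = y w" for x w
  proof (cases "w \<in> T")
    case True
    have "{v\<in>s. \<pi> v = w} = insert (r w) {u\<in>S. \<pi> u = w}"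
      using r True by (auto simp: S_def)
    moreover have "r w \<notin> {u\<in>S. \<pi> u = w}" using True by (auto simp: S_def)
    moreover have "(\<Sum>v\<in>{u\<in>S. \<pi> u = w}. E x v) = c x w"
      unfolding c_def by (rule sum.cong) (auto simp: E_def)
    moreover have "E x (r w) = 1 / m - c x w" using True r by (auto simp: E_def S_def)
    ultimately show ?thesis using fs True by (simp add: S_def y_def)
  next
    case False
    then have "{v\<in>s. \<pi> v = w} = {}" by (auto simp: T_def)
    then show ?thesis using False by (simp only: y_def) simp
  qed
  have Es: "E x \<in> closed_simplex s" if x: "x \<in> unit_cube n" for x
    unfolding closed_simplex_def
  proof (intro CollectI conjI allI impI)
    fix v
    have x01: "0 \<le> x i" "x i \<le> 1" for i using x by (auto simp: unit_cube_def)
    have "c x w \<le> 1 / m" for w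
    proof -
      have "c x w \<le> (\<Sum>u\<in>{u\<in>S. \<pi> u = w}. 1 / (m * M))"
        unfolding c_def using x01 mM by (intro sum_mono divide_right_mono) auto
      also have "\<dots> \<le> (\<Sum>u\<in>s. 1 / (m * M))"
        using mM fs by (intro sum_mono2) (auto simp: S_def)
      also have "\<dots> = 1 / m" using mM by (simp add: M_def)
      finally show ?thesis .
    qed
    then show "0 \<le> E x v" using x01 mM by (auto simp: E_def)
    show "E x v = 0" if "v \<notin> s" using that rT by (auto simp: E_def S_def)
  next
    have "(\<Sum>v\<in>s. E x v) = (\<Sum>w\<in>T. \<Sum>v\<in>{v\<in>s. \<pi> v = w}. E x v)"
      unfolding T_def by (rule sum.group[symmetric]) (use fs in auto)
    also have "\<dots> = (\<Sum>w\<in>T. 1 / m)" unfolding fibre by (simp add: y_def)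
    also have "\<dots> = 1" using mM by (simp add: m_def)
    finally show "(\<Sum>v\<in>s. E x v) = 1" .
  qed
  define Q where "Q = {a \<in> topspace (polyhedron_of K). p a = y}"
  have EQ: "E x \<in> Q" if "x \<in> unit_cube n" for x
    using Es[OF that] s p\<pi> fibre by (auto simp: Q_def topspace_polyhedron_of fun_eq_iff)
  have "(\<lambda>i. 0) \<in> unit_cube n" by (simp add: unit_cube_def)
  from EQ[OF this] have "y \<in> topspace L"
    using p continuous_map_image_subset_topspace unfolding Q_def by blast
  then have "covering_dim_le (subtopology (polyhedron_of K) Q) k"
    using dim unfolding map_dim_le_def Q_def by blast
  then have "covering_dim_le (top_of_set (unit_cube n)) k"
  proof (rule covering_dim_le_retract)
    have "continuous_on (unit_cube n) (\<lambda>x. E x v)" for v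
      unfolding E_def c_def by (cases "v \<in> S"; cases "v \<in> r ` T")
        (auto intro!: continuous_intros continuous_on_coordinate simp: mM less_imp_neq[THEN not_sym])
    then have "continuous_on (unit_cube n) E" by (rule continuous_on_coordinatewise_then_product)
    then have "continuous_map (top_of_set (unit_cube n)) (top_of_set (closed_simplex s)) E"
      using Es by auto
    from continuous_map_compose[OF this continuous_map_simplex_inclusion[OF s]]
    show "continuous_map (top_of_set (unit_cube n)) (subtopology (polyhedron_of K) Q) E"
      using EQ by (auto simp: continuous_map_in_subtopology o_def)
    \<comment> \<open>\<open>q\<close> reads off the free coordinates and undoes the scale;
      \<open>min 1\<close> brings points of the fibre outside the image of \<open>E\<close> back
      into the cube.\<close>
    define q where "q a i = (if i < n then min 1 (m * M * a (e i)) else 0)" for a i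
    have "continuous_map (polyhedron_of K) euclideanreal (\<lambda>a. q a i)" for i
      unfolding q_def by (cases "i < n")
        (auto intro!: continuous_map_real_min continuous_map_real_mult_left continuous_map_barycentric)
    then have "continuous_map (polyhedron_of K) (product_topology (\<lambda>i::nat. euclideanreal) UNIV) q"
      by (simp add: continuous_map_componentwise_UNIV)
    then have "continuous_map (subtopology (polyhedron_of K) Q) euclidean q"
      unfolding euclidean_product_topology by (rule continuous_map_from_subtopology)
    moreover have "q a \<in> unit_cube n" if "a \<in> Q" for a
      using that mM by (auto simp: q_def unit_cube_def Q_def topspace_polyhedron_of closed_simplex_def)
    ultimately show "continuous_map (subtopology (polyhedron_of K) Q) (top_of_set (unit_cube n)) q"
      by (auto simp: continuous_map_in_subtopology)
    fix x assume "x \<in> topspace (top_of_set (unit_cube n))"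
    then have x: "x \<in> unit_cube n" by simp
    show "q (E x) = x"
    proof
      fix i
      show "q (E x) i = x i"
      proof (cases "i < n")
        case True
        then have "e i \<in> S" using e by (auto simp: bij_betw_def)
        then have "m * M * E x (e i) = x i" using mM d[OF True] by (simp add: E_def)
        then show ?thesis using True x by (simp add: q_def unit_cube_def)
      qed (use x in \<open>auto simp: q_def unit_cube_def\<close>)
    qed
  qed
  then have "n \<le> k" by (rule covering_dim_unit_cube)
  then show ?thesis using cards by (simp add: T_def)
qed

lemma vertex_map_simplicial:
  assumes K: "finite K" "abstract_complex K" and V: "finite V" "\<And>s. s \<in> K \<Longrightarrow> s \<subseteq> V"
    and L: "\<And>s. s \<in> K \<Longrightarrow> \<pi> ` s \<in> L" "finite L"
    and p: "p = (\<lambda>a w. \<Sum>v\<in>{v\<in>V. \<pi> v = w}. a v)"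
  shows "simplicial_map K L p"
proof -
  have restr: "p a w = (\<Sum>v\<in>{v\<in>s. \<pi> v = w}. a v)" if "s \<in> K" "a \<in> closed_simplex s" for s a w
    unfolding p
    by (rule sum.mono_neutral_right) (use that V in \<open>auto simp: closed_simplex_def\<close>)
  have fin: "finite s" if "s \<in> K" for s using K(2) that by (auto simp: abstract_complex_def)
  have img: "p ` closed_simplex s = closed_simplex (\<pi> ` s)" if s: "s \<in> K" for s
  proof (intro antisym subsetI)
    fix b assume "b \<in> p ` closed_simplex s"
    then obtain a where a: "a \<in> closed_simplex s" "b = p a" by blast
    have "(\<Sum>w\<in>\<pi> ` s. p a w) = (\<Sum>w\<in>\<pi> ` s. \<Sum>v\<in>{v\<in>s. \<pi> v = w}. a v)" using restr[OF s a(1)] by simp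
    also have "\<dots> = (\<Sum>v\<in>s. a v)" by (rule sum.group) (use fin[OF s] in auto)
    finally have "(\<Sum>w\<in>\<pi> ` s. p a w) = 1" using a by (simp add: closed_simplex_def)
    moreover have "0 \<le> p a w" for w
      using a unfolding restr[OF s a(1)] by (intro sum_nonneg) (auto simp: closed_simplex_def)
    moreover have "p a w = 0" if "w \<notin> \<pi> ` s" for w
    proof -
      have "{v\<in>s. \<pi> v = w} = {}" using that by blast
      then show ?thesis unfolding restr[OF s a(1)] by (simp only: sum.empty)
    qed
    ultimately show "b \<in> closed_simplex (\<pi> ` s)" by (simp add: a(2) closed_simplex_def)
  next
    fix b assume b: "b \<in> closed_simplex (\<pi> ` s)"
    define r where "r = inv_into s \<pi>"
    have r: "r w \<in> s \<and> \<pi> (r w) = w" if "w \<in> \<pi> ` s" for w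
      using that by (auto simp: r_def inv_into_into f_inv_into_f)
    \<comment> \<open>A preimage of \<open>b\<close>: the representative takes the whole weight of
      its class.\<close>
    define a where "a v = (if v \<in> s \<and> v = r (\<pi> v) then b (\<pi> v) else 0)" for v
    have fib: "(\<Sum>v\<in>{v\<in>s. \<pi> v = w}. a v) = b w" for w
    proof (cases "w \<in> \<pi> ` s")
      case True
      have "(\<Sum>v\<in>{v\<in>s. \<pi> v = w}. a v) = (\<Sum>v\<in>{v\<in>s. \<pi> v = w}. if v = r w then b w else 0)"
        by (rule sum.cong) (auto simp: a_def)
      also have "\<dots> = b w" using r[OF True] fin[OF s] by simp
      finally show ?thesis .
    next
      case False
      then have "{v\<in>s. \<pi> v = w} = {}" by blast
      moreover have "b w = 0" using False b by (simp add: closed_simplex_def)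
      ultimately show ?thesis by (simp only: sum.empty)
    qed
    have "(\<Sum>v\<in>s. a v) = (\<Sum>w\<in>\<pi> ` s. \<Sum>v\<in>{v\<in>s. \<pi> v = w}. a v)"
      by (rule sum.group[symmetric]) (use fin[OF s] in auto)
    also have "\<dots> = 1" using b by (simp add: fib closed_simplex_def)
    finally have "a \<in> closed_simplex s" using b by (auto simp: a_def closed_simplex_def)
    moreover then have "p a = b" using restr[OF s] fib by auto
    ultimately show "b \<in> p ` closed_simplex s" by blast
  qed
  have "continuous_map (polyhedron_of K) (polyhedron_of L) p"
  proof -
    have "continuous_on A p" for A
      unfolding p by (intro continuous_on_coordinatewise_then_product continuous_on_sum continuous_on_coordinate)
    moreover have "p ` (\<Union>s\<in>K. closed_simplex s) \<subseteq> (\<Union>s\<in>L. closed_simplex s)"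
      using img L(1) by blast
    ultimately show ?thesis unfolding polyhedron_of_finite[OF K(1)] polyhedron_of_finite[OF L(2)]
      by (simp add: image_subset_iff_funcset)
  qed
  moreover have "p (\<lambda>v. (1 - u) * a v + u * b v) = (\<lambda>w. (1 - u) * p a w + u * p b w)" for a b u
    unfolding p by (simp add: sum.distrib sum_distrib_left)
  ultimately show ?thesis unfolding simplicial_map_def using img L(1) by blast
qed

text \<open>General position gives \<open>k\<close> linear functions that are injective on the part
  of a fibre with a given support. Their joint fibres within a fibre of \<open>p\<close> are then
  finite, and Kolmogorov's covering bounds the dimension.\<close>

lemma vertex_map_dim_le:
  fixes \<pi> :: "nat \<Rightarrow> nat"
  assumes K: "finite K" "abstract_complex K" and V: "finite V" "\<And>s. s \<in> K \<Longrightarrow> s \<subseteq> V"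
    and p: "p = (\<lambda>a w. \<Sum>v\<in>{v\<in>V. \<pi> v = w}. a v)" and card: "\<And>s. s \<in> K \<Longrightarrow> card s \<le> card (\<pi> ` s) + k"
  shows "map_dim_le (polyhedron_of K) L p k"
  unfolding map_dim_le_def
proof
  fix y
  let ?P = "\<Union>s\<in>K. closed_simplex s"
  define Q where "Q = {a \<in> ?P. p a = y}"
  have top: "subtopology (polyhedron_of K) {a \<in> topspace (polyhedron_of K). p a = y} = top_of_set Q"
    unfolding polyhedron_of_finite[OF K(1)] Q_def by (auto simp: subtopology_subtopology intro!: arg_cong[where f = "\<lambda>S. subtopology _ S"])
  have "closed {a. p a w = y w}" for w
    unfolding p by (intro closed_Collect_eq continuous_intros continuous_on_coordinate)
  then have "compact (?P \<inter> (\<Inter>w. {a. p a w = y w}))"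
    by (intro compact_Int_closed compact_finite_polyhedron K closed_INT) auto
  moreover have "?P \<inter> (\<Inter>w. {a. p a w = y w}) = Q" by (auto simp: Q_def fun_eq_iff)
  ultimately have cQ: "compact Q" by simp
  \<comment> \<open>There is nothing to perturb, so \<alpha> is 0. The size 1 of \<open>z\<close>
    bounds the linear functions by 1, as barycentric coordinates sum to 1.\<close>
  obtain z :: "nat \<Rightarrow> nat \<Rightarrow> real" where z1: "\<And>v j. \<bar>z v j\<bar> \<le> 1"
    and z: "\<And>s. s \<subseteq> V \<Longrightarrow> card s \<le> card (\<pi> ` s) + k \<Longrightarrow> fibrewise_independent k \<pi> s z"
    using general_position[OF V(1), of "{()}" 1 \<pi> k "\<lambda>_ _ _. 0"] by auto
  have "covering_dim_le (top_of_set Q) k"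
  proof (rule light_imp_covering_dim_le[where g = "\<lambda>j a. \<Sum>v\<in>V. a v * z v j"])
    show comp: "compact_space (top_of_set Q)" using cQ by (simp add: compact_space_subtopology)
    show "continuous_map (top_of_set Q) euclideanreal (\<lambda>a. \<Sum>v\<in>V. a v * z v j)" for j
      by (auto intro!: continuous_intros continuous_on_coordinate)
    show "\<bar>\<Sum>v\<in>V. a v * z v j\<bar> \<le> 1" if a: "a \<in> topspace (top_of_set Q)" for j a
    proof -
      obtain s where s: "s \<in> K" "a \<in> closed_simplex s" using a by (auto simp: Q_def)
      have "\<bar>\<Sum>v\<in>V. a v * z v j\<bar> \<le> (\<Sum>v\<in>V. a v)"
        using s z1 by (intro order_trans[OF sum_abs] sum_mono)
          (auto simp: abs_mult closed_simplex_def intro: mult_left_le)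
      then show ?thesis using closed_simplex_sum_superset[OF s(2) V(1)] V(2)[OF s(1)] by simp
    qed
    fix \<omega> a0 assume \<omega>: "open_cover (top_of_set Q) \<omega>" and "a0 \<in> topspace (top_of_set Q)"
    define F where "F = {a \<in> Q. \<forall>j<k. (\<Sum>v\<in>V. a v * z v j) = (\<Sum>v\<in>V. a0 v * z v j)}"
    have supp: "support a \<in> K" "a \<in> closed_simplex (support a)" if "a \<in> Q" for a
      using support_in_complex[OF K(2), of a] that by (auto simp: Q_def topspace_polyhedron_of)
    have "inj_on support F"
    proof (rule inj_onI)
      fix a b assume a: "a \<in> F" and b: "b \<in> F" and eq: "support a = support b"
      define s where "s = support a"
      have s: "s \<in> K" "a \<in> closed_simplex s" "b \<in> closed_simplex s"
        using supp[of a] supp[of b] a b unfolding eq s_def by (auto simp: F_def)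
      have out: "a v - b v = 0" if "v \<notin> s" for v using s(2,3) that by (simp add: closed_simplex_def)
      have 1: "(\<Sum>v\<in>{v\<in>s. \<pi> v = w}. a v - b v) = 0" for w
      proof -
        have "(\<Sum>v\<in>{v\<in>s. \<pi> v = w}. a v - b v) = (\<Sum>v\<in>{v\<in>V. \<pi> v = w}. a v - b v)"
          by (rule sum.mono_neutral_left) (use V s out in auto)
        also have "\<dots> = p a w - p b w" by (simp add: p sum_subtractf)
        finally show ?thesis using a b by (simp add: F_def Q_def)
      qed
      have 2: "(\<Sum>v\<in>s. (a v - b v) * z v j) = 0" if j: "j < k" for j
      proof -
        have "(\<Sum>v\<in>s. (a v - b v) * z v j) = (\<Sum>v\<in>V. (a v - b v) * z v j)"
          by (rule sum.mono_neutral_left) (use V s out in auto)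
        also have "\<dots> = (\<Sum>v\<in>V. a v * z v j) - (\<Sum>v\<in>V. b v * z v j)" by (simp add: left_diff_distrib sum_subtractf)
        finally show ?thesis using a b j by (simp add: F_def)
      qed
      have "\<forall>v\<in>s. a v - b v = 0"
        using z[OF V(2)[OF s(1)] card[OF s(1)], unfolded fibrewise_independent_def, rule_format, of "\<lambda>v. a v - b v"] 1 2
        by blast
      then have "a v = b v" for v using out[of v] by (cases "v \<in> s") auto
      then show "a = b" by blast
    qed
    moreover have "support ` F \<subseteq> K" using supp by (auto simp: F_def)
    ultimately have "finite F" using K(1) by (rule inj_on_finite)
    moreover have "F \<subseteq> topspace (top_of_set Q)" by (auto simp: F_def)
    moreover have "Hausdorff_space (top_of_set Q)" by (simp add: Hausdorff_space_subtopology)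
    ultimately have "splits (top_of_set Q) \<omega> F" using splits_finite[OF comp _ \<omega>] by blast
    then show "splits (top_of_set Q) \<omega> {x \<in> topspace (top_of_set Q). \<forall>i<k.
        (\<Sum>v\<in>V. x v * z v i) = (\<Sum>v\<in>V. a0 v * z v i)}" by (simp add: F_def)
  qed
  then show "covering_dim_le (subtopology (polyhedron_of K) {x \<in> topspace (polyhedron_of K). p x = y}) k"
    by (simp only: top)
qed

section \<open>From simplicial approximations to light maps\<close>

lemma (in Metric_space) continuous_map_dist_to:
  assumes f: "continuous_map X mtopology f" and a: "a \<in> M"
  shows "continuous_map X euclideanreal (\<lambda>x. d a (f x))"
proof -
  have "continuous_map mtopology euclideanreal (d a)"
    unfolding continuous_map_from_metric
  proof (intro conjI ballI allI impI)
    fix b U assume b: "b \<in> M" and U: "openin euclideanreal U \<and> d a b \<in> U"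
    then obtain e where e: "0 < e" "\<And>t. dist t (d a b) < e \<Longrightarrow> t \<in> U" using open_dist by (metis open_openin)
    show "\<exists>r>0. \<forall>x. x \<in> M \<and> d b x < r \<longrightarrow> d a x \<in> U"
    proof (intro exI[of _ e] conjI allI impI)
      fix x assume x: "x \<in> M \<and> d b x < e"
      have "\<bar>d a x - d a b\<bar> \<le> d b x"
        using triangle[of a b x] triangle[of a x b] commute[of b x] a b x by (simp add: abs_le_iff)
      then show "d a x \<in> U" using e x by (simp add: dist_real_def)
    qed (use e in simp)
  qed auto
  from continuous_map_compose[OF f this] show ?thesis by (simp add: o_def)
qed

definition joint_fibre :: "'a topology \<Rightarrow> nat \<Rightarrow> ('a \<Rightarrow> 'b) \<Rightarrow> (nat \<Rightarrow> 'a \<Rightarrow> real) \<Rightarrow> 'a \<Rightarrow> 'a set" where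
  "joint_fibre X k f g a = {x \<in> topspace X. f x = f a \<and> (\<forall>i<k. g i x = g i a)}"

definition fibres_split ::
    "'a topology \<Rightarrow> nat \<Rightarrow> ('a \<Rightarrow> 'b) \<Rightarrow> (nat \<Rightarrow> 'a \<Rightarrow> real) \<Rightarrow> 'a set set \<Rightarrow> bool" where
  "fibres_split X k f g \<omega> \<longleftrightarrow> (\<forall>a\<in>topspace X. splits X \<omega> (joint_fibre X k f g a))"

lemma closedin_joint_fibre:
  assumes "continuous_map X Y f" "Hausdorff_space Y" and g: "\<And>i. i < k \<Longrightarrow> continuous_map X euclideanreal (g i)"
  shows "closedin X (joint_fibre X k f g a)"
proof -
  have "closedin X (\<Inter>(insert {x \<in> topspace X. f x = f a} ((\<lambda>i. {x \<in> topspace X. g i x = g i a}) ` {..<k})))"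
    using assms by (intro closedin_Inter) (auto intro!: closedin_fibre[OF assms(1,2)] closedin_fibre[OF g])
  moreover have "\<Inter>(insert {x \<in> topspace X. f x = f a} ((\<lambda>i. {x \<in> topspace X. g i x = g i a}) ` {..<k})) =
      joint_fibre X k f g a" by (auto simp: joint_fibre_def)
  ultimately show ?thesis by simp
qed

text \<open>The zero sets of \<open>D\<close> are the joint fibres, which have splitting
  neighbourhoods; \<delta> is a Lebesgue number for these. It serves both directions: stability
  here, cutting along grids in the converse.\<close>

lemma (in Metric_space) fibres_split_uniformly:
  assumes X: "compact_space X" and f: "continuous_map X mtopology f"
    and g: "\<And>i. i < k \<Longrightarrow> continuous_map X euclideanreal (g i)" and sp: "fibres_split X k f g \<omega>"
  obtains \<delta> where "0 < \<delta>"
    "\<And>a. a \<in> topspace X \<Longrightarrow> splits X \<omega> {x \<in> topspace X. d (f a) (f x) + (\<Sum>i<k. \<bar>g i a - g i x\<bar>) < \<delta>}"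
proof -
  define D where "D x y = d (f x) (f y) + (\<Sum>i<k. \<bar>g i x - g i y\<bar>)" for x y
  have fM: "f x \<in> M" if "x \<in> topspace X" for x
    using f that continuous_map_image_subset_topspace by fastforce
  define \<O> where "\<O> = {W. openin X W \<and> splits X \<omega> W}"
  obtain \<delta> where \<delta>: "0 < \<delta>" "\<And>x. x \<in> topspace X \<Longrightarrow> \<exists>U\<in>\<O>. {y \<in> topspace X. D x y < \<delta>} \<subseteq> U"
  proof (rule pseudometric_lebesgue_number[OF X, of D \<O>])
    show "continuous_map X euclideanreal (D x)" if "x \<in> topspace X" for x
      unfolding D_def using g continuous_map_dist_to[OF f fM[OF that]] by (intro continuous_intros) auto
    show "0 \<le> D x y" for x y by (auto simp: D_def intro!: add_nonneg_nonneg sum_nonneg)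
    show "D x x = 0" if "x \<in> topspace X" for x using fM[OF that] by (simp add: D_def)
    show "D x z \<le> D x y + D y z" if "x \<in> topspace X" "y \<in> topspace X" "z \<in> topspace X" for x y z
    proof -
      have "(\<Sum>i<k. \<bar>g i x - g i z\<bar>) \<le> (\<Sum>i<k. \<bar>g i x - g i y\<bar> + \<bar>g i y - g i z\<bar>)" by (intro sum_mono) auto
      then show ?thesis using triangle[of "f x" "f y" "f z"] fM that by (simp add: D_def sum.distrib)
    qed
    show "\<exists>U\<in>\<O>. openin X U \<and> {y \<in> topspace X. D a y = 0} \<subseteq> U" if a: "a \<in> topspace X" for a
    proof -
      obtain W where W: "openin X W" "joint_fibre X k f g a \<subseteq> W" "splits X \<omega> W"
        using splits_neighbourhood sp a unfolding fibres_split_def by metis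
      have "y \<in> joint_fibre X k f g a" if y: "y \<in> topspace X" "D a y = 0" for y
      proof -
        have "d (f a) (f y) = 0" "(\<Sum>i<k. \<bar>g i a - g i y\<bar>) = 0"
          using y(2) nonneg[of "f a" "f y"] sum_abs_ge_zero[of "\<lambda>i. g i a - g i y" "{..<k}"]
          unfolding D_def by linarith+
        then show ?thesis using fM a y by (auto simp: joint_fibre_def sum_nonneg_eq_0_iff)
      qed
      then show ?thesis using W unfolding \<O>_def by (intro bexI[of _ W]) auto
    qed
  qed blast
  show ?thesis
  proof (rule that[OF \<delta>(1)])
    fix a assume "a \<in> topspace X"
    then obtain U where "splits X \<omega> U" "{y \<in> topspace X. D a y < \<delta>} \<subseteq> U" using \<delta>(2) by (auto simp: \<O>_def)
    then show "splits X \<omega> {x \<in> topspace X. d (f a) (f x) + (\<Sum>i<k. \<bar>g i a - g i x\<bar>) < \<delta>}"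
      using splits_mono unfolding D_def by blast
  qed
qed

lemma fibres_split_stable:
  assumes X: "compact_space X" and Y: "metrizable_space Y" and f: "continuous_map X Y f"
    and g: "\<And>i. i < k \<Longrightarrow> continuous_map X euclideanreal (g i)" and sp: "fibres_split X k f g \<omega>"
  obtains \<delta> where "0 < \<delta>"
    "\<And>g'. (\<And>i x. i < k \<Longrightarrow> x \<in> topspace X \<Longrightarrow> \<bar>g' i x - g i x\<bar> \<le> \<delta>) \<Longrightarrow> fibres_split X k f g' \<omega>"
proof -
  obtain M d where "Metric_space M d" and Yd: "Y = Metric_space.mtopology M d"
    using Y unfolding metrizable_space_def by blast
  then interpret Metric_space M d by simp
  obtain e where e: "0 < e"
    "\<And>a. a \<in> topspace X \<Longrightarrow> splits X \<omega> {x \<in> topspace X. d (f a) (f x) + (\<Sum>i<k. \<bar>g i a - g i x\<bar>) < e}"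
    using fibres_split_uniformly[OF X f[unfolded Yd] g sp] by blast
  \<comment> \<open>Two points of one joint fibre of \<open>f\<close> and \<open>g'\<close> differ
    by at most \<open>2 * \<delta>\<close> in each \<open>g i\<close>; \<open>Suc k\<close> makes
    the total strictly less than \<open>e\<close>, also for \<open>k = 0\<close>.\<close>
  define \<delta> where "\<delta> = e / (2 * real (Suc k))"
  show ?thesis
  proof
    show "0 < \<delta>" using e by (simp add: \<delta>_def)
    fix g' assume g': "\<And>i x. i < k \<Longrightarrow> x \<in> topspace X \<Longrightarrow> \<bar>g' i x - g i x\<bar> \<le> \<delta>"
    show "fibres_split X k f g' \<omega>"
      unfolding fibres_split_def
    proof
      fix a assume a: "a \<in> topspace X"
      have fa: "f a \<in> M" using f a continuous_map_image_subset_topspace unfolding Yd by fastforce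
      have "joint_fibre X k f g' a \<subseteq> {x \<in> topspace X. d (f a) (f x) + (\<Sum>i<k. \<bar>g i a - g i x\<bar>) < e}"
      proof
        fix x assume x: "x \<in> joint_fibre X k f g' a"
        then have xX: "x \<in> topspace X" by (simp add: joint_fibre_def)
        have "\<bar>g i a - g i x\<bar> \<le> 2 * \<delta>" if "i < k" for i
        proof -
          have "g' i x = g' i a" using x that by (simp add: joint_fibre_def)
          then show ?thesis using g'[OF that a] g'[OF that xX] by linarith
        qed
        then have "(\<Sum>i<k. \<bar>g i a - g i x\<bar>) \<le> (\<Sum>i<k. 2 * \<delta>)" by (intro sum_mono) auto
        also have "\<dots> < e" using e(1) by (simp add: \<delta>_def field_simps)
        finally show "x \<in> {x \<in> topspace X. d (f a) (f x) + (\<Sum>i<k. \<bar>g i a - g i x\<bar>) < e}"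
          using x fa by (simp add: joint_fibre_def)
      qed
      then show "splits X \<omega> (joint_fibre X k f g' a)" using e(2)[OF a] splits_mono by blast
    qed
  qed
qed

section \<open>Density: piecewise linear approximation in general position\<close>

lemma continuous_map_Min:
  fixes h :: "'b \<Rightarrow> 'a \<Rightarrow> real"
  assumes "finite F" "F \<noteq> {}" "\<And>a. a \<in> F \<Longrightarrow> continuous_map X euclideanreal (h a)"
  shows "continuous_map X euclideanreal (\<lambda>x. Min ((\<lambda>a. h a x) ` F))"
  using assms
proof (induction F rule: finite_ne_induct)
  case (insert a F)
  then have "Min ((\<lambda>a. h a x) ` insert a F) = min (h a x) (Min ((\<lambda>a. h a x) ` F))" for x by simp
  then show ?case using insert by (simp add: continuous_map_real_min)
qed simp


text \<open>The perturbed function may leave the unit interval by up to \<open>3 * \<eta>\<close>.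
  An affine rescaling returns it and, unlike truncation, identifies no values, so fibres are
  unchanged.\<close>

lemma abs_affine_rescale:
  fixes u g \<eta> :: real
  assumes "0 \<le> g" "g \<le> 1" "g - 2 * \<eta> \<le> u" "u \<le> g + 3 * \<eta>" "0 < \<eta>"
  shows "(u + 3 * \<eta>) / (1 + 6 * \<eta>) \<in> {0..1}" "\<bar>(u + 3 * \<eta>) / (1 + 6 * \<eta>) - g\<bar> \<le> 6 * \<eta>"
proof -
  have pos: "0 < 1 + 6 * \<eta>" using assms by simp
  show "(u + 3 * \<eta>) / (1 + 6 * \<eta>) \<in> {0..1}" using assms pos by auto
  have "0 \<le> \<eta> * g" "\<eta> * g \<le> \<eta>" using assms by (auto simp: mult_left_le)
  then have "\<bar>u + 3 * \<eta> - g - 6 * (\<eta> * g)\<bar> \<le> 6 * \<eta>" using assms unfolding abs_le_iff by linarith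
  also have "6 * \<eta> \<le> 6 * \<eta> * (1 + 6 * \<eta>)" using assms by simp
  finally have "\<bar>u + 3 * \<eta> - g - 6 * (\<eta> * g)\<bar> / (1 + 6 * \<eta>) \<le> 6 * \<eta>"
    using pos by (simp add: pos_divide_le_eq)
  moreover have "(u + 3 * \<eta>) / (1 + 6 * \<eta>) - g = (u + 3 * \<eta> - g - 6 * (\<eta> * g)) / (1 + 6 * \<eta>)"
    using pos by (simp add: field_simps)
  ultimately show "\<bar>(u + 3 * \<eta>) / (1 + 6 * \<eta>) - g\<bar> \<le> 6 * \<eta>" using pos by (simp add: abs_divide)
qed

text \<open>The density half of the category argument. After perturbation, the values of
  \<open>f\<close> and \<open>g'\<close> together with a simplex and a choice of linear pieces
  determine \<kappa> at a point; a joint fibre therefore has finite image under \<kappa>.\<close>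

lemma approx_imp_fibres_split_dense:
  assumes X: "compactum X" and Y: "compactum Y" and f: "continuous_map X Y f"
    and approx: "approx_by_simplicial_maps k X Y f" and \<omega>: "open_cover X \<omega>"
    and g: "\<And>i. i < k \<Longrightarrow> continuous_map X euclideanreal (g i)"
    and g01: "\<And>i x. i < k \<Longrightarrow> x \<in> topspace X \<Longrightarrow> g i x \<in> {0..1}" and "0 < \<epsilon>"
  obtains g' where "\<And>i. i < k \<Longrightarrow> continuous_map X euclideanreal (g' i)"
    "\<And>i x. i < k \<Longrightarrow> x \<in> topspace X \<Longrightarrow> g' i x \<in> {0..1}"
    "\<And>i x. i < k \<Longrightarrow> x \<in> topspace X \<Longrightarrow> \<bar>g' i x - g i x\<bar> < \<epsilon>"
    "fibres_split X k f g' \<omega>"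
proof (cases "topspace X = {}")
  case True
  then show ?thesis using that[of g] g g01 \<open>0 < \<epsilon>\<close> by (auto simp: fibres_split_def)
next
  case False
  have cX: "compact_space X" and HX: "Hausdorff_space X" and HY: "Hausdorff_space Y"
    using X Y by (auto simp: compactum_def metrizable_imp_Hausdorff_space)
  \<comment> \<open>The final error is at most \<open>6 * \<eta>\<close>, which
    \<open>\<epsilon> / 12\<close> keeps below \<epsilon>; \<open>\<eta> \<le> 1\<close> keeps
    \<open>\<eta> * \<delta>\<close> within the Lebesgue number \<delta> below.\<close>
  define \<eta> where "\<eta> = min 1 (\<epsilon> / 12)"
  have \<eta>: "0 < \<eta>" "\<eta> \<le> 1" "6 * \<eta> < \<epsilon>" using \<open>0 < \<epsilon>\<close> by (auto simp: \<eta>_def)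
  \<comment> \<open>Making \<open>g\<close> nearly constant on the members of the cover makes it
    nearly a function of \<kappa>.\<close>
  define \<omega>' where "\<omega>' = {W. openin X W \<and> (\<exists>U\<in>\<omega>. W \<subseteq> U) \<and> (\<forall>x\<in>W. \<forall>y\<in>W. \<forall>i<k. \<bar>g i x - g i y\<bar> < \<eta>)}"
  have \<omega>'refines: "refines \<omega>' \<omega>" by (auto simp: refines_def \<omega>'_def)
  have "\<exists>W\<in>\<omega>'. a \<in> W" if a: "a \<in> topspace X" for a
  proof -
    define N where "N = {x \<in> topspace X. (\<Sum>i<k. \<bar>g i a - g i x\<bar>) < \<eta> / 2}"
    have "openin X N" unfolding N_def
      using g by (intro openin_real_less continuous_intros) auto
    moreover obtain U where "U \<in> \<omega>" "openin X U" "a \<in> U" using \<omega> a unfolding open_cover_def by blast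
    moreover have "\<bar>g i x - g i y\<bar> < \<eta>" if xy: "x \<in> N" "y \<in> N" and i: "i < k" for x y i
    proof -
      have "\<bar>g i a - g i z\<bar> < \<eta> / 2" if "z \<in> N" for z
        using member_le_sum[of i "{..<k}" "\<lambda>i. \<bar>g i a - g i z\<bar>"] that i by (simp add: N_def)
      from this[OF xy(1)] this[OF xy(2)] show ?thesis by linarith
    qed
    ultimately have "U \<inter> N \<in> \<omega>'" unfolding \<omega>'_def by blast
    moreover have "a \<in> N" using a \<eta> by (simp add: N_def)
    ultimately show ?thesis using \<open>a \<in> U\<close> by blast
  qed
  then have \<omega>': "open_cover X \<omega>'"
    unfolding open_cover_def using openin_subset by (fastforce simp: \<omega>'_def)
  \<comment> \<open>\<open>\<kappa>Y\<close> is used only to equate \<open>p\<close> after \<kappa>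
    on the fibres of \<open>f\<close>, so a trivial cover of \<open>Y\<close> will do.\<close>
  have "open_cover Y {topspace Y}" by (simp add: open_cover_def)
  then obtain K L \<kappa> \<kappa>Y p where K: "admissible_complex K" and L: "admissible_complex L"
    and \<kappa>: "omega_map X \<omega>' (polyhedron_of K) \<kappa>" and p: "simplicial_map K L p"
    and pdim: "map_dim_le (polyhedron_of K) (polyhedron_of L) p k"
    and comm: "\<And>x. x \<in> topspace X \<Longrightarrow> p (\<kappa> x) = \<kappa>Y (f x)"
    using approx[unfolded approx_by_simplicial_maps_def, rule_format, OF conjI[OF \<omega>' \<open>open_cover Y {topspace Y}\<close>]]
    by blast
  have aK: "abstract_complex K" and aL: "abstract_complex L" using K L by (auto simp: admissible_complex_def)
  have HK: "Hausdorff_space (polyhedron_of K)"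
    using K metrizable_imp_Hausdorff_space by (auto simp: admissible_complex_def)
  obtain \<V> where \<kappa>c: "continuous_map X (polyhedron_of K) \<kappa>" and \<V>: "open_cover (polyhedron_of K) \<V>"
      "\<And>V. V \<in> \<V> \<Longrightarrow> \<exists>U\<in>\<omega>'. {x \<in> topspace X. \<kappa> x \<in> V} \<subseteq> U"
    using \<kappa> unfolding omega_map_def by blast
  have \<kappa>K: "\<kappa> x \<in> topspace (polyhedron_of K)" if "x \<in> topspace X" for x
    using \<kappa>c that continuous_map_image_subset_topspace by blast
  have sup: "support (\<kappa> x) \<in> K" "\<kappa> x \<in> closed_simplex (support (\<kappa> x))" if "x \<in> topspace X" for x
    using support_in_complex[OF aK \<kappa>K[OF that]] by auto
  obtain \<pi> where \<pi>: "\<And>s a w. s \<in> K \<Longrightarrow> a \<in> closed_simplex s \<Longrightarrow> p a w = (\<Sum>v\<in>{v\<in>s. \<pi> v = w}. a v)"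
    using simplicial_map_vertex_map[OF aK aL p] by blast
  have card: "card s \<le> card (\<pi> ` s) + k" if "s \<in> K" for s
    using map_dim_le_imp_card_le[OF aK _ \<pi>[OF that] pdim that] p unfolding simplicial_map_def by blast
  \<comment> \<open>\<open>K\<close> may be infinite, but the compact image of \<kappa> meets the
    relative interiors of finitely many simplices only; \<open>V\<close> collects their
    vertices.\<close>
  define S where "S = (\<lambda>x. support (\<kappa> x)) ` topspace X"
  have finS: "finite S" unfolding S_def by (rule finite_supports_compact_image[OF cX \<kappa>c aK])
  have SK: "S \<subseteq> K" using sup by (auto simp: S_def)
  define V where "V = \<Union>S"
  have finV: "finite V" using finS SK aK by (auto simp: V_def abstract_complex_def)
  have supV: "support (\<kappa> x) \<subseteq> V" if "x \<in> topspace X" for x using that by (auto simp: V_def S_def)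
  have \<kappa>0: "0 \<le> \<kappa> x v" if "x \<in> topspace X" for x v using sup(2)[OF that] by (simp add: closed_simplex_def)
  have \<kappa>out: "\<kappa> x v = 0" if "x \<in> topspace X" "v \<notin> V" for x v
    using supV[OF that(1)] that(2) by (auto simp: support_def)
  have \<kappa>1: "(\<Sum>v\<in>V. \<kappa> x v) = 1" if "x \<in> topspace X" for x
    using closed_simplex_sum_superset[OF sup(2)[OF that] finV supV[OF that]] .
  have \<kappa>cv: "continuous_map X euclideanreal (\<lambda>x. \<kappa> x v)" for v
    using continuous_map_compose[OF \<kappa>c continuous_map_barycentric[of K v]] by (simp add: o_def)
  define D where "D x y = (\<Sum>v\<in>V. \<bar>\<kappa> x v - \<kappa> y v\<bar>)" for x y
  have Dc: "continuous_map X euclideanreal (D x)" for x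
    unfolding D_def using \<kappa>cv finV by (intro continuous_intros) auto
  have D0: "0 \<le> D x y" for x y by (simp add: D_def sum_nonneg)
  \<comment> \<open>The zero sets of \<open>D\<close> are the fibres of \<kappa>, each inside a
    member of \<open>\<omega>'\<close>; hence \<open>D\<close>-close points have close values of
    \<open>g\<close>.\<close>
  obtain \<delta> where \<delta>: "0 < \<delta>" "\<And>x. x \<in> topspace X \<Longrightarrow> \<exists>U\<in>\<omega>'. {y \<in> topspace X. D x y < \<delta>} \<subseteq> U"
  proof (rule pseudometric_lebesgue_number[OF cX Dc D0, where \<O> = \<omega>'])
    show "D x x = 0" for x by (simp add: D_def)
    show "D x z \<le> D x y + D y z" for x y z
      unfolding D_def sum.distrib[symmetric] by (intro sum_mono) auto
    fix a assume a: "a \<in> topspace X"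
    then have "\<kappa> a \<in> \<Union>\<V>" using \<V>(1) \<kappa>K by (simp add: open_cover_def)
    then obtain W where W: "W \<in> \<V>" "\<kappa> a \<in> W" by blast
    obtain U where U: "U \<in> \<omega>'" "{x \<in> topspace X. \<kappa> x \<in> W} \<subseteq> U" using \<V>(2)[OF W(1)] by blast
    have "\<kappa> y = \<kappa> a" if y: "y \<in> topspace X" "D a y = 0" for y
    proof
      fix v
      show "\<kappa> y v = \<kappa> a v"
      proof (cases "v \<in> V")
        case True
        then show ?thesis using y(2) finV by (simp add: D_def sum_nonneg_eq_0_iff)
      qed (use \<kappa>out y a in simp)
    qed
    then have "{y \<in> topspace X. D a y = 0} \<subseteq> U" using U(2) W(2) by auto
    then show "\<exists>U\<in>\<omega>'. openin X U \<and> {y \<in> topspace X. D a y = 0} \<subseteq> U"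
      using U(1) by (auto simp: \<omega>'_def)
  qed blast
  have osc: "\<bar>g i x - g i y\<bar> < \<eta>" if xy: "x \<in> topspace X" "y \<in> topspace X" "D x y < \<delta>" and i: "i < k" for x y i
  proof -
    obtain U where U: "U \<in> \<omega>'" "{y \<in> topspace X. D x y < \<delta>} \<subseteq> U" using \<delta>(2)[OF xy(1)] by blast
    then have "x \<in> U" "y \<in> U" using xy \<delta>(1) by (auto simp: D_def)
    then show ?thesis using U(1) i by (auto simp: \<omega>'_def)
  qed
  obtain F where F: "finite F" "F \<subseteq> topspace X" "topspace X \<subseteq> (\<Union>a\<in>F. {x \<in> topspace X. D a x < \<eta> * \<delta>})"
  proof (rule compact_space_point_cover[OF cX, of "\<lambda>a. {x \<in> topspace X. D a x < \<eta> * \<delta>}"])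
    show "openin X {x \<in> topspace X. D a x < \<eta> * \<delta>} \<and> a \<in> {x \<in> topspace X. D a x < \<eta> * \<delta>}"
      if "a \<in> topspace X" for a
      using that openin_real_less(1)[OF Dc] \<eta> \<delta>(1) by (auto simp: D_def)
  qed
  have Fne: "F \<noteq> {}" using F(3) False by blast
  \<comment> \<open>an inf-convolution of \<open>g\<close>: near \<open>g\<close>, and piecewise linear in the barycentric coordinates because the
    \<open>L\<^sup>1\<close> distance \<open>D\<close> is\<close>
  define g1 where "g1 j x = Min ((\<lambda>a. g j a + D a x / \<delta>) ` F)" for j x
  have g1c: "continuous_map X euclideanreal (g1 j)" for j
    unfolding g1_def using F(1) Fne Dc \<delta>(1)
    by (intro continuous_map_Min continuous_intros) auto
  have g1_bounds: "g j x - \<eta> \<le> g1 j x" "g1 j x \<le> g j x + 2 * \<eta>" if x: "x \<in> topspace X" and j: "j < k" for j x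
  proof -
    \<comment> \<open>Far centres do not spoil the minimum: for \<open>D a x \<ge> \<delta>\<close>
      the penalty is at least 1, the whole range of \<open>g\<close>.\<close>
    have "g j x - \<eta> \<le> g j a + D a x / \<delta>" if a: "a \<in> F" for a
    proof (cases "D a x < \<delta>")
      case True
      have "0 \<le> D a x / \<delta>" using D0 \<delta>(1) by simp
      then show ?thesis using osc[of a x j] True a F(2) x j by fastforce
    next
      case False
      then have "1 \<le> D a x / \<delta>" using \<delta>(1) by simp
      moreover have "g j x \<le> 1" "0 \<le> g j a" using g01[OF j x] g01[OF j, of a] a F(2) by auto
      ultimately show ?thesis using \<eta>(1) by linarith
    qed
    then show "g j x - \<eta> \<le> g1 j x" unfolding g1_def using F(1) Fne by simp
    obtain a where a: "a \<in> F" "D a x < \<eta> * \<delta>" using F(3) x by blast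
    have "\<eta> * \<delta> \<le> 1 * \<delta>" using \<eta>(2) \<delta>(1) by (intro mult_right_mono) auto
    then have "\<bar>g j a - g j x\<bar> < \<eta>" using osc[of a x j] a F(2) x j by auto
    moreover have "D a x / \<delta> \<le> \<eta>" using a(2) \<delta>(1) by (simp add: pos_divide_le_eq)
    moreover have "g1 j x \<le> g j a + D a x / \<delta>" unfolding g1_def using F(1) a(1) by simp
    ultimately show "g1 j x \<le> g j x + 2 * \<eta>" by linarith
  qed
  \<comment> \<open>A piece \<open>q\<close> is a centre in \<open>F\<close> with a sign for each
    vertex. \<phi> lists the vertex values of the affine function in which the signed sum replaces
    the L1 distance; its constant is spread over the vertices since barycentric coordinates sum to
    1.\<close>
  define \<phi> where "\<phi> j q v = g j (fst q) + (snd q v - (\<Sum>u\<in>V. snd q u * \<kappa> (fst q) u)) / \<delta>"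
    for j and q :: "'a \<times> (nat \<Rightarrow> real)" and v
  define \<Sigma> where "\<Sigma> = F \<times> PiE V (\<lambda>_. {-1, 1::real})"
  have fin\<Sigma>: "finite \<Sigma>" unfolding \<Sigma>_def using F(1) finV by (intro finite_cartesian_product finite_PiE) auto
  have \<phi>: "\<exists>q\<in>\<Sigma>. g1 j x = (\<Sum>v\<in>V. \<kappa> x v * \<phi> j q v)" if x: "x \<in> topspace X" for j x
  proof -
    have "g1 j x \<in> (\<lambda>a. g j a + D a x / \<delta>) ` F" unfolding g1_def using F(1) Fne by (intro Min_in) auto
    then obtain a where a: "a \<in> F" "g1 j x = g j a + D a x / \<delta>" by blast
    define \<sigma> where "\<sigma> = (\<lambda>v\<in>V. if \<kappa> a v \<le> \<kappa> x v then 1 else (-1::real))"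
    define q where "q = (a, \<sigma>)"
    have "D a x = (\<Sum>v\<in>V. \<sigma> v * \<kappa> x v - \<sigma> v * \<kappa> a v)"
      unfolding D_def by (rule sum.cong) (auto simp: \<sigma>_def)
    also have "\<dots> = (\<Sum>v\<in>V. \<kappa> x v * \<sigma> v) - (\<Sum>v\<in>V. \<sigma> v * \<kappa> a v)"
      by (simp add: sum_subtractf mult.commute)
    finally have DD: "D a x = (\<Sum>v\<in>V. \<kappa> x v * \<sigma> v) - (\<Sum>v\<in>V. \<sigma> v * \<kappa> a v)" .
    have "(\<Sum>v\<in>V. \<kappa> x v * \<phi> j q v) =
        (\<Sum>v\<in>V. \<kappa> x v * (g j a - (\<Sum>u\<in>V. \<sigma> u * \<kappa> a u) / \<delta>) + \<kappa> x v * \<sigma> v / \<delta>)"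
      unfolding \<phi>_def q_def by (rule sum.cong) (auto simp: algebra_simps diff_divide_distrib)
    also have "\<dots> = (\<Sum>v\<in>V. \<kappa> x v) * (g j a - (\<Sum>u\<in>V. \<sigma> u * \<kappa> a u) / \<delta>) + (\<Sum>v\<in>V. \<kappa> x v * \<sigma> v) / \<delta>"
      unfolding sum.distrib sum_distrib_right sum_divide_distrib by simp
    also have "\<dots> = g1 j x" unfolding \<kappa>1[OF x] a(2) DD by (simp add: diff_divide_distrib)
    finally have "g1 j x = (\<Sum>v\<in>V. \<kappa> x v * \<phi> j q v)" by simp
    moreover have "q \<in> \<Sigma>" using a(1) by (auto simp: q_def \<Sigma>_def \<sigma>_def)
    ultimately show ?thesis by blast
  qed
  \<comment> \<open>Each coordinate \<open>j\<close> picks its own piece. General position must hold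
    for all \<open>k\<close>-tuples of pieces with one common \<open>z\<close>, because different
    shifts on different pieces would break continuity.\<close>
  define I where "I = PiE {..<k} (\<lambda>_. \<Sigma>)"
  have finI: "finite I" unfolding I_def using fin\<Sigma> by (intro finite_PiE) auto
  from general_position[OF finV finI \<eta>(1), of \<pi> k "\<lambda>i v j. \<phi> j (i j) v"]
  obtain z where zz: "(\<forall>v j. \<bar>z v j\<bar> \<le> \<eta>) \<and> (\<forall>i\<in>I. \<forall>s. s \<subseteq> V \<longrightarrow> card s \<le> card (\<pi> ` s) + k \<longrightarrow>
      fibrewise_independent k \<pi> s (\<lambda>v j. \<phi> j (i j) v + z v j))" ..
  then have z0: "\<bar>z v j\<bar> \<le> \<eta>" for v j by simp
  from zz have z: "fibrewise_independent k \<pi> s (\<lambda>v j. \<phi> j (i j) v + z v j)"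
    if "i \<in> I" "s \<subseteq> V" "card s \<le> card (\<pi> ` s) + k" for i s using that by simp
  define g2 where "g2 j x = g1 j x + (\<Sum>v\<in>V. \<kappa> x v * z v j)" for j x
  have g2c: "continuous_map X euclideanreal (g2 j)" for j
    unfolding g2_def using g1c \<kappa>cv finV by (intro continuous_intros) auto
  have g2_bounds: "g j x - 2 * \<eta> \<le> g2 j x" "g2 j x \<le> g j x + 3 * \<eta>" if x: "x \<in> topspace X" and j: "j < k" for j x
  proof -
    have "\<bar>\<Sum>v\<in>V. \<kappa> x v * z v j\<bar> \<le> (\<Sum>v\<in>V. \<kappa> x v * \<eta>)"
      using \<kappa>0[OF x] z0 by (intro order_trans[OF sum_abs] sum_mono) (auto simp: abs_mult intro: mult_left_mono)
    also have "\<dots> = \<eta>" using \<kappa>1[OF x] by (simp flip: sum_distrib_right)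
    finally show "g j x - 2 * \<eta> \<le> g2 j x" "g2 j x \<le> g j x + 3 * \<eta>"
      using g1_bounds[OF x j] unfolding g2_def by linarith+
  qed
  define g3 where "g3 j x = (g2 j x + 3 * \<eta>) / (1 + 6 * \<eta>)" for j x
  have rescale: "g3 j x \<in> {0..1}" "\<bar>g3 j x - g j x\<bar> \<le> 6 * \<eta>" if x: "x \<in> topspace X" and j: "j < k" for j x
    unfolding g3_def using abs_affine_rescale[OF _ _ g2_bounds[OF x j] \<eta>(1)] g01[OF j x] by auto
  have g3c: "continuous_map X euclideanreal (g3 j)" for j
    unfolding g3_def using g2c \<eta>(1) by (intro continuous_intros) auto
  \<comment> \<open>The difference \<open>b\<close> of two points of one simplex has zero class sums
    because \<open>f\<close> agrees, and zero perturbed linear values because \<open>g3\<close>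
    agrees; fibrewise independence then makes it 0.\<close>
  have inj: "\<kappa> x = \<kappa> y" if xy: "x \<in> topspace X" "y \<in> topspace X" "f x = f y" "support (\<kappa> x) = support (\<kappa> y)"
    and g3: "\<And>j. j < k \<Longrightarrow> g3 j x = g3 j y" and i: "i \<in> I"
    and ix: "\<And>j. j < k \<Longrightarrow> g1 j x = (\<Sum>v\<in>V. \<kappa> x v * \<phi> j (i j) v)"
    and iy: "\<And>j. j < k \<Longrightarrow> g1 j y = (\<Sum>v\<in>V. \<kappa> y v * \<phi> j (i j) v)" for x y i
  proof -
    define s where "s = support (\<kappa> x)"
    define b where "b v = \<kappa> x v - \<kappa> y v" for v
    have s: "s \<in> K" "\<kappa> x \<in> closed_simplex s" "\<kappa> y \<in> closed_simplex s" "s \<subseteq> V"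
      using sup[OF xy(1)] sup[OF xy(2)] supV[OF xy(1)] xy(4) by (auto simp: s_def)
    have out: "b v = 0" if "v \<notin> s" for v using s(2,3) that by (simp add: closed_simplex_def b_def)
    have 1: "(\<Sum>v\<in>{v\<in>s. \<pi> v = w}. b v) = 0" for w
    proof -
      have "(\<Sum>v\<in>{v\<in>s. \<pi> v = w}. b v) = p (\<kappa> x) w - p (\<kappa> y) w"
        unfolding \<pi>[OF s(1,2)] \<pi>[OF s(1,3)] b_def by (rule sum_subtractf)
      then show ?thesis using comm[OF xy(1)] comm[OF xy(2)] xy(3) by simp
    qed
    have 2: "(\<Sum>v\<in>s. b v * (\<phi> j (i j) v + z v j)) = 0" if j: "j < k" for j
    proof -
      have "(\<Sum>v\<in>s. b v * (\<phi> j (i j) v + z v j)) = (\<Sum>v\<in>V. b v * (\<phi> j (i j) v + z v j))"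
        by (rule sum.mono_neutral_left) (use finV s out in auto)
      also have "\<dots> = (\<Sum>v\<in>V. (\<kappa> x v * \<phi> j (i j) v + \<kappa> x v * z v j) - (\<kappa> y v * \<phi> j (i j) v + \<kappa> y v * z v j))"
        by (rule sum.cong) (auto simp: b_def algebra_simps)
      also have "\<dots> = g2 j x - g2 j y"
        unfolding g2_def ix[OF j] iy[OF j] sum_subtractf sum.distrib ..
      also have "\<dots> = 0" using g3[OF j] \<eta>(1) by (simp add: g3_def)
      finally show ?thesis .
    qed
    have "\<forall>v\<in>s. b v = 0"
      using z[OF i s(4) card[OF s(1)]] 1 2 unfolding fibrewise_independent_def by blast
    then have "b v = 0" for v using out by blast
    then show ?thesis by (simp add: b_def fun_eq_iff)
  qed
  have "\<forall>x\<in>topspace X. \<exists>i. i \<in> I \<and> (\<forall>j<k. g1 j x = (\<Sum>v\<in>V. \<kappa> x v * \<phi> j (i j) v))"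
  proof
    fix x assume x: "x \<in> topspace X"
    have "\<forall>j. \<exists>q. q \<in> \<Sigma> \<and> g1 j x = (\<Sum>v\<in>V. \<kappa> x v * \<phi> j q v)" using \<phi>[OF x] by blast
    from choice[OF this] obtain c where c: "\<forall>j. c j \<in> \<Sigma> \<and> g1 j x = (\<Sum>v\<in>V. \<kappa> x v * \<phi> j (c j) v)" ..
    show "\<exists>i. i \<in> I \<and> (\<forall>j<k. g1 j x = (\<Sum>v\<in>V. \<kappa> x v * \<phi> j (i j) v))"
      using c by (intro exI[of _ "restrict c {..<k}"]) (auto simp: I_def)
  qed
  from bchoice[OF this] obtain t where t: "\<forall>x\<in>topspace X. t x \<in> I \<and>
      (\<forall>j<k. g1 j x = (\<Sum>v\<in>V. \<kappa> x v * \<phi> j (t x j) v))" ..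
  have "splits X \<omega> (joint_fibre X k f g3 a)" if "a \<in> topspace X" for a
  proof -
    let ?F = "joint_fibre X k f g3 a"
    have FX: "x \<in> topspace X" if "x \<in> ?F" for x using that by (simp add: joint_fibre_def)
    \<comment> \<open>\<open>T\<close> takes finitely many values on the fibre, and \<kappa> is
      constant where \<open>T\<close> is.\<close>
    define T where "T x = (support (\<kappa> x), t x)" for x
    have "T ` ?F \<subseteq> S \<times> I" using t FX by (auto simp: T_def S_def)
    then have finT: "finite (T ` ?F)" using finS finI finite_subset by blast
    have eq: "\<kappa> x = \<kappa> y" if "x \<in> ?F" "y \<in> ?F" "T x = T y" for x y
    proof (rule inj[of x y "t x"])
      show "f x = f y" "support (\<kappa> x) = support (\<kappa> y)" using that by (auto simp: joint_fibre_def T_def)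
      show "g3 j x = g3 j y" if "j < k" for j using that \<open>x \<in> ?F\<close> \<open>y \<in> ?F\<close> by (simp add: joint_fibre_def)
      show "t x \<in> I" "\<And>j. j < k \<Longrightarrow> g1 j x = (\<Sum>v\<in>V. \<kappa> x v * \<phi> j (t x j) v)"
        using t FX[OF that(1)] by auto
      show "g1 j y = (\<Sum>v\<in>V. \<kappa> y v * \<phi> j (t x j) v)" if "j < k" for j
        using t FX[OF \<open>y \<in> ?F\<close>] \<open>T x = T y\<close> that by (auto simp: T_def)
    qed (use FX that in auto)
    have "\<kappa> ` ?F \<subseteq> (\<lambda>q. \<kappa> (inv_into ?F T q)) ` (T ` ?F)"
    proof (rule image_subsetI)
      fix x assume x: "x \<in> ?F"
      have "\<kappa> x = \<kappa> (inv_into ?F T (T x))"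
        by (rule eq) (use x in \<open>auto simp: inv_into_into f_inv_into_f\<close>)
      then show "\<kappa> x \<in> (\<lambda>q. \<kappa> (inv_into ?F T q)) ` (T ` ?F)" using x by blast
    qed
    then have "finite (\<kappa> ` ?F)" using finT finite_surj by blast
    then have "splits X \<omega>' ?F"
      by (rule splits_finite_image[OF cX HX HK \<kappa> closedin_joint_fibre[OF f HY g3c]])
    then show ?thesis using \<omega>'refines splits_refines by blast
  qed
  then have "fibres_split X k f g3 \<omega>" by (simp add: fibres_split_def)
  moreover have "\<bar>g3 i x - g i x\<bar> < \<epsilon>" if "i < k" "x \<in> topspace X" for i x
    using rescale(2)[OF that(2,1)] \<eta>(3) by simp
  ultimately show ?thesis using that[of g3] g3c rescale(1) by blast
qed

text \<open>Baire's argument by hand: each stage fixes a tolerance within which splitting over its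
  cover persists, and all later stages stay within it. Covers by balls of radius
  \<open>1 / Suc n\<close> suffice, since one of them refines any given open cover.\<close>

lemma uniform_limit_fibres_split:
  assumes X: "compactum X" and Y: "compactum Y" and f: "continuous_map X Y f"
    and approx: "approx_by_simplicial_maps k X Y f"
  obtains g where "\<And>i. i < k \<Longrightarrow> continuous_map X euclideanreal (g i)"
    "\<And>i x. i < k \<Longrightarrow> x \<in> topspace X \<Longrightarrow> g i x \<in> {0..1}"
    "\<And>\<omega>. open_cover X \<omega> \<Longrightarrow> fibres_split X k f g \<omega>"
proof -
  have cX: "compact_space X" and mX: "metrizable_space X" and mY: "metrizable_space Y"
    using X Y by (auto simp: compactum_def)
  obtain M d where "Metric_space M d" and Xd: "X = Metric_space.mtopology M d"
    using mX unfolding metrizable_space_def by blast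
  then interpret Metric_space M d by simp
  define \<omega> where "\<omega> n = (\<lambda>a. mball a (1 / real (Suc n))) ` M" for n
  have \<omega>: "open_cover X (\<omega> n)" for n
    unfolding open_cover_def Xd \<omega>_def by (auto intro!: bexI)
  have cofinal: "\<exists>n. refines (\<omega> n) \<U>" if \<U>: "open_cover X \<U>" for \<U>
  proof -
    obtain e where e: "0 < e" "\<And>x. x \<in> topspace X \<Longrightarrow> \<exists>U\<in>\<U>. {y \<in> topspace X. d x y < e} \<subseteq> U"
    proof (rule pseudometric_lebesgue_number[OF cX, of d \<U>])
      show "continuous_map X euclideanreal (d x)" if "x \<in> topspace X" for x
        using continuous_map_dist_to[of X "\<lambda>x. x" x] that by (simp add: Xd)
      fix a assume "a \<in> topspace X"
      then have a: "a \<in> M" by (simp add: Xd)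
      obtain U where "U \<in> \<U>" "openin X U" "a \<in> U" using \<U> a unfolding open_cover_def Xd by auto
      moreover have "{y \<in> topspace X. d a y = 0} \<subseteq> {a}" using a by (auto simp: Xd)
      ultimately show "\<exists>U\<in>\<U>. openin X U \<and> {y \<in> topspace X. d a y = 0} \<subseteq> U" by blast
    qed (auto simp: Xd triangle)
    obtain n where n: "1 / real (Suc n) < e" using e(1) nat_approx_posE by blast
    have "\<exists>U\<in>\<U>. mball a (1 / real (Suc n)) \<subseteq> U" if a: "a \<in> M" for a
    proof -
      obtain U where U: "U \<in> \<U>" "{y \<in> topspace X. d a y < e} \<subseteq> U" using e(2)[of a] a by (auto simp: Xd)
      moreover have "mball a (1 / real (Suc n)) \<subseteq> {y \<in> topspace X. d a y < e}"
        using n by (auto simp: Xd)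
      ultimately show ?thesis by blast
    qed
    then have "refines (\<omega> n) \<U>" by (auto simp: refines_def \<omega>_def)
    then show ?thesis by blast
  qed
  \<comment> \<open>\<open>snd gd\<close> is the tolerance: every map that close to
    \<open>fst gd\<close> still splits over \<open>\<omega> n\<close>.\<close>
  define good where "good n gd \<longleftrightarrow> (\<forall>i<k. continuous_map X euclideanreal (fst gd i)) \<and>
      (\<forall>i<k. \<forall>x\<in>topspace X. fst gd i x \<in> {0..1}) \<and> 0 < snd gd \<and>
      (\<forall>g'. (\<forall>i<k. \<forall>x\<in>topspace X. \<bar>g' i x - fst gd i x\<bar> \<le> snd gd) \<longrightarrow> fibres_split X k f g' (\<omega> n))"
    for n and gd :: "(nat \<Rightarrow> 'a \<Rightarrow> real) \<times> real"
  have step: "\<exists>gd. good n gd \<and> (\<forall>i<k. \<forall>x\<in>topspace X. \<bar>fst gd i x - g i x\<bar> \<le> e) \<and> snd gd \<le> e"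
    if g: "\<And>i. i < k \<Longrightarrow> continuous_map X euclideanreal (g i)"
      "\<And>i x. i < k \<Longrightarrow> x \<in> topspace X \<Longrightarrow> g i x \<in> {0..1}" and e: "0 < e" for n g and e :: real
  proof -
    obtain g' where g': "\<And>i. i < k \<Longrightarrow> continuous_map X euclideanreal (g' i)"
      "\<And>i x. i < k \<Longrightarrow> x \<in> topspace X \<Longrightarrow> g' i x \<in> {0..1}"
      "\<And>i x. i < k \<Longrightarrow> x \<in> topspace X \<Longrightarrow> \<bar>g' i x - g i x\<bar> < e"
      "fibres_split X k f g' (\<omega> n)"
      by (rule approx_imp_fibres_split_dense[OF X Y f approx \<omega>[of n], where g = g and \<epsilon> = e])
        (use g e in blast)+
    obtain \<delta> where \<delta>: "0 < \<delta>"
      "\<And>g''. (\<And>i x. i < k \<Longrightarrow> x \<in> topspace X \<Longrightarrow> \<bar>g'' i x - g' i x\<bar> \<le> \<delta>) \<Longrightarrow> fibres_split X k f g'' (\<omega> n)"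
      using fibres_split_stable[OF cX mY f g'(1) g'(4)] by blast
    have "good n (g', min \<delta> e)"
      unfolding good_def fst_conv snd_conv
    proof (intro conjI allI impI ballI)
      show "fibres_split X k f g'' (\<omega> n)" if "\<forall>i<k. \<forall>x\<in>topspace X. \<bar>g'' i x - g' i x\<bar> \<le> min \<delta> e" for g''
        by (rule \<delta>(2)) (use that in auto)
    qed (use g' \<delta>(1) e in auto)
    then show ?thesis using g'(3) by (intro exI[of _ "(g', min \<delta> e)"]) (auto intro: less_imp_le)
  qed
  define near where "near gd hd \<longleftrightarrow> (\<forall>i<k. \<forall>x\<in>topspace X. \<bar>fst hd i x - fst gd i x\<bar> \<le> snd gd / 2) \<and> snd hd \<le> snd gd / 2"
    for gd hd :: "(nat \<Rightarrow> 'a \<Rightarrow> real) \<times> real"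
  have "\<exists>s. \<forall>n. good n (s n) \<and> near (s n) (s (Suc n))"
  proof (rule dependent_nat_choice)
    show "\<exists>gd. good 0 gd" using step[of "\<lambda>_ _. 0" 1 0] by auto
    fix gd n assume "good n gd"
    then show "\<exists>hd. good (Suc n) hd \<and> near gd hd"
      using step[of "fst gd" "snd gd / 2" "Suc n"] unfolding near_def good_def by simp
  qed
  then obtain s where s: "\<And>n. good n (s n)" "\<And>n. near (s n) (s (Suc n))" by blast
  define g where "g n = fst (s n)" for n
  define \<delta> where "\<delta> n = snd (s n)" for n
  have gc: "continuous_map X euclideanreal (g n i)" if "i < k" for n i
    using s(1)[of n] that by (simp add: good_def g_def)
  have g01: "0 \<le> g n i x" "g n i x \<le> 1" if "i < k" "x \<in> topspace X" for n i x
    using s(1)[of n] that by (auto simp: good_def g_def)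
  have \<delta>pos: "0 < \<delta> n" for n using s(1)[of n] by (simp add: good_def \<delta>_def)
  have stable: "fibres_split X k f g' (\<omega> n)" if "\<And>i x. i < k \<Longrightarrow> x \<in> topspace X \<Longrightarrow> \<bar>g' i x - g n i x\<bar> \<le> \<delta> n" for g' n
    using s(1)[of n] that by (simp add: good_def \<delta>_def g_def)
  have step_g: "\<bar>g (Suc n) i x - g n i x\<bar> \<le> \<delta> n / 2" if "i < k" "x \<in> topspace X" for n i x
    using s(2)[of n] that by (simp add: near_def \<delta>_def g_def)
  have step_\<delta>: "\<delta> (Suc n) \<le> \<delta> n / 2" for n
    using s(2)[of n] by (simp add: near_def \<delta>_def)
  \<comment> \<open>A step and the next tolerance are both at most half of
    \<open>\<delta> n\<close>, so each step is paid for by the decrease of the tolerance; the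
    telescoped bound leaves the limit within \<open>\<delta> n\<close>.\<close>
  have dist_le: "\<bar>g (n + m) i x - g n i x\<bar> \<le> \<delta> n - \<delta> (n + m)" if "i < k" "x \<in> topspace X" for n m i x
  proof (induction m)
    case (Suc m)
    then show ?case using step_g[OF that, of "n + m"] step_\<delta>[of "n + m"]
      unfolding add_Suc_right by linarith
  qed simp
  have dist_le': "\<bar>g m i x - g n i x\<bar> \<le> \<delta> n" if "i < k" "x \<in> topspace X" "n \<le> m" for n m i x
    using dist_le[OF that(1,2), of n "m - n"] that(3) \<delta>pos[of m] by simp
  have "\<delta> n \<le> \<delta> 0 * (1 / 2) ^ n" for n
  proof (induction n)
    case (Suc n)
    then show ?case using step_\<delta>[of n] by simp
  qed simp
  moreover have "(\<lambda>n. \<delta> 0 * (1 / 2) ^ n) \<longlonglongrightarrow> 0"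
    by (intro tendsto_mult_right_zero LIMSEQ_realpow_zero) auto
  ultimately have \<delta>lim: "\<delta> \<longlonglongrightarrow> 0"
    using \<delta>pos by (intro tendsto_sandwich[of "\<lambda>_. 0" \<delta> sequentially "\<lambda>n. \<delta> 0 * (1 / 2) ^ n"]) (auto intro!: always_eventually less_imp_le)
  define G where "G i x = lim (\<lambda>n. g n i x)" for i x
  have lim: "(\<lambda>n. g n i x) \<longlonglongrightarrow> G i x" if "i < k" "x \<in> topspace X" for i x
  proof -
    have "Cauchy (\<lambda>n. g n i x)"
    proof (rule metric_CauchyI)
      fix e :: real assume e: "0 < e"
      have "\<forall>\<^sub>F n in sequentially. \<delta> n < e / 2" using e by (intro order_tendstoD(2)[OF \<delta>lim]) simp
      then obtain N where N: "\<delta> N < e / 2" unfolding eventually_sequentially by blast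
      have "dist (g m i x) (g n i x) < e" if "m \<ge> N" "n \<ge> N" for m n
        using dist_le'[OF \<open>i < k\<close> \<open>x \<in> topspace X\<close> that(1)] dist_le'[OF \<open>i < k\<close> \<open>x \<in> topspace X\<close> that(2)] N
        unfolding dist_real_def by linarith
      then show "\<exists>M. \<forall>m\<ge>M. \<forall>n\<ge>M. dist (g m i x) (g n i x) < e" by blast
    qed
    then show ?thesis unfolding G_def using Cauchy_convergent_iff convergent_LIMSEQ_iff by blast
  qed
  have Gg: "\<bar>G i x - g n i x\<bar> \<le> \<delta> n" if "i < k" "x \<in> topspace X" for n i x
  proof (rule LIMSEQ_le_const2)
    show "(\<lambda>m. \<bar>g m i x - g n i x\<bar>) \<longlonglongrightarrow> \<bar>G i x - g n i x\<bar>"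
      by (intro tendsto_intros lim that)
    show "\<exists>N. \<forall>m\<ge>N. \<bar>g m i x - g n i x\<bar> \<le> \<delta> n" using dist_le'[OF that] by blast
  qed
  show ?thesis
  proof
    fix i assume i: "i < k"
    show "continuous_map X euclideanreal (G i)"
      unfolding mtopology_is_euclidean[symmetric]
    proof (rule Met_TC.continuous_map_uniform_limit[where F = sequentially and f = "\<lambda>n. g n i"])
      show "\<forall>\<^sub>F n in sequentially. continuous_map X Met_TC.mtopology (g n i)"
        using gc[OF i] by simp
      fix e :: real assume e: "0 < e"
      have "\<forall>\<^sub>F n in sequentially. \<delta> n < e" using order_tendstoD(2)[OF \<delta>lim e] .
      then show "\<forall>\<^sub>F n in sequentially. \<forall>x\<in>topspace X. G i x \<in> UNIV \<and> dist (g n i x) (G i x) < e"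
      proof eventually_elim
        case (elim n)
        then show ?case using Gg[OF i, of _ n] by (force simp: dist_real_def abs_minus_commute)
      qed
    qed simp
    show "G i x \<in> {0..1}" if x: "x \<in> topspace X" for x
      using LIMSEQ_le_const[OF lim[OF i x], of 0] LIMSEQ_le_const2[OF lim[OF i x], of 1] g01[OF i x] by auto
  next
    fix \<U> assume "open_cover X \<U>"
    then obtain n where n: "refines (\<omega> n) \<U>" using cofinal by blast
    have "fibres_split X k f G (\<omega> n)" by (rule stable) (use Gg in blast)
    then show "fibres_split X k f G \<U>" using splits_refines[OF _ n] by (simp add: fibres_split_def)
  qed
qed

section \<open>From light maps to simplicial approximations\<close>

text \<open>The open vertex stars form the required cover of the polyhedron, so only the supports of
  the barycentric coordinates have to be small.\<close>

lemma omega_map_barycentric: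
  assumes K: "finite K" "abstract_complex K"
    and cont: "\<And>v. continuous_map X euclideanreal (\<lambda>x. \<kappa> x v)"
    and into: "\<And>x. x \<in> topspace X \<Longrightarrow> \<exists>s\<in>K. \<kappa> x \<in> closed_simplex s"
    and star: "\<And>v. v \<in> \<Union>K \<Longrightarrow> \<exists>U\<in>\<omega>. {x \<in> topspace X. 0 < \<kappa> x v} \<subseteq> U"
  shows "omega_map X \<omega> (polyhedron_of K) \<kappa>"
  unfolding omega_map_def
proof (intro conjI exI[of _ "(\<lambda>v. {a \<in> topspace (polyhedron_of K). 0 < a v}) ` \<Union>K"] ballI)
  have "continuous_map X (product_topology (\<lambda>i::nat. euclideanreal) UNIV) \<kappa>"
    using cont by (simp add: continuous_map_componentwise_UNIV)
  then show "continuous_map X (polyhedron_of K) \<kappa>"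
    unfolding polyhedron_of_finite[OF K(1)] euclidean_product_topology
    using into by (auto simp: continuous_map_in_subtopology)
  show "open_cover (polyhedron_of K) ((\<lambda>v. {a \<in> topspace (polyhedron_of K). 0 < a v}) ` \<Union>K)"
    unfolding open_cover_def
  proof (intro conjI ballI antisym subsetI)
    show "openin (polyhedron_of K) W" if "W \<in> (\<lambda>v. {a \<in> topspace (polyhedron_of K). 0 < a v}) ` \<Union>K" for W
      using that openin_real_less(2)[OF continuous_map_barycentric] by auto
    fix a assume a: "a \<in> topspace (polyhedron_of K)"
    then obtain v where "v \<in> support a" "support a \<in> K" "0 < a v"
      using support_in_complex[OF K(2) a] K(2)
      by (force simp: abstract_complex_def support_def closed_simplex_def order_less_le)
    then show "a \<in> \<Union>((\<lambda>v. {a \<in> topspace (polyhedron_of K). 0 < a v}) ` \<Union>K)" using a by blast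
  qed auto
  fix W assume "W \<in> (\<lambda>v. {a \<in> topspace (polyhedron_of K). 0 < a v}) ` \<Union>K"
  then obtain v where v: "v \<in> \<Union>K" "W = {a \<in> topspace (polyhedron_of K). 0 < a v}" by blast
  have "{x \<in> topspace X. \<kappa> x \<in> W} \<subseteq> {x \<in> topspace X. 0 < \<kappa> x v}" by (auto simp: v(2))
  then show "\<exists>U\<in>\<omega>. {x \<in> topspace X. \<kappa> x \<in> W} \<subseteq> U" using star[OF v(1)] by blast
qed

text \<open>If 0 is in \<open>U\<close>, the preimage merely gains the other pieces, which are open;
  otherwise it is cut down to \<open>W\<close>.\<close>

lemma continuous_map_disjoint_piece:
  fixes \<psi> :: "'a \<Rightarrow> real"
  assumes \<psi>: "continuous_map X euclideanreal \<psi>" and \<W>: "\<And>W. W \<in> \<W> \<Longrightarrow> openin X W" "pairwise disjnt \<W>"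
    and zero: "\<And>x. x \<in> topspace X \<Longrightarrow> x \<notin> \<Union>\<W> \<Longrightarrow> \<psi> x = 0" and W: "W \<in> \<W>"
  shows "continuous_map X euclideanreal (\<lambda>x. if x \<in> W then \<psi> x else 0)"
  unfolding continuous_map_def
proof (intro conjI allI impI)
  fix U :: "real set" assume U: "openin euclideanreal U"
  have pre: "openin X {x \<in> topspace X. \<psi> x \<in> U}" by (rule openin_continuous_map_preimage[OF \<psi> U])
  have dis: "x \<notin> W" if "x \<in> W'" "W' \<in> \<W> - {W}" for x W'
    using that W \<W>(2) by (auto simp: pairwise_def disjnt_def)
  show "openin X {x \<in> topspace X. (if x \<in> W then \<psi> x else 0) \<in> U}"
  proof (cases "0 \<in> U")
    case True
    have "{x \<in> topspace X. (if x \<in> W then \<psi> x else 0) \<in> U} = {x \<in> topspace X. \<psi> x \<in> U} \<union> \<Union>(\<W> - {W})"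
    proof (intro antisym subsetI)
      fix x assume x: "x \<in> {x \<in> topspace X. (if x \<in> W then \<psi> x else 0) \<in> U}"
      then show "x \<in> {x \<in> topspace X. \<psi> x \<in> U} \<union> \<Union>(\<W> - {W})"
        using zero[of x] True by (cases "x \<in> W"; cases "x \<in> \<Union>\<W>") auto
    next
      fix x assume x: "x \<in> {x \<in> topspace X. \<psi> x \<in> U} \<union> \<Union>(\<W> - {W})"
      then have "x \<in> topspace X" using \<W>(1) openin_subset by fastforce
      then show "x \<in> {x \<in> topspace X. (if x \<in> W then \<psi> x else 0) \<in> U}"
        using x True dis by auto
    qed
    moreover have "openin X (\<Union>(\<W> - {W}))" using \<W>(1) by blast
    ultimately show ?thesis using openin_Un[OF pre] by simp
  next
    case False
    then have "{x \<in> topspace X. (if x \<in> W then \<psi> x else 0) \<in> U} = {x \<in> topspace X. \<psi> x \<in> U} \<inter> W"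
      by auto
    then show ?thesis using openin_Int[OF pre \<W>(1)[OF W]] by simp
  qed
qed simp

section \<open>Stick breaking and grid bumps\<close>

lemma sum_stick_breaking:
  fixes t :: "nat \<Rightarrow> real"
  shows "(\<Sum>j<n. t j * (\<Prod>l<j. 1 - t l)) = 1 - (\<Prod>j<n. 1 - t j)"
  by (induction n) (auto simp: algebra_simps)

text \<open>The weights vanish behind the first index with \<open>t j = 1\<close>, so all indices
  before the last nonzero weight have \<open>t j \<noteq> 1\<close>. \<open>Suc\<close> counts that
  last weight: it is the one piece granted to each vertex, the others form the excess.\<close>

lemma card_stick_breaking_le:
  fixes t :: "nat \<Rightarrow> real"
  shows "card {j. j < n \<and> t j * (\<Prod>l<j. 1 - t l) \<noteq> 0} \<le> Suc (card {j. j < n \<and> t j \<noteq> 1})"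
proof (cases "{j. j < n \<and> t j * (\<Prod>l<j. 1 - t l) \<noteq> 0} = {}")
  case False
  let ?S = "{j. j < n \<and> t j * (\<Prod>l<j. 1 - t l) \<noteq> 0}"
  define j where "j = Max ?S"
  have fin: "finite ?S" by simp
  have j: "j \<in> ?S" unfolding j_def using fin False by (rule Max_in)
  have "?S \<subseteq> {..j}" using Max_ge[OF fin] by (auto simp: j_def)
  then have "card ?S \<le> Suc j" using card_mono[of "{..j}" ?S] by simp
  moreover have "{..<j} \<subseteq> {j. j < n \<and> t j \<noteq> 1}" using j by auto
  then have "j \<le> card {j. j < n \<and> t j \<noteq> 1}" using card_mono[of "{j. j < n \<and> t j \<noteq> 1}" "{..<j}"] by simp
  ultimately show ?thesis by linarith
qed (simp only: card.empty)

text \<open>The factor \<open>2 * real M\<close> matches the radius in \<open>near_grid\<close>: for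
  \<open>M > 0\<close> the bump is 1 as soon as no coordinate is near the grid, while it vanishes
  where some coordinate is on it.\<close>

definition grid_bump :: "nat \<Rightarrow> nat \<Rightarrow> nat \<Rightarrow> (nat \<Rightarrow> real) \<Rightarrow> real" where
  "grid_bump k M q t = (\<Prod>i<k. min 1 (2 * real M * infdist (t i - real q / real M) \<int>))"

lemma grid_bump_bounds: "0 \<le> grid_bump k M q t" "grid_bump k M q t \<le> 1"
  unfolding grid_bump_def by (auto intro!: prod_nonneg prod_le_1 simp: infdist_nonneg)

lemma grid_bump_off_grid:
  assumes "grid_bump k M q t \<noteq> 0" "i < k"
  shows "t i - real q / real M \<notin> \<int>"
proof
  assume "t i - real q / real M \<in> \<int>"
  then have "infdist (t i - real q / real M) \<int> = 0" by simp
  then have "\<exists>i\<in>{..<k}. min 1 (2 * real M * infdist (t i - real q / real M) \<int>) = 0"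
    using assms(2) by (intro bexI[of _ i]) simp_all
  then have "grid_bump k M q t = 0" unfolding grid_bump_def by (simp add: prod_zero)
  then show False using assms(1) by simp
qed

text \<open>Each of the \<open>k\<close> coordinates is close to at most one of the \<open>M\<close> shifted grids.\<close>

lemma card_grid_bump_le: "card {q. q < M \<and> grid_bump k M q t \<noteq> 1} \<le> k"
proof -
  have "\<exists>i<k. near_grid M q (t i)" if q: "q < M" "grid_bump k M q t \<noteq> 1" for q
  proof (rule ccontr)
    assume "\<not> ?thesis"
    then have "1 / (2 * real M) \<le> infdist (t i - real q / real M) \<int>" if "i < k" for i
      using that by (metis near_grid_def not_less)
    then have "min 1 (2 * real M * infdist (t i - real q / real M) \<int>) = 1" if "i < k" for i
      using that q(1) by (simp add: field_simps min_def)
    then have "grid_bump k M q t = 1" unfolding grid_bump_def by (intro prod.neutral) auto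
    then show False using q(2) by simp
  qed
  then have "{q. q < M \<and> grid_bump k M q t \<noteq> 1} \<subseteq> {q. q < M \<and> (\<exists>i<k. near_grid M q (t i))}" by blast
  then have "card {q. q < M \<and> grid_bump k M q t \<noteq> 1} \<le> card {q. q < M \<and> (\<exists>i<k. near_grid M q (t i))}"
    by (intro card_mono) auto
  then show ?thesis using card_near_grid_le[of M k t] by simp
qed

lemma continuous_map_grid_bump:
  assumes "\<And>i. i < k \<Longrightarrow> continuous_map X euclideanreal (\<lambda>x. t x i)"
  shows "continuous_map X euclideanreal (\<lambda>x. grid_bump k M q (t x))"
proof -
  have "continuous_map X euclideanreal (\<lambda>x. infdist (t x i - real q / real M) \<int>)" if "i < k" for i
  proof -
    have "continuous_map X euclideanreal (\<lambda>x. t x i - real q / real M)"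
      using assms[OF that] by (intro continuous_intros) auto
    moreover have "continuous_map euclideanreal euclideanreal (\<lambda>u. infdist u \<int>)"
      by (auto intro!: continuous_intros)
    ultimately show ?thesis using continuous_map_compose[of X euclideanreal _ euclideanreal "\<lambda>u. infdist u \<int>"]
      by (simp add: o_def)
  qed
  then show ?thesis unfolding grid_bump_def
    by (intro continuous_map_prod continuous_map_real_min continuous_map_real_mult_left) auto
qed

lemma fibres_split_imp_approx:
  assumes X: "compactum X" and Y: "compactum Y" and f: "continuous_map X Y f"
    and g: "\<And>i. i < k \<Longrightarrow> continuous_map X euclideanreal (g i)"
    and g01: "\<And>i x. i < k \<Longrightarrow> x \<in> topspace X \<Longrightarrow> g i x \<in> {0..1}"
    and light: "\<And>\<omega>. open_cover X \<omega> \<Longrightarrow> fibres_split X k f g \<omega>"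
  shows "approx_by_simplicial_maps k X Y f"
  unfolding approx_by_simplicial_maps_def
proof (intro allI impI, elim conjE)
  fix \<omega>X \<omega>Y assume \<omega>X: "open_cover X \<omega>X" and \<omega>Y: "open_cover Y \<omega>Y"
  have cX: "compact_space X" and cY: "compact_space Y" and HY: "Hausdorff_space Y" and mY: "metrizable_space Y"
    using X Y by (auto simp: compactum_def metrizable_imp_Hausdorff_space)
  have fY: "f x \<in> topspace Y" if "x \<in> topspace X" for x
    using f that continuous_map_image_subset_topspace by blast
  obtain M d where "Metric_space M d" and Yd: "Y = Metric_space.mtopology M d"
    using mY unfolding metrizable_space_def by blast
  then interpret Metric_space M d by simp
  obtain \<delta> where \<delta>: "0 < \<delta>"
    "\<And>a. a \<in> topspace X \<Longrightarrow> splits X \<omega>X {x \<in> topspace X. d (f a) (f x) + (\<Sum>i<k. \<bar>g i a - g i x\<bar>) < \<delta>}"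
    using fibres_split_uniformly[OF cX f[unfolded Yd] g light[OF \<omega>X]] by blast
  \<comment> \<open>Half of \<delta> is spent on the variation of \<open>f\<close> over a member,
    the other half on the width of the grid cells.\<close>
  define \<U> where "\<U> = {W. openin Y W \<and> (\<exists>U\<in>\<omega>Y. W \<subseteq> U) \<and> (\<forall>y\<in>W. \<forall>z\<in>W. d y z < \<delta> / 2)}"
  have "\<exists>W\<in>\<U>. y \<in> W" if y: "y \<in> topspace Y" for y
  proof -
    have yM: "y \<in> M" using y by (simp add: Yd)
    obtain U where U: "U \<in> \<omega>Y" "openin Y U" "y \<in> U" using \<omega>Y y unfolding open_cover_def by blast
    have "d a b < \<delta> / 2" if "a \<in> mball y (\<delta> / 4)" "b \<in> mball y (\<delta> / 4)" for a b
      using that triangle[of a y b] commute[of a y] by simp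
    moreover have "openin Y (U \<inter> mball y (\<delta> / 4))" using U(2) by (simp add: Yd openin_Int)
    ultimately have "U \<inter> mball y (\<delta> / 4) \<in> \<U>" using U(1) unfolding \<U>_def by blast
    moreover have "y \<in> U \<inter> mball y (\<delta> / 4)" using U(3) yM \<delta>(1) by simp
    ultimately show ?thesis by (rule bexI[rotated])
  qed
  then have "open_cover Y \<U>" unfolding open_cover_def using openin_subset by (fastforce simp: \<U>_def)
  then obtain m :: nat and \<phi> where \<phi>c: "\<And>v. v < m \<Longrightarrow> continuous_map Y euclideanreal (\<phi> v)"
    and \<phi>0: "\<And>v y. v < m \<Longrightarrow> y \<in> topspace Y \<Longrightarrow> 0 \<le> \<phi> v y"
    and \<phi>U: "\<And>v. v < m \<Longrightarrow> \<exists>U\<in>\<U>. {y \<in> topspace Y. 0 < \<phi> v y} \<subseteq> U"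
    and \<phi>1: "\<And>y. y \<in> topspace Y \<Longrightarrow> (\<Sum>v<m. \<phi> v y) = 1"
    using finite_partition_of_unity[OF cY HY] by blast
  obtain n0 :: nat where n0: "2 * real k / \<delta> < real n0" using reals_Archimedean2 by blast
  define N where "N = real (Suc n0)"
  have N: "0 < N" "real k / N < \<delta> / 2" using n0 \<delta>(1) by (auto simp: N_def field_simps)
  \<comment> \<open>\<open>k + 1\<close> grids for each of the \<open>m\<close> vertices of
    \<open>L\<close>; \<open>idx\<close> numbers them injectively, so no two vertices share a
    shift.\<close>
  define Q where "Q = m * Suc k"
  define idx where "idx v j = v * Suc k + j" for v j
  have idxQ: "idx v j < Q" if "v < m" "j < Suc k" for v j
  proof -
    have "idx v j < Suc v * Suc k" using that by (simp add: idx_def)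
    also have "\<dots> \<le> Q" unfolding Q_def using that by (intro mult_le_mono1) simp
    finally show ?thesis .
  qed
  have idxinj: "v = v' \<and> j = j'" if "idx v j = idx v' j'" "j < Suc k" "j' < Suc k" for v j v' j'
  proof -
    have "idx v j div Suc k = v" "idx v' j' div Suc k = v'"
      using that(2,3) div_mult_self3[of "Suc k" _ v] by (simp_all add: idx_def del: mult_Suc_right)
    then have "v = v'" using that(1) by simp
    then show ?thesis using that(1) by (simp add: idx_def)
  qed
  define \<theta> where "\<theta> q x = grid_bump k Q q (\<lambda>i. N * g i x)" for q x
  have \<theta>c: "continuous_map X euclideanreal (\<theta> q)" for q
    unfolding \<theta>_def using g by (intro continuous_map_grid_bump continuous_map_real_mult_left) auto
  \<comment> \<open>Stick breaking over the grids of \<open>v\<close>: grid \<open>j\<close> takes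
    the share \<theta> of what the earlier grids left.\<close>
  define w where "w v j x = \<theta> (idx v j) x * (\<Prod>l<j. 1 - \<theta> (idx v l) x)" for v j x
  have w0: "0 \<le> w v j x" for v j x
    unfolding w_def \<theta>_def by (intro mult_nonneg_nonneg prod_nonneg) (auto simp: grid_bump_bounds)
  have wc: "continuous_map X euclideanreal (w v j)" for v j
    unfolding w_def by (intro continuous_intros \<theta>c continuous_map_prod) auto
  \<comment> \<open>The bound runs over all \<open>Q\<close> grids together, not over those of one
    \<open>v\<close>; this makes \<open>k\<close> the total excess.\<close>
  have bad: "card {q. q < Q \<and> \<theta> q x \<noteq> 1} \<le> k" for x unfolding \<theta>_def by (rule card_grid_bump_le)
  have w1: "(\<Sum>j<Suc k. w v j x) = 1" if v: "v < m" for v x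
  proof -
    \<comment> \<open>At most \<open>k\<close> of the \<open>k + 1\<close> bumps of \<open>v\<close>
      differ from 1, so the stick is used up.\<close>
    have "\<exists>j<Suc k. \<theta> (idx v j) x = 1"
    proof (rule ccontr)
      assume "\<not> ?thesis"
      then have "idx v ` {..<Suc k} \<subseteq> {q. q < Q \<and> \<theta> q x \<noteq> 1}" using idxQ[OF v] by auto
      then have "card (idx v ` {..<Suc k}) \<le> card {q. q < Q \<and> \<theta> q x \<noteq> 1}" by (intro card_mono) auto
      moreover have "card (idx v ` {..<Suc k}) = Suc k"
      proof -
        have "inj_on (idx v) {..<Suc k}"
        proof (rule inj_onI)
          fix j j' assume "j \<in> {..<Suc k}" "j' \<in> {..<Suc k}" "idx v j = idx v j'"
          then show "j = j'" using idxinj[of v j v j'] by simp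
        qed
        then show ?thesis by (simp add: card_image)
      qed
      ultimately show False using bad[of x] by simp
    qed
    then have "(\<Prod>j<Suc k. 1 - \<theta> (idx v j) x) = 0" by (intro prod_zero) auto
    then show ?thesis
      unfolding w_def using sum_stick_breaking[of "\<lambda>j. \<theta> (idx v j) x" "Suc k"] by simp
  qed
  define \<psi> where "\<psi> v j x = \<phi> v (f x) * w v j x" for v j x
  have \<phi>fc: "continuous_map X euclideanreal (\<lambda>x. \<phi> v (f x))" if "v < m" for v
    using continuous_map_compose[OF f \<phi>c[OF that]] by (simp add: o_def)
  have \<psi>c: "continuous_map X euclideanreal (\<psi> v j)" if "v < m" for v j
    unfolding \<psi>_def by (intro continuous_intros \<phi>fc wc that)
  have \<psi>0: "0 \<le> \<psi> v j x" if "v < m" "x \<in> topspace X" for v j x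
    unfolding \<psi>_def using \<phi>0[OF that(1) fY[OF that(2)]] w0 by simp
  have "\<exists>\<W>. finite \<W> \<and> (\<forall>W\<in>\<W>. openin X W \<and> (\<exists>U\<in>\<omega>X. W \<subseteq> U)) \<and> pairwise disjnt \<W> \<and>
      {x \<in> topspace X. \<psi> v j x \<noteq> 0} \<subseteq> \<Union>\<W>" if v: "v < m" for v j
  proof -
    define A where "A = {x \<in> topspace X. 0 < \<phi> v (f x)}"
    have "splits X \<omega>X {x\<in>A. \<forall>i<k. N * g i x - real (idx v j) / real Q \<notin> \<int>}"
    proof (rule splits_off_grid[OF _ g])
      show "openin X A" unfolding A_def by (rule openin_real_less[OF \<phi>fc[OF v]])
      show "\<bar>g i x\<bar> \<le> 1" if "i < k" "x \<in> topspace X" for i x using g01[OF that] by simp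
      fix a assume a: "a \<in> A"
      then have aX: "a \<in> topspace X" by (simp add: A_def)
      obtain U where U: "U \<in> \<U>" "{y \<in> topspace Y. 0 < \<phi> v y} \<subseteq> U" using \<phi>U[OF v] by blast
      have "d (f a) (f x) + (\<Sum>i<k. \<bar>g i a - g i x\<bar>) < \<delta>"
        if x: "x \<in> A" "\<forall>i<k. \<bar>g i a - g i x\<bar> \<le> 1 / N" for x
      proof -
        have "f a \<in> U" "f x \<in> U" using a x U(2) fY by (auto simp: A_def)
        then have "d (f a) (f x) < \<delta> / 2" using U(1) by (simp add: \<U>_def)
        moreover have "(\<Sum>i<k. \<bar>g i a - g i x\<bar>) \<le> (\<Sum>i<k. 1 / N)" using x(2) by (intro sum_mono) auto
        moreover have "(\<Sum>i<k. 1 / N) = real k / N" by simp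
        ultimately show ?thesis using N(2) by linarith
      qed
      then show "splits X \<omega>X {x \<in> A. \<forall>i<k. \<bar>g i a - g i x\<bar> \<le> 1 / N}"
        by (intro splits_mono[OF \<delta>(2)[OF aX]]) (auto simp: A_def)
    qed (use N in auto)
    moreover have "{x \<in> topspace X. \<psi> v j x \<noteq> 0} \<subseteq> {x\<in>A. \<forall>i<k. N * g i x - real (idx v j) / real Q \<notin> \<int>}"
    proof (intro subsetI CollectI conjI allI impI)
      fix x assume x: "x \<in> {x \<in> topspace X. \<psi> v j x \<noteq> 0}"
      then have "\<phi> v (f x) \<noteq> 0" and \<theta>: "\<theta> (idx v j) x \<noteq> 0" by (auto simp: \<psi>_def w_def)
      then show "x \<in> A" using x \<phi>0[OF v fY, of x] by (simp add: A_def)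
      show "N * g i x - real (idx v j) / real Q \<notin> \<int>" if "i < k" for i
        using grid_bump_off_grid[OF \<theta>[unfolded \<theta>_def] that] .
    qed
    ultimately have "splits X \<omega>X {x \<in> topspace X. \<psi> v j x \<noteq> 0}" by (rule splits_mono)
    then show ?thesis by (simp add: splits_def)
  qed
  then have "\<forall>e\<in>{..<m} \<times> UNIV. \<exists>\<W>. finite \<W> \<and> (\<forall>W\<in>\<W>. openin X W \<and> (\<exists>U\<in>\<omega>X. W \<subseteq> U)) \<and> pairwise disjnt \<W> \<and>
      {x \<in> topspace X. \<psi> (fst e) (snd e) x \<noteq> 0} \<subseteq> \<Union>\<W>" by simp
  from bchoice[OF this] obtain \<W>' where \<W>': "\<forall>e\<in>{..<m} \<times> UNIV. finite (\<W>' e) \<and>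
      (\<forall>W\<in>\<W>' e. openin X W \<and> (\<exists>U\<in>\<omega>X. W \<subseteq> U)) \<and> pairwise disjnt (\<W>' e) \<and>
      {x \<in> topspace X. \<psi> (fst e) (snd e) x \<noteq> 0} \<subseteq> \<Union>(\<W>' e)" ..
  define \<W> where "\<W> v j = \<W>' (v, j)" for v and j :: nat
  have \<W>: "finite (\<W> v j)" "pairwise disjnt (\<W> v j)" "{x \<in> topspace X. \<psi> v j x \<noteq> 0} \<subseteq> \<Union>(\<W> v j)"
    and \<W>o: "W \<in> \<W> v j \<Longrightarrow> openin X W" "W \<in> \<W> v j \<Longrightarrow> \<exists>U\<in>\<omega>X. W \<subseteq> U" if "v < m" for v j W
    using \<W>'[THEN bspec, of "(v, j)"] that by (auto simp: \<W>_def)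
  \<comment> \<open>The vertices of \<open>K\<close> are the pieces: a vertex of \<open>L\<close>,
    one of its grids, and a member of the disjoint family for that grid.\<close>
  define E where "E = (SIGMA v:{..<m}. SIGMA j:{..<Suc k}. \<W> v j)"
  have finE: "finite E" unfolding E_def using \<W>(1) by (intro finite_SigmaI) auto
  define n where "n = card E"
  obtain h where h: "bij_betw h {..<n} E"
    using ex_bij_betw_nat_finite[OF finE] by (auto simp: lessThan_atLeast0 n_def)
  define vx where "vx i = fst (h i)" for i
  define jx where "jx i = fst (snd (h i))" for i
  define Wx where "Wx i = snd (snd (h i))" for i
  have hE: "vx i < m" "jx i < Suc k" "Wx i \<in> \<W> (vx i) (jx i)" if "i < n" for i
  proof -
    have "h i \<in> E" using h that by (auto simp: bij_betw_def)
    then show "vx i < m" "jx i < Suc k" "Wx i \<in> \<W> (vx i) (jx i)"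
      by (auto simp: E_def vx_def jx_def Wx_def)
  qed
  define \<kappa> where "\<kappa> x i = (if i < n then if x \<in> Wx i then \<psi> (vx i) (jx i) x else 0 else 0)" for x i
  have \<kappa>c: "continuous_map X euclideanreal (\<lambda>x. \<kappa> x i)" for i
  proof (cases "i < n")
    case True
    have "continuous_map X euclideanreal (\<lambda>x. if x \<in> Wx i then \<psi> (vx i) (jx i) x else 0)"
      by (rule continuous_map_disjoint_piece[OF \<psi>c[OF hE(1)] \<W>o(1)[OF hE(1)] \<W>(2)[OF hE(1)] _ hE(3)])
        (use True \<W>(3)[OF hE(1)[OF True]] in auto)
    then show ?thesis using True by (simp add: \<kappa>_def)
  qed (simp add: \<kappa>_def)
  have \<kappa>0: "0 \<le> \<kappa> x i" if "x \<in> topspace X" for x i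
    using \<psi>0 hE(1) that by (auto simp: \<kappa>_def)
  \<comment> \<open>This is the commutation with \<open>p\<close>: each grid of \<open>v\<close>
    contributes its weight through at most one piece at \<open>x\<close>, and the grid weights sum
    to 1.\<close>
  have \<kappa>sum: "(\<Sum>i\<in>{i\<in>{..<n}. vx i = v}. \<kappa> x i) = \<phi> v (f x)" if v: "v < m" and x: "x \<in> topspace X" for v x
  proof -
    define c where "c e = (case e of (u, j, W) \<Rightarrow> if u = v then if x \<in> W then \<psi> u j x else 0 else 0)" for e
    have piece: "(\<Sum>W\<in>\<W> v j. if x \<in> W then \<psi> v j x else 0) = \<psi> v j x" for j
    proof (cases "\<psi> v j x = 0")
      case False
      then obtain W0 where W0: "W0 \<in> \<W> v j" "x \<in> W0" using \<W>(3)[OF v] x by blast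
      have "x \<in> W \<longleftrightarrow> W = W0" if "W \<in> \<W> v j" for W
        using that W0 \<W>(2)[OF v, of j] by (auto simp: pairwise_def disjnt_def)
      then have "(\<Sum>W\<in>\<W> v j. if x \<in> W then \<psi> v j x else 0) = (\<Sum>W\<in>\<W> v j. if W = W0 then \<psi> v j x else 0)"
        by (intro sum.cong) auto
      then show ?thesis using W0(1) \<W>(1)[OF v] by simp
    next
      case True
      show ?thesis unfolding True by simp
    qed
    have "(\<Sum>i\<in>{i\<in>{..<n}. vx i = v}. \<kappa> x i) = (\<Sum>i<n. if vx i = v then \<kappa> x i else 0)"
      by (rule sum.inter_filter) simp
    also have "\<dots> = (\<Sum>i<n. c (h i))"
      by (rule sum.cong) (auto simp: c_def \<kappa>_def vx_def jx_def Wx_def split: prod.splits)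
    also have "\<dots> = (\<Sum>e\<in>E. c e)" by (rule sum.reindex_bij_betw[OF h])
    also have "\<dots> = (\<Sum>u<m. \<Sum>r\<in>(SIGMA j:{..<Suc k}. \<W> u j). c (u, r))"
      unfolding E_def by (subst sum.Sigma) (use \<W>(1) in auto)
    also have "\<dots> = (\<Sum>u<m. if u = v then \<phi> v (f x) else 0)"
    proof (rule sum.cong)
      fix u assume u: "u \<in> {..<m}"
      have "(\<Sum>r\<in>(SIGMA j:{..<Suc k}. \<W> u j). c (u, r)) = (\<Sum>j<Suc k. \<Sum>W\<in>\<W> u j. c (u, j, W))"
        by (subst sum.Sigma) (use \<W>(1) u in auto)
      also have "\<dots> = (if u = v then \<phi> v (f x) else 0)"
      proof (cases "u = v")
        case True
        then have "(\<Sum>j<Suc k. \<Sum>W\<in>\<W> u j. c (u, j, W)) = (\<Sum>j<Suc k. \<psi> v j x)"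
          using piece by (simp add: c_def)
        also have "\<dots> = \<phi> v (f x) * (\<Sum>j<Suc k. w v j x)" unfolding \<psi>_def sum_distrib_left ..
        finally show ?thesis using True w1[OF v] by simp
      qed (simp add: c_def)
      finally show "(\<Sum>r\<in>(SIGMA j:{..<Suc k}. \<W> u j). c (u, r)) = (if u = v then \<phi> v (f x) else 0)" .
    qed simp
    also have "\<dots> = \<phi> v (f x)" using v by simp
    finally show ?thesis .
  qed
  define K where "K = {s. s \<noteq> {} \<and> s \<subseteq> {..<n} \<and> card s \<le> card (vx ` s) + k}"
  define L where "L = {t. t \<noteq> {} \<and> t \<subseteq> {..<m}}"
  have finK: "finite K" by (rule finite_subset[of _ "Pow {..<n}"]) (auto simp: K_def)
  have finL: "finite L" by (rule finite_subset[of _ "Pow {..<m}"]) (auto simp: L_def)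
  have aK: "abstract_complex K"
    unfolding abstract_complex_def
  proof (intro ballI conjI allI impI)
    fix s assume s: "s \<in> K"
    then show fs: "finite s" using finite_subset by (auto simp: K_def)
    show "s \<noteq> {}" using s by (simp add: K_def)
    fix t assume t: "t \<subseteq> s \<and> t \<noteq> {}"
    have ft: "finite t" using fs t finite_subset by blast
    \<comment> \<open>Each removed vertex takes at most one image vertex with it, so the excess over
      the image does not grow on faces.\<close>
    have "vx ` s \<subseteq> vx ` t \<union> vx ` (s - t)" by blast
    then have "card (vx ` s) \<le> card (vx ` t \<union> vx ` (s - t))" using fs ft by (intro card_mono) auto
    also have "\<dots> \<le> card (vx ` t) + card (vx ` (s - t))" by (rule card_Un_le)
    also have "card (vx ` (s - t)) \<le> card (s - t)" using fs by (intro card_image_le) auto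
    also have "card (s - t) = card s - card t" using ft t by (intro card_Diff_subset) auto
    finally have "card (vx ` s) \<le> card (vx ` t) + (card s - card t)" by simp
    moreover have "card t \<le> card s" using fs t by (intro card_mono) auto
    moreover have "card s \<le> card (vx ` s) + k" using s by (simp add: K_def)
    ultimately have "card t \<le> card (vx ` t) + k" by linarith
    then show "t \<in> K" using s t by (auto simp: K_def)
  qed
  have aL: "abstract_complex L"
    unfolding abstract_complex_def L_def using finite_subset by fastforce
  have \<kappa>K: "support (\<kappa> x) \<in> K \<and> \<kappa> x \<in> closed_simplex (support (\<kappa> x))" if x: "x \<in> topspace X" for x
  proof -
    define s where "s = support (\<kappa> x)"
    have sn: "s \<subseteq> {..<n}" by (auto simp: s_def support_def \<kappa>_def split: if_splits)
    have "(\<Sum>i<n. \<kappa> x i) = (\<Sum>v<m. \<Sum>i\<in>{i\<in>{..<n}. vx i = v}. \<kappa> x i)"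
      by (rule sum.group[symmetric]) (use hE(1) in auto)
    also have "\<dots> = 1" using \<kappa>sum[OF _ x] \<phi>1[OF fY[OF x]] by simp
    finally have "\<kappa> x \<in> closed_simplex {..<n}"
      using \<kappa>0[OF x] by (auto simp: closed_simplex_def \<kappa>_def)
    from closed_simplex_support[OF this]
    have s: "s \<noteq> {}" "\<kappa> x \<in> closed_simplex s" by (auto simp: s_def)
    have fs: "finite s" using sn finite_subset by blast
    have sD: "i < n" "x \<in> Wx i" "w (vx i) (jx i) x \<noteq> 0" if "i \<in> s" for i
      using that by (auto simp: s_def support_def \<kappa>_def \<psi>_def split: if_splits)
    define B where "B v = {j. j < Suc k \<and> w v j x \<noteq> 0}" for v
    define B' where "B' v = {j. j < Suc k \<and> \<theta> (idx v j) x \<noteq> 1}" for v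
    have BB': "card (B v) \<le> Suc (card (B' v))" for v
      unfolding B_def B'_def w_def by (rule card_stick_breaking_le)
    have "inj_on (\<lambda>i. (vx i, jx i)) s"
    proof (rule inj_onI)
      fix i i' assume i: "i \<in> s" "i' \<in> s" and eq: "(vx i, jx i) = (vx i', jx i')"
      have "Wx i \<in> \<W> (vx i) (jx i)" "Wx i' \<in> \<W> (vx i) (jx i)"
        using hE(3)[OF sD(1)[OF i(1)]] hE(3)[OF sD(1)[OF i(2)]] eq by simp_all
      moreover have "x \<in> Wx i" "x \<in> Wx i'" using sD(2) i by auto
      ultimately have "Wx i = Wx i'"
        using \<W>(2)[OF hE(1)[OF sD(1)[OF i(1)]], of "jx i"] by (auto simp: pairwise_def disjnt_def)
      then have "h i = h i'" using eq by (auto simp: vx_def jx_def Wx_def prod_eq_iff)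
      then show "i = i'" using h sD(1) i by (auto simp: bij_betw_def inj_on_def)
    qed
    then have "card s = card ((\<lambda>i. (vx i, jx i)) ` s)" by (simp add: card_image)
    also have "\<dots> \<le> card (SIGMA v:vx ` s. B v)"
      using fs hE(2) sD by (intro card_mono finite_SigmaI) (auto simp: B_def)
    also have "\<dots> = (\<Sum>v\<in>vx ` s. card (B v))" using fs by (intro card_SigmaI) (auto simp: B_def)
    also have "\<dots> \<le> (\<Sum>v\<in>vx ` s. 1 + card (B' v))" using BB' by (intro sum_mono) simp
    also have "\<dots> = card (vx ` s) + (\<Sum>v\<in>vx ` s. card (B' v))" by (simp add: sum_Suc)
    also have "(\<Sum>v\<in>vx ` s. card (B' v)) = card (SIGMA v:vx ` s. B' v)"
      using fs by (intro card_SigmaI[symmetric]) (auto simp: B'_def)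
    also have "card (SIGMA v:vx ` s. B' v) \<le> card {q. q < Q \<and> \<theta> q x \<noteq> 1}"
    proof (rule card_inj_on_le)
      show "inj_on (\<lambda>(v, j). idx v j) (SIGMA v:vx ` s. B' v)"
      proof (rule inj_onI)
        fix r r' assume r: "r \<in> (SIGMA v:vx ` s. B' v)" "r' \<in> (SIGMA v:vx ` s. B' v)"
          and eq: "(\<lambda>(v, j). idx v j) r = (\<lambda>(v, j). idx v j) r'"
        have "snd r < Suc k" "snd r' < Suc k" using r by (auto simp: B'_def)
        then show "r = r'" using idxinj[of "fst r" "snd r" "fst r'" "snd r'"] eq
          by (simp add: case_prod_unfold prod_eq_iff)
      qed
      show "(\<lambda>(v, j). idx v j) ` (SIGMA v:vx ` s. B' v) \<subseteq> {q. q < Q \<and> \<theta> q x \<noteq> 1}"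
        using idxQ hE(1) sD(1) by (auto simp: B'_def)
    qed simp
    also have "\<dots> \<le> k" by (rule bad)
    finally have "card s \<le> card (vx ` s) + k" by simp
    then show ?thesis using s sn by (simp add: K_def s_def)
  qed
  define \<kappa>Y where "\<kappa>Y y v = (if v < m then \<phi> v y else 0)" for y v
  define p :: "(nat \<Rightarrow> real) \<Rightarrow> nat \<Rightarrow> real" where "p = (\<lambda>a v. \<Sum>i\<in>{i\<in>{..<n}. vx i = v}. a i)"
  have vxL: "vx ` s \<in> L" if "s \<in> K" for s using that hE(1) by (auto simp: K_def L_def)
  show "\<exists>K L \<kappa>X \<kappa>Y p. admissible_complex K \<and> admissible_complex L \<and>
      omega_map X \<omega>X (polyhedron_of K) \<kappa>X \<and> omega_map Y \<omega>Y (polyhedron_of L) \<kappa>Y \<and>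
      simplicial_map K L p \<and> map_dim_le (polyhedron_of K) (polyhedron_of L) p k \<and>
      (\<forall>x\<in>topspace X. p (\<kappa>X x) = \<kappa>Y (f x))"
  proof (intro exI conjI ballI)
    show "admissible_complex K" "admissible_complex L"
      using finite_imp_admissible_complex finK finL aK aL by auto
    show "simplicial_map K L p"
      by (rule vertex_map_simplicial[OF finK aK _ _ vxL finL p_def]) (auto simp: K_def)
    show "map_dim_le (polyhedron_of K) (polyhedron_of L) p k"
      by (rule vertex_map_dim_le[OF finK aK _ _ p_def]) (auto simp: K_def)
    show "omega_map X \<omega>X (polyhedron_of K) \<kappa>"
    proof (rule omega_map_barycentric[OF finK aK \<kappa>c])
      show "\<exists>s\<in>K. \<kappa> x \<in> closed_simplex s" if "x \<in> topspace X" for x using \<kappa>K[OF that] by blast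
      fix i assume "i \<in> \<Union>K"
      then have i: "i < n" by (auto simp: K_def)
      obtain U where "U \<in> \<omega>X" "Wx i \<subseteq> U" using \<W>o(2)[OF hE(1)[OF i] hE(3)[OF i]] by blast
      moreover have "{x \<in> topspace X. 0 < \<kappa> x i} \<subseteq> Wx i" by (auto simp: \<kappa>_def split: if_splits)
      ultimately show "\<exists>U\<in>\<omega>X. {x \<in> topspace X. 0 < \<kappa> x i} \<subseteq> U" by blast
    qed
    show "omega_map Y \<omega>Y (polyhedron_of L) \<kappa>Y"
    proof (rule omega_map_barycentric[OF finL aL])
      show "continuous_map Y euclideanreal (\<lambda>y. \<kappa>Y y v)" for v
        using \<phi>c by (cases "v < m") (auto simp: \<kappa>Y_def)
      show "\<exists>s\<in>L. \<kappa>Y y \<in> closed_simplex s" if y: "y \<in> topspace Y" for y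
      proof (intro bexI[of _ "{..<m}"])
        show "\<kappa>Y y \<in> closed_simplex {..<m}" using \<phi>0 \<phi>1 y by (auto simp: \<kappa>Y_def closed_simplex_def)
        have "m \<noteq> 0" using \<phi>1[OF y] by (intro notI) simp
        then show "{..<m} \<in> L" by (auto simp: L_def)
      qed
      fix v assume "v \<in> \<Union>L"
      then have v: "v < m" by (auto simp: L_def)
      obtain U where U: "U \<in> \<U>" "{y \<in> topspace Y. 0 < \<phi> v y} \<subseteq> U" using \<phi>U[OF v] by blast
      then obtain U' where "U' \<in> \<omega>Y" "U \<subseteq> U'" by (auto simp: \<U>_def)
      then show "\<exists>U\<in>\<omega>Y. {y \<in> topspace Y. 0 < \<kappa>Y y v} \<subseteq> U"
        using U(2) v by (intro bexI[of _ U']) (auto simp: \<kappa>Y_def)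
    qed
    fix x assume x: "x \<in> topspace X"
    show "p (\<kappa> x) = \<kappa>Y (f x)"
    proof
      fix v
      show "p (\<kappa> x) v = \<kappa>Y (f x) v"
      proof (cases "v < m")
        case True
        then show ?thesis using \<kappa>sum[OF True x] by (simp add: p_def \<kappa>Y_def)
      next
        case False
        then have "{i\<in>{..<n}. vx i = v} = {}" using hE(1) by blast
        then show ?thesis using False unfolding p_def \<kappa>Y_def by (simp only: sum.empty if_False)
      qed
    qed
  qed
qed

theorem theorem1p4:
  fixes X :: "'a topology" and Y :: "'b topology" and f :: "'a \<Rightarrow> 'b" and k :: nat
  assumes "compactum X" and "compactum Y" and "continuous_map X Y f"
  shows "approx_by_simplicial_maps k X Y f \<longleftrightarrow>
    (\<exists>g. continuous_map X (cube k) g \<and>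
         map_dim_le X (prod_topology Y (cube k)) (diagonal_product f g) 0)"
proof
  have cX: "compact_space X" and HX: "Hausdorff_space X" and HY: "Hausdorff_space Y"
    using assms by (auto simp: compactum_def metrizable_imp_Hausdorff_space)
  show "\<exists>g. continuous_map X (cube k) g \<and> map_dim_le X (prod_topology Y (cube k)) (diagonal_product f g) 0"
    if approx: "approx_by_simplicial_maps k X Y f"
  proof -
    obtain g where g: "\<And>i. i < k \<Longrightarrow> continuous_map X euclideanreal (g i)"
      and g01: "\<And>i x. i < k \<Longrightarrow> x \<in> topspace X \<Longrightarrow> g i x \<in> {0..1}"
      and light: "\<And>\<omega>. open_cover X \<omega> \<Longrightarrow> fibres_split X k f g \<omega>"
      using uniform_limit_fibres_split[OF assms approx] by blast
    \<comment> \<open>Points of \<open>cube k\<close> are extensional functions, hence the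
      restriction.\<close>
    define G where "G x = (\<lambda>i\<in>{..<k}. g i x)" for x
    have "continuous_map X (cube k) G"
      using g g01 unfolding cube_def continuous_map_componentwise
      by (auto simp: G_def continuous_map_in_subtopology)
    moreover have "map_dim_le X (prod_topology Y (cube k)) (diagonal_product f G) 0"
      unfolding map_dim_le_def
    proof
      fix y
      define F where "F = {x \<in> topspace X. diagonal_product f G x = y}"
      \<comment> \<open>A \<open>joint_fibre\<close> is given by one of its points, so empty fibres
        are treated apart.\<close>
      have "closedin X F \<and> (\<forall>\<omega>. open_cover X \<omega> \<longrightarrow> splits X \<omega> F)"
      proof (cases "F = {}")
        case False
        then obtain a where a: "a \<in> F" by blast
        have "G x = G a \<longleftrightarrow> (\<forall>i<k. g i x = g i a)" for x
          by (auto simp: G_def fun_eq_iff restrict_def)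
        then have "F = joint_fibre X k f g a"
          using a by (auto simp: F_def joint_fibre_def diagonal_product_def)
        moreover have "a \<in> topspace X" using a by (simp add: F_def)
        ultimately show ?thesis
          using closedin_joint_fibre[OF assms(3) HY, where g = g and k = k and a = a] g light
          unfolding fibres_split_def by simp
      qed simp
      then show "covering_dim_le (subtopology X {x \<in> topspace X. diagonal_product f G x = y}) 0"
        using splits_imp_covering_dim_0[of X F] by (simp add: F_def)
    qed
    ultimately show ?thesis by blast
  qed
  show "approx_by_simplicial_maps k X Y f"
    if "\<exists>g. continuous_map X (cube k) g \<and> map_dim_le X (prod_topology Y (cube k)) (diagonal_product f g) 0"
  proof -
    from that obtain G where "continuous_map X (cube k) G \<and>
        map_dim_le X (prod_topology Y (cube k)) (diagonal_product f G) 0" ..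
    then have G: "continuous_map X (cube k) G"
      and dim: "map_dim_le X (prod_topology Y (cube k)) (diagonal_product f G) 0" by simp_all
    have ext: "G x \<in> extensional {..<k}" if "x \<in> topspace X" for x
      using G that unfolding cube_def continuous_map_componentwise by auto
    have Gi: "continuous_map X (top_of_set {0..1}) (\<lambda>x. G x i)" if "i < k" for i
      using G that unfolding cube_def continuous_map_componentwise by auto
    have g: "continuous_map X euclideanreal (\<lambda>x. G x i)" if "i < k" for i
      using Gi[OF that] by (simp add: continuous_map_in_subtopology)
    show ?thesis
    proof (rule fibres_split_imp_approx[OF assms, where g = "\<lambda>i x. G x i"])
      show "G x i \<in> {0..1}" if "i < k" "x \<in> topspace X" for i x
        using continuous_map_image_subset_topspace[OF Gi[OF that(1)]] that(2) by auto
      fix \<omega> assume \<omega>: "open_cover X \<omega>"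
      show "fibres_split X k f (\<lambda>i x. G x i) \<omega>"
        unfolding fibres_split_def
      proof
        fix a assume a: "a \<in> topspace X"
        have "G x = G a \<longleftrightarrow> (\<forall>i<k. G x i = G a i)" if "x \<in> topspace X" for x
          using extensionalityI[OF ext[OF that] ext[OF a]] by auto
        then have F: "joint_fibre X k f (\<lambda>i x. G x i) a = {x \<in> topspace X. diagonal_product f G x = (f a, G a)}"
          by (auto simp: joint_fibre_def diagonal_product_def)
        have "(f a, G a) \<in> topspace (prod_topology Y (cube k))"
          using a continuous_map_image_subset_topspace[OF G] continuous_map_image_subset_topspace[OF assms(3)] by auto
        then have "covering_dim_le (subtopology X (joint_fibre X k f (\<lambda>i x. G x i) a)) 0"
          using dim unfolding map_dim_le_def F by blast
        then show "splits X \<omega> (joint_fibre X k f (\<lambda>i x. G x i) a)"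
          using closedin_joint_fibre[OF assms(3) HY, where g = "\<lambda>i x. G x i" and k = k and a = a] g
          by (intro covering_dim_0_imp_splits[OF cX HX \<omega>]) simp_all
      qed
    qed (rule g)
  qed
qed

end
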